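(* A simplicial map $f\colon Y\to X$ between simplicial spaces is culf if and only if $\mathrm{Sd}(f)\colon\mathrm{Sd}(Y)\to\mathrm{Sd}(X)$ is a right fibration.
   Context: All notions are $\infty$-categorical. $\mathcal S$ is the $\infty$-category of spaces; a simplicial space is an object of $s\mathcal S=\mathrm{Fun}(\Delta^{op},\mathcal S)$. A simplicial map is a right fibration if it is cartesian, as a natural transformation, on all maps $\ell\colon[m]\to[n]$ in $\Delta$ with $\ell(m)=n$. It is culf if it is cartesian on all active maps, i.e. maps $g\colon[k]\to[n]$ with $g(0)=0$ and $g(k)=n$. The edgewise subdivision is $\mathrm{Sd}=Q^*\colon s\mathcal S\to s\mathcal S$, $\mathrm{Sd}(X)=X\circ Q^{op}$, where $Q\colon\Delta\to\Delta$ is $[n]\mapsto[n]^{op}\star[n]=[2n+1]$. *)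

theory Defs
  imports Main "HOL-Library.FuncSet"
begin

text \<open>
  The model of \<open>\<infinity>\<close>-categories is that of quasi-categories: \<open>\<infinity>\<close>-categories are simplicial sets,
  functor \<open>\<infinity>\<close>-categories are internal homs of simplicial sets, limits are terminal objects of
  slices, and the \<open>\<infinity>\<close>-category of spaces is the homotopy coherent nerve of the simplicial
  category of Kan complexes. In particular a simplicial space below is a homotopy coherent
  diagram, and not a strict simplicial object in Kan complexes.
\<close>


section \<open>Simplicial sets\<close>

text \<open>
  All functions that serve as elements of some set of simplices or morphisms are extensional
  (equal to \<^const>\<open>undefined\<close> outside their domain), so that equality in HOL is the intended one.
\<close>

definition chains :: "'v set \<Rightarrow> ('v \<Rightarrow> 'v \<Rightarrow> bool) \<Rightarrow> nat \<Rightarrow> (nat \<Rightarrow> 'v) set" where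
  "chains A r n = {s \<in> {..n} \<rightarrow>\<^sub>E A. monotone_on {..n} (\<le>) r s}"

text \<open>\<open>Delta m n\<close> is the set of maps \<open>[m] \<rightarrow> [n]\<close> of the simplex category, where \<open>[n]\<close> is \<open>{..n}\<close>.\<close>

definition Delta :: "nat \<Rightarrow> nat \<Rightarrow> (nat \<Rightarrow> nat) set" where
  "Delta m n = chains {..n} (\<le>) m"

definition Delta_id :: "nat \<Rightarrow> nat \<Rightarrow> nat" where
  "Delta_id n = (\<lambda>i\<in>{..n}. i)"

text \<open>For \<open>\<theta> \<in> Delta m n\<close>, the induced map \<open>X\<^sub>n \<rightarrow> X\<^sub>m\<close> is \<open>act X m n \<theta>\<close>.\<close>

record 'a sset =
  cells :: "nat \<Rightarrow> 'a set"
  act :: "nat \<Rightarrow> nat \<Rightarrow> (nat \<Rightarrow> nat) \<Rightarrow> 'a \<Rightarrow> 'a"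

definition is_sset :: "'a sset \<Rightarrow> bool" where
  "is_sset X \<longleftrightarrow>
     (\<forall>m n. \<forall>\<theta>\<in>Delta m n. act X m n \<theta> \<in> cells X n \<rightarrow> cells X m) \<and>
     (\<forall>n. \<forall>x\<in>cells X n. act X n n (Delta_id n) x = x) \<and>
     (\<forall>l m n. \<forall>\<phi>\<in>Delta l m. \<forall>\<theta>\<in>Delta m n. \<forall>x\<in>cells X n.
        act X l n (compose {..l} \<theta> \<phi>) x = act X l m \<phi> (act X m n \<theta> x))"

definition smap :: "'a sset \<Rightarrow> 'b sset \<Rightarrow> (nat \<Rightarrow> 'a \<Rightarrow> 'b) set" where
  "smap X Y = {f. (\<forall>n. f n \<in> cells X n \<rightarrow>\<^sub>E cells Y n) \<and>
     (\<forall>m n. \<forall>\<theta>\<in>Delta m n. \<forall>x\<in>cells X n. f m (act X m n \<theta> x) = act Y m n \<theta> (f n x))}"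

text \<open>The nerve of the poset \<open>(A, r)\<close>.\<close>

definition pnerve :: "'v set \<Rightarrow> ('v \<Rightarrow> 'v \<Rightarrow> bool) \<Rightarrow> (nat \<Rightarrow> 'v) sset" where
  "pnerve A r = \<lparr>cells = chains A r, act = (\<lambda>m n \<theta> s. compose {..m} s \<theta>)\<rparr>"

definition simplex :: "nat \<Rightarrow> (nat \<Rightarrow> nat) sset" where
  "simplex n = pnerve {..n} (\<le>)"

definition boundary :: "nat \<Rightarrow> (nat \<Rightarrow> nat) sset" where
  "boundary n = \<lparr>cells = (\<lambda>m. {\<theta> \<in> Delta m n. \<not> {..n} \<subseteq> \<theta> ` {..m}}), act = act (simplex n)\<rparr>"

definition horn :: "nat \<Rightarrow> nat \<Rightarrow> (nat \<Rightarrow> nat) sset" where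
  "horn n k = \<lparr>cells = (\<lambda>m. {\<theta> \<in> Delta m n. \<not> {..n} - {k} \<subseteq> \<theta> ` {..m}}), act = act (simplex n)\<rparr>"

definition is_kan :: "'a sset \<Rightarrow> bool" where
  "is_kan X \<longleftrightarrow> is_sset X \<and>
     (\<forall>n\<ge>1. \<forall>k\<le>n. \<forall>h\<in>smap (horn n k) X. \<exists>\<sigma>\<in>smap (simplex n) X.
        \<forall>m. \<forall>\<theta>\<in>cells (horn n k) m. \<sigma> m \<theta> = h m \<theta>)"

definition sprod :: "'a sset \<Rightarrow> 'b sset \<Rightarrow> ('a \<times> 'b) sset" where
  "sprod X Y = \<lparr>cells = (\<lambda>n. cells X n \<times> cells Y n),
                act = (\<lambda>m n \<theta>. map_prod (act X m n \<theta>) (act Y m n \<theta>))\<rparr>"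

text \<open>The internal hom, with \<open>n\<close>-simplices the maps \<open>\<Delta>\<^sup>n \<times> X \<rightarrow> Y\<close>.\<close>

definition shom :: "'a sset \<Rightarrow> 'b sset \<Rightarrow> (nat \<Rightarrow> (nat \<Rightarrow> nat) \<times> 'a \<Rightarrow> 'b) sset" where
  "shom X Y =
     \<lparr>cells = (\<lambda>n. smap (sprod (simplex n) X) Y),
      act = (\<lambda>m n \<theta> f k. \<lambda>(\<alpha>, x) \<in> cells (simplex m) k \<times> cells X k. f k (compose {..k} \<theta> \<alpha>, x))\<rparr>"

text \<open>Precomposition with \<open>u : W \<rightarrow> X\<close>, as a map from \<open>shom X Y\<close> to \<open>shom W Y\<close>.\<close>

definition precomp :: "'w sset \<Rightarrow> (nat \<Rightarrow> 'w \<Rightarrow> 'a) \<Rightarrow>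
    nat \<Rightarrow> (nat \<Rightarrow> (nat \<Rightarrow> nat) \<times> 'a \<Rightarrow> 'b) \<Rightarrow> (nat \<Rightarrow> (nat \<Rightarrow> nat) \<times> 'w \<Rightarrow> 'b)" where
  "precomp W u n f = (\<lambda>k. \<lambda>(\<alpha>, w) \<in> cells (simplex n) k \<times> cells W k. f k (\<alpha>, u k w))"

text \<open>The \<open>i\<close>-th vertex of an \<open>n\<close>-simplex.\<close>

definition vertex :: "'a sset \<Rightarrow> nat \<Rightarrow> nat \<Rightarrow> 'a \<Rightarrow> 'a" where
  "vertex X n i x = act X 0 n (\<lambda>_\<in>{..0}. i) x"


section \<open>Categories, nerves, and the functor \<open>Q\<close>\<close>

record ('o, 'm) category =
  obj :: "'o set"
  hom :: "'o \<Rightarrow> 'o \<Rightarrow> 'm set"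
  idn :: "'o \<Rightarrow> 'm"
  comp :: "'o \<Rightarrow> 'o \<Rightarrow> 'o \<Rightarrow> 'm \<Rightarrow> 'm \<Rightarrow> 'm"  \<comment> \<open>\<open>comp C a b c g f\<close> is \<open>g \<circ> f : a \<rightarrow> b \<rightarrow> c\<close>\<close>

definition opp :: "('o, 'm) category \<Rightarrow> ('o, 'm) category" where
  "opp C = \<lparr>obj = obj C, hom = (\<lambda>a b. hom C b a), idn = idn C,
            comp = (\<lambda>a b c g f. comp C c b a f g)\<rparr>"

definition tri :: "nat \<Rightarrow> (nat \<times> nat) set" where
  "tri n = {(i, j). i \<le> j \<and> j \<le> n}"

text \<open>
  An \<open>n\<close>-simplex of the nerve is a functor \<open>[n] \<rightarrow> C\<close>, given by its objects \<open>a i\<close> and its morphisms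
  \<open>\<phi> (i, j) : a i \<rightarrow> a j\<close> for all \<open>i \<le> j\<close>.
\<close>

definition nerve :: "('o, 'm) category \<Rightarrow> ((nat \<Rightarrow> 'o) \<times> (nat \<times> nat \<Rightarrow> 'm)) sset" where
  "nerve C =
     \<lparr>cells = (\<lambda>n. {(a, \<phi>).
        a \<in> {..n} \<rightarrow>\<^sub>E obj C \<and>
        \<phi> \<in> (\<Pi>\<^sub>E (i, j) \<in> tri n. hom C (a i) (a j)) \<and>
        (\<forall>i\<le>n. \<phi> (i, i) = idn C (a i)) \<and>
        (\<forall>i j k. i \<le> j \<and> j \<le> k \<and> k \<le> n \<longrightarrow>
           \<phi> (i, k) = comp C (a i) (a j) (a k) (\<phi> (j, k)) (\<phi> (i, j)))}),
      act = (\<lambda>m n \<theta> (a, \<phi>). (compose {..m} a \<theta>, \<lambda>(i, j) \<in> tri m. \<phi> (\<theta> i, \<theta> j)))\<rparr>"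

text \<open>
  The map of nerves induced by a functor with object part \<open>F\<close> and morphism part \<open>G\<close>. Only its
  values on simplices of the source matter; it is not restricted to them.
\<close>

definition nerve_map :: "('o \<Rightarrow> 'p) \<Rightarrow> ('o \<Rightarrow> 'o \<Rightarrow> 'm \<Rightarrow> 'k) \<Rightarrow>
    nat \<Rightarrow> (nat \<Rightarrow> 'o) \<times> (nat \<times> nat \<Rightarrow> 'm) \<Rightarrow> (nat \<Rightarrow> 'p) \<times> (nat \<times> nat \<Rightarrow> 'k)" where
  "nerve_map F G n = (\<lambda>(a, \<phi>). (\<lambda>i\<in>{..n}. F (a i), \<lambda>(i, j) \<in> tri n. G (a i) (a j) (\<phi> (i, j))))"

definition simplex_cat :: "(nat, nat \<Rightarrow> nat) category" where
  "simplex_cat = \<lparr>obj = UNIV, hom = Delta, idn = Delta_id,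
                  comp = (\<lambda>l m n \<theta> \<phi>. compose {..l} \<theta> \<phi>)\<rparr>"

text \<open>
  The functor \<open>[n] \<mapsto> [n]\<^sup>o\<^sup>p \<star> [n] = [2n+1]\<close>. Under this identification the element \<open>i\<close> of \<open>[n]\<^sup>o\<^sup>p\<close>
  corresponds to \<open>n - i\<close>, and the element \<open>i\<close> of \<open>[n]\<close> to \<open>n + 1 + i\<close>.
\<close>

definition Q_obj :: "nat \<Rightarrow> nat" where
  "Q_obj n = 2 * n + 1"

definition Q_mor :: "nat \<Rightarrow> nat \<Rightarrow> (nat \<Rightarrow> nat) \<Rightarrow> (nat \<Rightarrow> nat)" where
  "Q_mor m n \<theta> = (\<lambda>i\<in>{..Q_obj m}. if i \<le> m then n - \<theta> (m - i) else n + 1 + \<theta> (i - (m + 1)))"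

type_synonym delta_op_cell = "(nat \<Rightarrow> nat) \<times> (nat \<times> nat \<Rightarrow> nat \<Rightarrow> nat)"

definition Delta_op :: "delta_op_cell sset" where
  "Delta_op = nerve (opp simplex_cat)"

text \<open>A morphism \<open>a \<rightarrow> b\<close> of the opposite category is a map \<open>[b] \<rightarrow> [a]\<close>.\<close>

definition Q_op :: "nat \<Rightarrow> delta_op_cell \<Rightarrow> delta_op_cell" where
  "Q_op = nerve_map Q_obj (\<lambda>a b \<theta>. Q_mor b a \<theta>)"


section \<open>The \<open>\<infinity>\<close>-category of spaces\<close>

record ('o, 'h) simplicial_category =
  sobj :: "'o set"
  smor :: "'o \<Rightarrow> 'o \<Rightarrow> 'h sset"
  sidn :: "'o \<Rightarrow> nat \<Rightarrow> 'h"  \<comment> \<open>the identity, as a degenerate simplex in each dimension\<close>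
  scomp :: "'o \<Rightarrow> 'o \<Rightarrow> 'o \<Rightarrow> nat \<Rightarrow> 'h \<Rightarrow> 'h \<Rightarrow> 'h"

text \<open>
  The mapping space from \<open>i\<close> to \<open>j\<close> in the simplicial category \<open>\<CC>[\<Delta>\<^sup>n]\<close> (for \<open>i \<le> j\<close>): the nerve of
  the poset of all \<open>S \<subseteq> {i..j}\<close> with \<open>i \<in> S\<close> and \<open>j \<in> S\<close>. Composition is union.
\<close>

definition paths :: "nat \<Rightarrow> nat \<Rightarrow> (nat \<Rightarrow> nat set) sset" where
  "paths i j = pnerve {S. S \<subseteq> {i..j} \<and> i \<in> S \<and> j \<in> S} (\<subseteq>)"

text \<open>
  The homotopy coherent nerve: its \<open>n\<close>-simplices are the simplicial functors \<open>\<CC>[\<Delta>\<^sup>n] \<rightarrow> C\<close>, given by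
  the objects \<open>a i\<close> and the maps \<open>F (i, j)\<close> of mapping spaces.
\<close>

definition hc_nerve :: "('o, 'h) simplicial_category \<Rightarrow>
    ((nat \<Rightarrow> 'o) \<times> (nat \<times> nat \<Rightarrow> nat \<Rightarrow> (nat \<Rightarrow> nat set) \<Rightarrow> 'h)) sset" where
  "hc_nerve C =
     \<lparr>cells = (\<lambda>n. {(a, F).
        a \<in> {..n} \<rightarrow>\<^sub>E sobj C \<and>
        F \<in> (\<Pi>\<^sub>E (i, j) \<in> tri n. smap (paths i j) (smor C (a i) (a j))) \<and>
        (\<forall>i\<le>n. \<forall>m. F (i, i) m (\<lambda>_\<in>{..m}. {i}) = sidn C (a i) m) \<and>
        (\<forall>i j k. i \<le> j \<and> j \<le> k \<and> k \<le> n \<longrightarrow>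
           (\<forall>m. \<forall>s \<in> cells (paths i j) m. \<forall>t \<in> cells (paths j k) m.
              F (i, k) m (\<lambda>l\<in>{..m}. s l \<union> t l) =
                scomp C (a i) (a j) (a k) m (F (j, k) m t) (F (i, j) m s)))}),
      act = (\<lambda>m n \<theta> (a, F).
        (compose {..m} a \<theta>,
         \<lambda>(i, j) \<in> tri m. \<lambda>d. \<lambda>s \<in> cells (paths i j) d.
           F (\<theta> i, \<theta> j) d (\<lambda>l\<in>{..d}. \<theta> ` s l)))\<rparr>"

type_synonym 'a kan_mor = "nat \<Rightarrow> (nat \<Rightarrow> nat) \<times> 'a \<Rightarrow> 'a"

definition kan_cat :: "('a sset, 'a kan_mor) simplicial_category" where
  "kan_cat =
     \<lparr>sobj = {X. is_kan X},
      smor = shom,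
      sidn = (\<lambda>X n k. \<lambda>(\<alpha>, x) \<in> cells (simplex n) k \<times> cells X k. x),
      scomp = (\<lambda>X Y Z n g f k. \<lambda>(\<alpha>, x) \<in> cells (simplex n) k \<times> cells X k. g k (\<alpha>, f k (\<alpha>, x)))\<rparr>"

text \<open>
  The \<open>\<infinity>\<close>-category of spaces. The type \<open>'a\<close> plays the role of a universe: the objects are the Kan
  complexes whose simplices are elements of \<open>'a\<close>. For every \<open>'a\<close> this is a full subcategory of
  the \<open>\<infinity>\<close>-category of all spaces that contains the point, hence its inclusion preserves and
  reflects pullback squares.
\<close>

type_synonym 'a spaces_cell =
  "(nat \<Rightarrow> 'a sset) \<times> (nat \<times> nat \<Rightarrow> nat \<Rightarrow> (nat \<Rightarrow> nat set) \<Rightarrow> 'a kan_mor)"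

definition spaces :: "'a spaces_cell sset" where
  "spaces = hc_nerve kan_cat"


section \<open>Pullback squares\<close>

text \<open>The order of the join of two posets, whose underlying set is \<^term>\<open>A <+> B\<close>.\<close>

fun join_le :: "('u \<Rightarrow> 'u \<Rightarrow> bool) \<Rightarrow> ('v \<Rightarrow> 'v \<Rightarrow> bool) \<Rightarrow> 'u + 'v \<Rightarrow> 'u + 'v \<Rightarrow> bool" where
  "join_le r s (Inl x) (Inl y) = r x y"
| "join_le r s (Inl x) (Inr y) = True"
| "join_le r s (Inr x) (Inl y) = False"
| "join_le r s (Inr x) (Inr y) = s x y"

text \<open>
  For a diagram \<open>p\<close> in \<open>C\<close> of shape \<open>K\<close>, the nerve of the poset \<open>(P, r)\<close>, the slice \<open>C\<^bsub>/p\<^esub>\<close>: its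
  \<open>n\<close>-simplices are the maps \<open>\<Delta>\<^sup>n \<star> K \<rightarrow> C\<close> extending \<open>p\<close>, where \<open>\<Delta>\<^sup>n \<star> K\<close> is the nerve of the
  poset \<open>[n] \<star> P\<close>.
\<close>

definition slice :: "'c sset \<Rightarrow> 'v set \<Rightarrow> ('v \<Rightarrow> 'v \<Rightarrow> bool) \<Rightarrow> (nat \<Rightarrow> (nat \<Rightarrow> 'v) \<Rightarrow> 'c) \<Rightarrow>
    (nat \<Rightarrow> (nat \<Rightarrow> nat + 'v) \<Rightarrow> 'c) sset" where
  "slice C P r p =
     \<lparr>cells = (\<lambda>n. {F \<in> smap (pnerve ({..n} <+> P) (join_le (\<le>) r)) C.
        \<forall>m. \<forall>s \<in> cells (pnerve P r) m. F m (\<lambda>i\<in>{..m}. Inr (s i)) = p m s}),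
      act = (\<lambda>m n \<theta> F k. \<lambda>s \<in> cells (pnerve ({..m} <+> P) (join_le (\<le>) r)) k.
        F k (\<lambda>i\<in>{..k}. map_sum \<theta> id (s i)))\<rparr>"

text \<open>Joyal's definition of a terminal object of a quasi-category.\<close>

definition is_terminal :: "'c sset \<Rightarrow> 'c \<Rightarrow> bool" where
  "is_terminal C t \<longleftrightarrow> t \<in> cells C 0 \<and>
     (\<forall>n\<ge>1. \<forall>h\<in>smap (boundary n) C. h 0 (\<lambda>_\<in>{..0}. n) = t \<longrightarrow>
        (\<exists>\<sigma>\<in>smap (simplex n) C. \<forall>m. \<forall>\<theta>\<in>cells (boundary n) m. \<sigma> m \<theta> = h m \<theta>))"

abbreviation prod_le :: "nat \<times> nat \<Rightarrow> nat \<times> nat \<Rightarrow> bool" where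
  "prod_le \<equiv> rel_prod (\<le>) (\<le>)"

definition square_shape :: "(nat \<times> nat) set" where
  "square_shape = {..1} \<times> {..1}"

definition cospan_shape :: "(nat \<times> nat) set" where
  "cospan_shape = square_shape - {(0, 0)}"

text \<open>
  A square \<open>q : \<Delta>\<^sup>1 \<times> \<Delta>\<^sup>1 \<rightarrow> C\<close> is a pullback if it is a limit cone over its restriction to the
  cospan \<open>(0, 1) \<rightarrow> (1, 1) \<leftarrow> (1, 0)\<close>, i.e. a terminal object of the slice over that cospan, where
  \<open>\<Delta>\<^sup>1 \<times> \<Delta>\<^sup>1\<close> is identified with the join of \<open>\<Delta>\<^sup>0\<close> and the cospan.
\<close>

definition square_cospan :: "(nat \<Rightarrow> (nat \<Rightarrow> nat \<times> nat) \<Rightarrow> 'c) \<Rightarrow> (nat \<Rightarrow> (nat \<Rightarrow> nat \<times> nat) \<Rightarrow> 'c)" where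
  "square_cospan q = (\<lambda>m. \<lambda>s \<in> cells (pnerve cospan_shape prod_le) m. q m s)"

definition square_cone ::
    "(nat \<Rightarrow> (nat \<Rightarrow> nat \<times> nat) \<Rightarrow> 'c) \<Rightarrow> (nat \<Rightarrow> (nat \<Rightarrow> nat + nat \<times> nat) \<Rightarrow> 'c)" where
  "square_cone q = (\<lambda>m. \<lambda>s \<in> cells (pnerve ({..0} <+> cospan_shape) (join_le (\<le>) prod_le)) m.
     q m (\<lambda>i\<in>{..m}. case_sum (\<lambda>_. (0, 0)) id (s i)))"

definition is_pullback :: "'c sset \<Rightarrow> (nat \<Rightarrow> (nat \<Rightarrow> nat \<times> nat) \<Rightarrow> 'c) \<Rightarrow> bool" where
  "is_pullback C q \<longleftrightarrow>
     q \<in> smap (pnerve square_shape prod_le) C \<and>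
     is_terminal (slice C cospan_shape prod_le (square_cospan q)) (square_cone q)"


section \<open>Simplicial spaces\<close>

text \<open>
  The functor \<open>\<infinity>\<close>-category of simplicial spaces; its \<open>0\<close>-simplices are the simplicial spaces and
  its \<open>1\<close>-simplices the simplicial maps.
\<close>

type_synonym 'a sspaces_cell = "nat \<Rightarrow> (nat \<Rightarrow> nat) \<times> delta_op_cell \<Rightarrow> 'a spaces_cell"

definition sspaces :: "'a sspaces_cell sset" where
  "sspaces = shom Delta_op spaces"

definition sspace_maps :: "'a sspaces_cell \<Rightarrow> 'a sspaces_cell \<Rightarrow> 'a sspaces_cell set" where
  "sspace_maps Y X = {f \<in> cells sspaces 1. vertex sspaces 1 0 f = Y \<and> vertex sspaces 1 1 f = X}"

text \<open>The map \<open>g : [k] \<rightarrow> [n]\<close>, as a \<open>1\<close>-simplex from \<open>[n]\<close> to \<open>[k]\<close> in the nerve of the opposite.\<close>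

definition op_edge :: "nat \<Rightarrow> nat \<Rightarrow> (nat \<Rightarrow> nat) \<Rightarrow> delta_op_cell" where
  "op_edge k n g =
     (\<lambda>i\<in>{..1}. if i = 0 then n else k,
      \<lambda>(i, j) \<in> tri 1. if i < j then g else Delta_id (if i = 0 then n else k))"

text \<open>
  The naturality square of \<open>f : Y \<rightarrow> X\<close> at \<open>g : [k] \<rightarrow> [n]\<close>: the restriction of
  \<open>f : \<Delta>\<^sup>1 \<times> N(\<Delta>\<^sup>o\<^sup>p) \<rightarrow> \<S>\<close> along the product of \<open>\<Delta>\<^sup>1\<close> with the edge given by \<open>g\<close>. Its vertices at
  \<open>(0, 0)\<close>, \<open>(0, 1)\<close>, \<open>(1, 0)\<close>, \<open>(1, 1)\<close> are \<open>Y\<^sub>n\<close>, \<open>Y\<^sub>k\<close>, \<open>X\<^sub>n\<close>, \<open>X\<^sub>k\<close>.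
\<close>

definition naturality_square :: "'a sspaces_cell \<Rightarrow> nat \<Rightarrow> nat \<Rightarrow> (nat \<Rightarrow> nat) \<Rightarrow>
    nat \<Rightarrow> (nat \<Rightarrow> nat \<times> nat) \<Rightarrow> 'a spaces_cell" where
  "naturality_square f k n g = (\<lambda>m. \<lambda>s \<in> cells (pnerve square_shape prod_le) m.
     f m (\<lambda>i\<in>{..m}. fst (s i), act Delta_op m 1 (\<lambda>i\<in>{..m}. snd (s i)) (op_edge k n g)))"

definition cartesian_on :: "'a sspaces_cell \<Rightarrow> nat \<Rightarrow> nat \<Rightarrow> (nat \<Rightarrow> nat) \<Rightarrow> bool" where
  "cartesian_on f k n g \<longleftrightarrow> is_pullback spaces (naturality_square f k n g)"

definition right_fibration :: "'a sspaces_cell \<Rightarrow> bool" where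
  "right_fibration f \<longleftrightarrow> (\<forall>m n. \<forall>l\<in>Delta m n. l m = n \<longrightarrow> cartesian_on f m n l)"

definition culf :: "'a sspaces_cell \<Rightarrow> bool" where
  "culf f \<longleftrightarrow> (\<forall>k n. \<forall>g\<in>Delta k n. g 0 = 0 \<and> g k = n \<longrightarrow> cartesian_on f k n g)"

text \<open>Edgewise subdivision, as a map from \<^const>\<open>sspaces\<close> to itself given in each dimension.\<close>

definition Sd :: "nat \<Rightarrow> 'a sspaces_cell \<Rightarrow> 'a sspaces_cell" where
  "Sd = precomp Delta_op Q_op"

end

theory Submission
  imports Defs
begin

text \<open>
A map \<open>l : [m] \<rightarrow> [n]\<close> with \<open>l(m) = n\<close> has an active image \<open>Q(l)\<close>, because \<open>Q(l)\<close> sends the first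
element to \<open>n - l(m) = 0\<close> and the last one to \<open>n + 1 + l(m)\<close>. The naturality square of \<open>Sd(f)\<close> at
\<open>l\<close> is the naturality square of \<open>f\<close> at \<open>Q(l)\<close>, so culf maps subdivide to right fibrations.

Conversely, every active map \<open>g : [k] \<rightarrow> [n]\<close> is a retract of \<open>Q(g)\<close> in the arrow category of
\<open>\<Delta>\<close>. The inclusion \<open>[n] \<rightarrow> [n]\<^sup>o\<^sup>p \<star> [n]\<close> of the second factor is natural, and the map
\<open>[n]\<^sup>o\<^sup>p \<star> [n] \<rightarrow> [n]\<close> that collapses the first factor to \<open>0\<close> is a retraction of it, natural for
the maps that preserve \<open>0\<close>. An active map preserves the last element, so \<open>f\<close> is cartesian on
\<open>Q(g)\<close> if \<open>Sd(f)\<close> is a right fibration; hence the naturality square at \<open>g\<close> is a retract of a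
pullback square. It remains to see that pullback squares are closed under retracts
(\<open>pullback_retract\<close>). This is the main work, because a retract of squares of spaces is a coherent
diagram \<open>\<Delta>\<^sup>2 \<times> \<Delta>\<^sup>1 \<times> \<Delta>\<^sup>1 \<rightarrow> \<S>\<close>, and a pullback is a terminal object of a slice. Two facts enter.

The first is that \<open>\<S>\<close> has fillers of inner horns (\<open>spaces_inner_fills\<close>). A map from an inner horn
to the homotopy coherent nerve leaves only one map of mapping spaces undetermined, on a cube whose
value is prescribed on all faces but one. Such an open box is filled by the homotopy extension
property of Kan complexes (\<open>homotopy_extension\<close>), applied to the product of a cube with an
arbitrary simplicial set.

The second is a construction of extensions in any simplicial set with inner fillers. All shapes are
complexes of chains of a poset, and the simplices to be added are matched in pairs that differ by
one vertex; each pair is added by filling one horn (\<open>matching_extension\<close>, \<open>shift_extension\<close>). Given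
a boundary of cones over the cospan of \<open>q\<close>, whose last cone is \<open>q\<close>, and a retraction of \<open>q'\<close> onto
\<open>q\<close>, three extensions give the missing cone: compose all given cones with the map from \<open>q\<close> to
\<open>q'\<close>, use that \<open>q'\<close> is terminal, and compose the resulting cone with the map from \<open>q'\<close> back to \<open>q\<close>.
The composite agrees with the given data because the composite from \<open>q\<close> to \<open>q\<close> is degenerate.
\<close>

section \<open>Complexes of chains in a poset\<close>

lemma smapI:
  assumes "\<And>n x. x \<in> cells X n \<Longrightarrow> f n x \<in> cells Y n"
    and "\<And>n x. x \<notin> cells X n \<Longrightarrow> f n x = undefined"
    and "\<And>m n \<theta> x. \<theta> \<in> Delta m n \<Longrightarrow> x \<in> cells X n \<Longrightarrow> f m (act X m n \<theta> x) = act Y m n \<theta> (f n x)"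
  shows "f \<in> smap X Y"
  using assms by (auto simp: smap_def PiE_def extensional_def)

lemma smap_cell: "f \<in> smap X Y \<Longrightarrow> x \<in> cells X n \<Longrightarrow> f n x \<in> cells Y n"
  by (auto simp: smap_def)

lemma smap_undefined: "f \<in> smap X Y \<Longrightarrow> x \<notin> cells X n \<Longrightarrow> f n x = undefined"
  by (auto simp: smap_def PiE_def extensional_def)

lemma smap_act:
  "f \<in> smap X Y \<Longrightarrow> \<theta> \<in> Delta m n \<Longrightarrow> x \<in> cells X n \<Longrightarrow> f m (act X m n \<theta> x) = act Y m n \<theta> (f n x)"
  by (auto simp: smap_def)

lemma smap_eqI:
  assumes "f \<in> smap X Y" "g \<in> smap X Z" "\<And>n x. x \<in> cells X n \<Longrightarrow> f n x = g n x"
  shows "f = g"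
proof (intro ext)
  fix n x show "f n x = g n x"
    using assms smap_undefined[OF assms(1)] smap_undefined[OF assms(2)] by (cases "x \<in> cells X n") auto
qed

lemma sset_act_cell: "is_sset X \<Longrightarrow> \<theta> \<in> Delta m n \<Longrightarrow> x \<in> cells X n \<Longrightarrow> act X m n \<theta> x \<in> cells X m"
  unfolding is_sset_def by blast

lemma sset_act_id: "is_sset X \<Longrightarrow> x \<in> cells X n \<Longrightarrow> act X n n (Delta_id n) x = x"
  unfolding is_sset_def by blast

lemma sset_act_act:
  "is_sset X \<Longrightarrow> \<phi> \<in> Delta l m \<Longrightarrow> \<theta> \<in> Delta m n \<Longrightarrow> x \<in> cells X n \<Longrightarrow>
   act X l m \<phi> (act X m n \<theta> x) = act X l n (\<lambda>i\<in>{..l}. \<theta> (\<phi> i)) x"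
  unfolding is_sset_def compose_def by metis

lemma mem_Delta:
  "\<theta> \<in> Delta m n \<longleftrightarrow>
     \<theta> \<in> extensional {..m} \<and> (\<forall>i\<le>m. \<theta> i \<le> n) \<and> (\<forall>i j. i \<le> j \<and> j \<le> m \<longrightarrow> \<theta> i \<le> \<theta> j)"
  by (auto simp: Delta_def chains_def PiE_def Pi_def monotone_on_def)

lemma Delta_extensional: "\<theta> \<in> Delta m n \<Longrightarrow> \<theta> \<in> extensional {..m}"
  and Delta_le: "\<theta> \<in> Delta m n \<Longrightarrow> i \<le> m \<Longrightarrow> \<theta> i \<le> n"
  and Delta_mono: "\<theta> \<in> Delta m n \<Longrightarrow> i \<le> j \<Longrightarrow> j \<le> m \<Longrightarrow> \<theta> i \<le> \<theta> j"
  by (auto simp: mem_Delta)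

lemma Delta_comp: "\<phi> \<in> Delta l m \<Longrightarrow> \<theta> \<in> Delta m n \<Longrightarrow> (\<lambda>i\<in>{..l}. \<theta> (\<phi> i)) \<in> Delta l n"
  by (auto simp: mem_Delta)

lemma Delta_id_mem: "Delta_id n \<in> Delta n n"
  by (auto simp: mem_Delta Delta_id_def)

text \<open>
The simplicial subset of the nerve of \<open>r\<close> that consists of the simplices whose set of vertices lies
in \<open>S\<close>. Simplices, horns, boundaries, cubes and joins are all of this form, so that one calculus
of extensions serves them all.
\<close>

definition chain_cx :: "('v \<Rightarrow> 'v \<Rightarrow> bool) \<Rightarrow> 'v set set \<Rightarrow> (nat \<Rightarrow> 'v) sset" where
  "chain_cx r S = \<lparr>cells = (\<lambda>m. {s \<in> extensional {..m}. monotone_on {..m} (\<le>) r s \<and> s ` {..m} \<in> S}),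
             act = (\<lambda>m n \<theta> s. compose {..m} s \<theta>)\<rparr>"

text \<open>
Closure under all subsets, the empty set included, although no simplex has an empty set of
vertices.
\<close>

definition down_closed :: "'v set set \<Rightarrow> bool" where
  "down_closed S \<longleftrightarrow> (\<forall>c\<in>S. \<forall>d\<subseteq>c. d \<in> S)"

lemma down_closedD: "down_closed S \<Longrightarrow> c \<in> S \<Longrightarrow> d \<subseteq> c \<Longrightarrow> d \<in> S"
  by (auto simp: down_closed_def)

lemma mem_cx:
  "s \<in> cells (chain_cx r S) m \<longleftrightarrow>
     s \<in> extensional {..m} \<and> (\<forall>i j. i \<le> j \<and> j \<le> m \<longrightarrow> r (s i) (s j)) \<and> s ` {..m} \<in> S"
  by (auto simp: chain_cx_def monotone_on_def)

lemma act_cx: "act (chain_cx r S) m n \<theta> s = (\<lambda>i\<in>{..m}. s (\<theta> i))"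
  by (simp add: chain_cx_def compose_def)

lemma pnerve_cx: "pnerve A r = chain_cx r (Pow A)"
proof -
  have "chains A r = (\<lambda>m. {s \<in> extensional {..m}. monotone_on {..m} (\<le>) r s \<and> s ` {..m} \<in> Pow A})"
    by (rule ext) (auto simp: chains_def PiE_def Pi_def)
  then show ?thesis by (simp add: pnerve_def chain_cx_def)
qed

lemma simplex_cx: "simplex n = chain_cx (\<le>) (Pow {..n})"
  by (simp add: simplex_def pnerve_cx)

lemma cells_simplex: "cells (simplex n) m = Delta m n"
  by (simp add: simplex_def pnerve_def Delta_def)

lemma boundary_cx: "boundary n = chain_cx (\<le>) {I. I \<subseteq> {..n} \<and> \<not> {..n} \<subseteq> I}"
proof -
  have "(\<lambda>m. {\<theta> \<in> Delta m n. \<not> {..n} \<subseteq> \<theta> ` {..m}}) =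
    cells (chain_cx (\<le>) {I. I \<subseteq> {..n} \<and> \<not> {..n} \<subseteq> I})"
    by (intro ext set_eqI) (auto simp: mem_cx mem_Delta)
  then show ?thesis by (simp add: boundary_def simplex_cx chain_cx_def)
qed

lemma horn_cx: "horn n k = chain_cx (\<le>) {I. I \<subseteq> {..n} \<and> \<not> {..n} - {k} \<subseteq> I}"
proof -
  have "(\<lambda>m. {\<theta> \<in> Delta m n. \<not> {..n} - {k} \<subseteq> \<theta> ` {..m}}) =
    cells (chain_cx (\<le>) {I. I \<subseteq> {..n} \<and> \<not> {..n} - {k} \<subseteq> I})"
    by (intro ext set_eqI) (auto simp: mem_cx mem_Delta)
  then show ?thesis by (simp add: horn_def simplex_cx chain_cx_def)
qed

lemma cx_act_mem:
  assumes "down_closed S" "s \<in> cells (chain_cx r S) n" "\<theta> \<in> Delta m n"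
  shows "(\<lambda>i\<in>{..m}. s (\<theta> i)) \<in> cells (chain_cx r S) m"
proof -
  have "(\<lambda>i\<in>{..m}. s (\<theta> i)) ` {..m} \<subseteq> s ` {..n}"
    using assms(3) by (auto simp: mem_Delta)
  then show ?thesis using assms by (auto simp: mem_cx mem_Delta intro: down_closedD)
qed

lemma is_ssetI:
  assumes "\<And>m n \<theta> x. \<theta> \<in> Delta m n \<Longrightarrow> x \<in> cells X n \<Longrightarrow> act X m n \<theta> x \<in> cells X m"
    and "\<And>n x. x \<in> cells X n \<Longrightarrow> act X n n (Delta_id n) x = x"
    and "\<And>l m n \<phi> \<theta> x. \<phi> \<in> Delta l m \<Longrightarrow> \<theta> \<in> Delta m n \<Longrightarrow> x \<in> cells X n \<Longrightarrow>
        act X l n (\<lambda>i\<in>{..l}. \<theta> (\<phi> i)) x = act X l m \<phi> (act X m n \<theta> x)"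
  shows "is_sset X"
  using assms unfolding is_sset_def compose_def by blast

lemma is_sset_cx:
  assumes "down_closed S" shows "is_sset (chain_cx r S)"
proof (rule is_ssetI)
  fix n s assume "s \<in> cells (chain_cx r S) n"
  then have "s \<in> extensional {..n}" by (simp add: mem_cx)
  then show "act (chain_cx r S) n n (Delta_id n) s = s"
    by (auto simp: act_cx Delta_id_def extensional_def)
next
  fix l m n \<phi> \<theta> s assume "\<phi> \<in> Delta l m"
  then show "act (chain_cx r S) l n (\<lambda>i\<in>{..l}. \<theta> (\<phi> i)) s = act (chain_cx r S) l m \<phi> (act (chain_cx r S) m n \<theta> s)"
    by (auto simp: act_cx mem_Delta)
qed (use assms cx_act_mem in \<open>auto simp: act_cx\<close>)

lemma cx_mono: "s \<in> cells (chain_cx r S) m \<Longrightarrow> S \<subseteq> T \<Longrightarrow> s \<in> cells (chain_cx r T) m"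
  by (auto simp: mem_cx)

lemma down_closed_Pow: "down_closed (Pow A)"
  by (auto simp: down_closed_def)

definition pull :: "('v \<Rightarrow> 'v \<Rightarrow> bool) \<Rightarrow> 'v set set \<Rightarrow> ('v \<Rightarrow> 'w) \<Rightarrow> (nat \<Rightarrow> (nat \<Rightarrow> 'w) \<Rightarrow> 'c) \<Rightarrow>
    (nat \<Rightarrow> (nat \<Rightarrow> 'v) \<Rightarrow> 'c)" where
  "pull r S \<phi> g = (\<lambda>m. \<lambda>s\<in>cells (chain_cx r S) m. g m (\<lambda>i\<in>{..m}. \<phi> (s i)))"

lemma map_cells:
  assumes "s \<in> cells (chain_cx r S) m" 
    and "\<And>c x y. c \<in> S \<Longrightarrow> x \<in> c \<Longrightarrow> y \<in> c \<Longrightarrow> r x y \<Longrightarrow> r' (\<phi> x) (\<phi> y)"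
    and "\<And>c. c \<in> S \<Longrightarrow> \<phi> ` c \<in> S'"
  shows "(\<lambda>i\<in>{..m}. \<phi> (s i)) \<in> cells (chain_cx r' S') m"
proof -
  have "(\<lambda>i\<in>{..m}. \<phi> (s i)) ` {..m} = \<phi> ` (s ` {..m})" by auto
  moreover have "r' (\<phi> (s i)) (\<phi> (s j))" if "i \<le> j" "j \<le> m" for i j
    using assms(1) that by (intro assms(2)[of "s ` {..m}"]) (auto simp: mem_cx)
  ultimately show ?thesis using assms(1,3) by (auto simp: mem_cx)
qed

lemma pull_smap:
  assumes "g \<in> smap (chain_cx r' S') C" "down_closed S"
    and "\<And>c x y. c \<in> S \<Longrightarrow> x \<in> c \<Longrightarrow> y \<in> c \<Longrightarrow> r x y \<Longrightarrow> r' (\<phi> x) (\<phi> y)"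
    and "\<And>c. c \<in> S \<Longrightarrow> \<phi> ` c \<in> S'"
  shows "pull r S \<phi> g \<in> smap (chain_cx r S) C"
proof (rule smapI)
  fix m s assume s: "s \<in> cells (chain_cx r S) m"
  have "(\<lambda>i\<in>{..m}. \<phi> (s i)) \<in> cells (chain_cx r' S') m"
    by (rule map_cells[OF s]) (use assms in auto)
  then show "pull r S \<phi> g m s \<in> cells C m"
    using s smap_cell[OF assms(1)] by (simp add: pull_def)
next
  fix m n \<theta> s assume \<theta>: "\<theta> \<in> Delta m n" and s: "s \<in> cells (chain_cx r S) n"
  have "(\<lambda>i\<in>{..n}. \<phi> (s i)) \<in> cells (chain_cx r' S') n"
    by (rule map_cells[OF s]) (use assms in auto)
  note this = smap_act[OF assms(1) \<theta> this]
  moreover have "(\<lambda>i\<in>{..m}. \<phi> ((\<lambda>i\<in>{..m}. s (\<theta> i)) i)) = (\<lambda>i\<in>{..m}. (\<lambda>i\<in>{..n}. \<phi> (s i)) (\<theta> i))"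
    using \<theta> by (auto simp: mem_Delta)
  ultimately show "pull r S \<phi> g m (act (chain_cx r S) m n \<theta> s) = act C m n \<theta> (pull r S \<phi> g n s)"
    using cx_act_mem[OF assms(2) s \<theta>] s
    by (simp add: pull_def act_cx)
qed (simp add: pull_def)

lemma glue_smap:
  assumes g: "g \<in> smap (chain_cx r S) C" "down_closed S" and h: "h \<in> smap (chain_cx r T) C" "down_closed T"
    and eq: "\<And>m s. s \<in> cells (chain_cx r S) m \<Longrightarrow> s \<in> cells (chain_cx r T) m \<Longrightarrow> g m s = h m s"
  shows "\<exists>k\<in>smap (chain_cx r (S \<union> T)) C. (\<forall>m. \<forall>s\<in>cells (chain_cx r S) m. k m s = g m s) \<and>
    (\<forall>m. \<forall>s\<in>cells (chain_cx r T) m. k m s = h m s)"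
proof -
  define k where "k = (\<lambda>m s. if s \<in> cells (chain_cx r S) m then g m s else h m s)"
  have kS: "k m s = g m s" if "s \<in> cells (chain_cx r S) m" for m s using that by (simp add: k_def)
  have kT: "k m s = h m s" if "s \<in> cells (chain_cx r T) m" for m s using that eq by (simp add: k_def)
  have split: "s \<in> cells (chain_cx r S) m \<or> s \<in> cells (chain_cx r T) m" if "s \<in> cells (chain_cx r (S \<union> T)) m" for m s
    using that by (auto simp: mem_cx)
  have "k \<in> smap (chain_cx r (S \<union> T)) C"
  proof (rule smapI)
    fix m s assume "s \<in> cells (chain_cx r (S \<union> T)) m"
    then show "k m s \<in> cells C m" using split kS kT smap_cell[OF g(1)] smap_cell[OF h(1)] by metis
  next
    fix m s assume "s \<notin> cells (chain_cx r (S \<union> T)) m"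
    then show "k m s = undefined" using smap_undefined[OF h(1)] by (auto simp: k_def mem_cx)
  next
    fix m n \<theta> s assume \<theta>: "\<theta> \<in> Delta m n" and s: "s \<in> cells (chain_cx r (S \<union> T)) n"
    show "k m (act (chain_cx r (S \<union> T)) m n \<theta> s) = act C m n \<theta> (k n s)"
      using split[OF s] kS kT smap_act[OF g(1) \<theta>] smap_act[OF h(1) \<theta>]
        cx_act_mem[OF g(2) _ \<theta>] cx_act_mem[OF h(2) _ \<theta>]
      by (auto simp: act_cx)
  qed
  then show ?thesis using kS kT by blast
qed

text \<open>
Only finite chains occur as vertex sets, so a family may be changed freely on all other sets. This
allows the families below to be described without mentioning chains.
\<close>

lemma smap_cx_cong:
  assumes "\<And>c. finite c \<Longrightarrow> (\<And>x y. x \<in> c \<Longrightarrow> y \<in> c \<Longrightarrow> r x y \<or> r y x) \<Longrightarrow> c \<in> S \<longleftrightarrow> c \<in> T"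
  shows "chain_cx r S = chain_cx r T"
proof -
  have "s ` {..m} \<in> S \<longleftrightarrow> s ` {..m} \<in> T" if "monotone_on {..m} (\<le>) r s" for s and m :: nat
  proof (rule assms)
    fix x y assume "x \<in> s ` {..m}" "y \<in> s ` {..m}"
    then show "r x y \<or> r y x" using that by (clarsimp simp: monotone_on_def) (meson atMost_iff nat_le_linear)
  qed simp
  then have "cells (chain_cx r S) = cells (chain_cx r T)" by (intro ext) (auto simp: chain_cx_def)
  then show ?thesis by (simp add: chain_cx_def)
qed

section \<open>Extension along matchings\<close>

definition porder :: "('v \<Rightarrow> 'v \<Rightarrow> bool) \<Rightarrow> bool" where
  "porder r \<longleftrightarrow> reflp r \<and> transp r \<and> antisymp r"

lemma porder_refl: "porder r \<Longrightarrow> r x x"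
  and porder_trans: "porder r \<Longrightarrow> r x y \<Longrightarrow> r y z \<Longrightarrow> r x z"
  and porder_antisym: "porder r \<Longrightarrow> r x y \<Longrightarrow> r y x \<Longrightarrow> x = y"
  by (auto simp: porder_def dest: reflpD transpD antisympD)

definition is_chain :: "('v \<Rightarrow> 'v \<Rightarrow> bool) \<Rightarrow> 'v set \<Rightarrow> bool" where
  "is_chain r c \<longleftrightarrow> (\<forall>x\<in>c. \<forall>y\<in>c. r x y \<or> r y x)"

text \<open>
On a finite chain this is the order-preserving enumeration, starting from \<open>0\<close>.
\<close>

definition rank :: "('v \<Rightarrow> 'v \<Rightarrow> bool) \<Rightarrow> 'v set \<Rightarrow> 'v \<Rightarrow> nat" where
  "rank r c x = card {y \<in> c. y \<noteq> x \<and> r y x}"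

lemma rank_less:
  assumes "porder r" "finite c" "x \<in> c" "r x y" "x \<noteq> y"
  shows "rank r c x < rank r c y"
  unfolding rank_def
proof (rule psubset_card_mono)
  show "{z \<in> c. z \<noteq> x \<and> r z x} \<subset> {z \<in> c. z \<noteq> y \<and> r z y}"
    using assms porder_trans[OF assms(1)] porder_antisym[OF assms(1)] by blast
qed (use assms in auto)

lemma rank_mono: "porder r \<Longrightarrow> finite c \<Longrightarrow> x \<in> c \<Longrightarrow> r x y \<Longrightarrow> rank r c x \<le> rank r c y"
  using rank_less[of r c x y] by (cases "x = y") auto

lemma rank_bij:
  assumes "porder r" "finite c" "is_chain r c" "c \<noteq> {}"
  shows "bij_betw (rank r c) c {..card c - 1}"
proof -
  have inj: "inj_on (rank r c) c"
    using rank_less[OF assms(1,2)] assms(3) unfolding is_chain_def inj_on_def by (metis less_irrefl)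
  have "rank r c x < card c" if "x \<in> c" for x
    unfolding rank_def using that assms(2) by (intro psubset_card_mono) auto
  then have sub: "rank r c ` c \<subseteq> {..card c - 1}" by fastforce
  have "card c > 0" using assms(2,4) by (simp add: card_gt_0_iff)
  then have "rank r c ` c = {..card c - 1}"
    using inj by (intro card_subset_eq[OF _ sub]) (auto simp: card_image)
  then show ?thesis using inj by (simp add: bij_betw_def)
qed

lemma subset_missing:
  assumes "d \<subseteq> c" "d \<noteq> c" "d \<noteq> c - {v}"
  obtains w where "w \<in> c" "w \<notin> d" "w \<noteq> v"
proof -
  have "\<not> c - {v} \<subseteq> d" using assms by (cases "v \<in> d") auto
  then show thesis using that by auto
qed

definition fills :: "'c sset \<Rightarrow> nat \<Rightarrow> nat \<Rightarrow> bool" where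
  "fills C n k \<longleftrightarrow> (\<forall>h\<in>smap (horn n k) C. \<exists>\<sigma>\<in>smap (simplex n) C.
     \<forall>m. \<forall>\<theta>\<in>cells (horn n k) m. \<sigma> m \<theta> = h m \<theta>)"

text \<open>
Attaching one simplex \<open>c\<close> together with its face opposite \<open>v\<close>: the other faces form a horn, whose
missing face is indexed by the position of \<open>v\<close> in \<open>c\<close>.
\<close>

lemma fill_one:
  assumes r: "porder r" and S: "down_closed S" and g: "g \<in> smap (chain_cx r S) C"
    and c: "finite c" "is_chain r c" "v \<in> c"
    and new: "c \<notin> S" "c - {v} \<notin> S"
    and faces: "\<And>w. w \<in> c \<Longrightarrow> w \<noteq> v \<Longrightarrow> c - {w} \<in> S"
    and fills: "fills C (card c - 1) (rank r c v)"
  shows "\<exists>g'\<in>smap (chain_cx r (insert c (insert (c - {v}) S))) C.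
    \<forall>m. \<forall>s\<in>cells (chain_cx r S) m. g' m s = g m s"
proof -
  define n where "n = card c - 1"
  define k where "k = rank r c v"
  \<comment> \<open>\<open>e\<close> enumerates \<open>c\<close> in increasing order; it pulls \<open>g\<close> back to the horn\<close>
  define e where "e = inv_into c (rank r c)"
  have bij: "bij_betw (rank r c) c {..n}"
    unfolding n_def using rank_bij[OF r c(1,2)] c(3) by blast
  have e_mem: "e i \<in> c" and rank_e: "rank r c (e i) = i" if "i \<le> n" for i
    using bij that by (auto simp: e_def bij_betw_def inv_into_into f_inv_into_f)
  have e_rank: "e (rank r c x) = x" if "x \<in> c" for x
    using bij that by (auto simp: e_def bij_betw_def)
  have e_mono: "r (e i) (e j)" if "i \<le> j" "j \<le> n" for i j
  proof (rule ccontr)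
    assume "\<not> r (e i) (e j)"
    then have "r (e j) (e i)" "e j \<noteq> e i"
      using c(2) e_mem that porder_refl[OF r] unfolding is_chain_def by (metis order_trans)+
    then have "j < i" using rank_less[OF r c(1) e_mem] rank_e that by (metis order_trans)
    then show False using that by simp
  qed
  define H where "H = {I. I \<subseteq> {..n} \<and> \<not> {..n} - {k} \<subseteq> I}"
  define h where "h = pull (\<le>) H e g"
  have "h \<in> smap (chain_cx (\<le>) H) C"
    unfolding h_def
  proof (rule pull_smap[OF g])
    show "down_closed H" unfolding H_def down_closed_def by blast
    fix I assume I: "I \<in> H"
    then obtain j where j: "j \<le> n" "j \<noteq> k" "j \<notin> I" unfolding H_def by auto
    have "e j \<noteq> v" using rank_e[OF j(1)] j(2) by (auto simp: k_def)
    then have "c - {e j} \<in> S" using faces e_mem j by blast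
    moreover have "e ` I \<subseteq> c - {e j}"
    proof (intro image_subsetI DiffI)
      fix i assume i: "i \<in> I"
      then have "i \<le> n" "i \<noteq> j" using I j unfolding H_def by auto
      then show "e i \<in> c" "e i \<notin> {e j}" using e_mem rank_e[OF \<open>i \<le> n\<close>] rank_e[OF j(1)] by auto
    qed
    ultimately show "e ` I \<in> S" using S down_closedD by blast
    fix x y assume "x \<in> I" "y \<in> I" "x \<le> y"
    then show "r (e x) (e y)" using I e_mono by (auto simp: H_def)
  qed
  then obtain \<tau> where \<tau>: "\<tau> \<in> smap (chain_cx (\<le>) (Pow {..n})) C"
    and \<tau>h: "\<And>m \<theta>. \<theta> \<in> cells (chain_cx (\<le>) H) m \<Longrightarrow> \<tau> m \<theta> = h m \<theta>"
    using fills unfolding fills_def n_def[symmetric] k_def[symmetric] horn_cx simplex_cx H_def[symmetric]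
    by blast
  define t where "t = pull r (Pow c) (rank r c) \<tau>"
  have t: "t \<in> smap (chain_cx r (Pow c)) C"
    unfolding t_def
  proof (rule pull_smap[OF \<tau> down_closed_Pow])
    fix d assume d: "d \<in> Pow c"
    then show "rank r c ` d \<in> Pow {..n}" using bij by (auto simp: bij_betw_def)
    fix x y assume "x \<in> d" "r x y"
    then show "rank r c x \<le> rank r c y" using rank_mono[OF r c(1)] d by auto
  qed
  have "\<exists>k\<in>smap (chain_cx r (S \<union> Pow c)) C. (\<forall>m. \<forall>s\<in>cells (chain_cx r S) m. k m s = g m s) \<and>
    (\<forall>m. \<forall>s\<in>cells (chain_cx r (Pow c)) m. k m s = t m s)"
  proof (rule glue_smap[OF g S t down_closed_Pow])
    fix m s assume sS: "s \<in> cells (chain_cx r S) m" and sc: "s \<in> cells (chain_cx r (Pow c)) m"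
    let ?u = "\<lambda>i\<in>{..m}. rank r c (s i)"
    have im: "s ` {..m} \<in> S" "s ` {..m} \<subseteq> c" using sS sc by (auto simp: mem_cx)
    have "?u \<in> cells (chain_cx (\<le>) (Pow {..n})) m"
      by (rule map_cells[OF sc]) (use bij_betw_imp_surj_on[OF bij] rank_mono[OF r c(1)] in blast)+
    moreover have "\<not> {..n} - {k} \<subseteq> ?u ` {..m}"
    proof
      assume a: "{..n} - {k} \<subseteq> ?u ` {..m}"
      have "c - {v} \<subseteq> s ` {..m}"
      proof
        fix x assume x: "x \<in> c - {v}"
        then have "rank r c x \<in> {..n} - {k}"
          using bij c(3) unfolding k_def bij_betw_def inj_on_def by auto
        then obtain i where "i \<le> m" "rank r c x = rank r c (s i)" using a by auto
        then have "x = s i" using bij x im unfolding bij_betw_def inj_on_def by auto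
        then show "x \<in> s ` {..m}" using \<open>i \<le> m\<close> by auto
      qed
      then show False using new(2) S im(1) down_closedD by blast
    qed
    ultimately have u: "?u \<in> cells (chain_cx (\<le>) H) m" by (auto simp: mem_cx H_def)
    have "(\<lambda>i\<in>{..m}. e (?u i)) = s"
    proof (rule ext)
      fix i show "(\<lambda>i\<in>{..m}. e (?u i)) i = s i"
        using sS im(2) e_rank by (cases "i \<le> m") (auto simp: mem_cx extensional_def)
    qed
    then show "g m s = t m s" using sc u \<tau>h[OF u] by (simp add: t_def pull_def h_def)
  qed
  moreover have "S \<union> Pow c = insert c (insert (c - {v}) S)"
  proof (intro set_eqI iffI)
    fix d assume "d \<in> S \<union> Pow c"
    moreover have "d \<in> S" if ne: "d \<subseteq> c" "d \<noteq> c" "d \<noteq> c - {v}"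
    proof -
      obtain w where "w \<in> c" "w \<notin> d" "w \<noteq> v" using subset_missing[OF ne] by metis
      then have "c - {w} \<in> S" "d \<subseteq> c - {w}" using faces[of w] ne by auto
      then show "d \<in> S" by (rule down_closedD[OF S])
    qed
    ultimately show "d \<in> insert c (insert (c - {v}) S)" by blast
  qed auto
  ultimately show ?thesis by metis
qed

text \<open>
A discrete Morse argument. The chains of \<open>U\<close> come in pairs, \<open>c\<close> without \<open>v c\<close> and \<open>c\<close> with \<open>v c\<close>.
The measure \<open>\<mu>\<close> makes the matching acyclic: if a facet of the larger chain of a pair, other than
the smaller chain, is new, then it belongs to a pair of smaller measure. Hence the pairs can be
attached one after the other, in the order of their measures.
\<close>

lemma matching_extension:
  fixes \<mu> :: "'v set \<Rightarrow> nat"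
  assumes r: "porder r" and U: "finite U"
    and "down_closed S" "g \<in> smap (chain_cx r S) C" "S \<inter> U = {}"
    and "\<And>c. c \<in> U \<Longrightarrow> finite c \<and> is_chain r c"
    and "\<And>c. c \<in> U \<Longrightarrow> insert (v c) c \<in> U \<and> c - {v c} \<in> U \<and>
           v (insert (v c) c) = v c \<and> v (c - {v c}) = v c"
    and "\<And>c. c \<in> U \<Longrightarrow> v c \<in> c \<Longrightarrow> fills C (card c - 1) (rank r c (v c))"
    and "\<And>c w. c \<in> U \<Longrightarrow> v c \<in> c \<Longrightarrow> w \<in> c \<Longrightarrow> w \<noteq> v c \<Longrightarrow>
           c - {w} \<in> S \<or> c - {w} \<in> U \<and> \<mu> (c - {w} - {v (c - {w})}) < \<mu> (c - {v c})"
  shows "\<exists>g'\<in>smap (chain_cx r (S \<union> U)) C. \<forall>m. \<forall>s\<in>cells (chain_cx r S) m. g' m s = g m s"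
  using assms(2-)
proof (induction U arbitrary: S g rule: finite_psubset_induct)
  case (psubset U)
  note S = psubset.prems(1) and g = psubset.prems(2) and disj = psubset.prems(3)
    and ch = psubset.prems(4) and tog = psubset.prems(5) and fil = psubset.prems(6)
    and fac = psubset.prems(7)
  show ?case
  proof (cases "U = {}")
    case True
    then show ?thesis using g by auto
  next
    case False
    then obtain c0 where "c0 \<in> U" by blast
    then have "insert (v c0) c0 \<in> U \<and> v (insert (v c0) c0) \<in> insert (v c0) c0"
      using tog[of c0] by simp
    \<comment> \<open>the next pair to be attached is one of least measure; its other facets are then present already\<close>
    from ex_has_least_nat[of "\<lambda>c. c \<in> U \<and> v c \<in> c", OF this, of "\<lambda>c. \<mu> (c - {v c})"]
    obtain c where c: "c \<in> U" "v c \<in> c"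
      and min: "\<And>d. d \<in> U \<Longrightarrow> v d \<in> d \<Longrightarrow> \<mu> (c - {v c}) \<le> \<mu> (d - {v d})"
      by blast
    have faces: "c - {w} \<in> S" if w: "w \<in> c" "w \<noteq> v c" for w
    proof (rule ccontr)
      assume "c - {w} \<notin> S"
      then have d: "c - {w} \<in> U" and lt: "\<mu> (c - {w} - {v (c - {w})}) < \<mu> (c - {v c})"
        using fac[OF c w] by auto
      let ?d = "insert (v (c - {w})) (c - {w})"
      have "?d \<in> U" "v ?d = v (c - {w})" using tog[OF d] by auto
      then have "\<mu> (c - {v c}) \<le> \<mu> (?d - {v (c - {w})})" using min[of ?d] by simp
      moreover have "?d - {v (c - {w})} = c - {w} - {v (c - {w})}" by auto
      ultimately show False using lt by simp
    qed
    let ?S = "insert c (insert (c - {v c}) S)"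
    let ?U = "U - {c, c - {v c}}"
    have new: "c \<notin> S" "c - {v c} \<notin> S" using c tog disj by blast+
    obtain g1 where g1: "g1 \<in> smap (chain_cx r ?S) C"
      and g1g: "\<And>m s. s \<in> cells (chain_cx r S) m \<Longrightarrow> g1 m s = g m s"
      using fill_one[OF r S g _ _ c(2) new faces fil[OF c]] ch[OF c(1)] by blast
    have "\<exists>g'\<in>smap (chain_cx r (?S \<union> ?U)) C. \<forall>m. \<forall>s\<in>cells (chain_cx r ?S) m. g' m s = g1 m s"
    proof (rule psubset.IH[OF _ _ g1])
      show "?U \<subset> U" using c by blast
      show "down_closed ?S"
        unfolding down_closed_def
      proof (intro ballI allI impI)
        fix d d' assume d: "d \<in> ?S" and d': "d' \<subseteq> d"
        show "d' \<in> ?S"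
        proof (cases "d \<in> S")
          case True
          then show ?thesis using S d' down_closedD by blast
        next
          case False
          then have "d' \<subseteq> c" using d d' by blast
          moreover have "d' \<in> S" if ne: "d' \<noteq> c" "d' \<noteq> c - {v c}"
          proof -
            obtain w where "w \<in> c" "w \<notin> d'" "w \<noteq> v c" using subset_missing[OF \<open>d' \<subseteq> c\<close> ne] by metis
            then have "c - {w} \<in> S" "d' \<subseteq> c - {w}" using faces[of w] \<open>d' \<subseteq> c\<close> by auto
            then show ?thesis by (rule down_closedD[OF S])
          qed
          ultimately show ?thesis by blast
        qed
      qed
      show "?S \<inter> ?U = {}" using disj by blast
      fix d assume "d \<in> ?U"
      then have d: "d \<in> U" "d \<noteq> c" "d \<noteq> c - {v c}" by auto
      show "finite d \<and> is_chain r d" using ch[OF d(1)] .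
      have tc: "v (c - {v c}) = v c" using tog[OF c(1)] by blast
      have "insert (v d) d \<noteq> c" using tog[OF d(1)] d by (metis Diff_insert_absorb insert_absorb)
      moreover have "insert (v d) d \<noteq> c - {v c}"
        using tog[OF d(1)] tc by (metis Diff_iff insertI1)
      moreover have "d - {v d} \<noteq> c - {v c}"
        using tog[OF d(1)] tc d c(2) by (metis Diff_empty Diff_insert0 insert_Diff)
      moreover have "d - {v d} \<noteq> c" using tog[OF d(1)] c by (metis Diff_iff insertI1)
      ultimately show "insert (v d) d \<in> ?U \<and> d - {v d} \<in> ?U \<and>
           v (insert (v d) d) = v d \<and> v (d - {v d}) = v d"
        using tog[OF d(1)] by blast
      assume vd: "v d \<in> d"
      show "fills C (card d - 1) (rank r d (v d))" using fil[OF d(1) vd] .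
      fix w assume "w \<in> d" "w \<noteq> v d"
      then show "d - {w} \<in> ?S \<or> d - {w} \<in> ?U \<and> \<mu> (d - {w} - {v (d - {w})}) < \<mu> (d - {v d})"
        using fac[OF d(1) vd] by blast
    qed
    moreover have "?S \<union> ?U = S \<union> U" using c tog[OF c(1)] by auto
    ultimately obtain g' where "g' \<in> smap (chain_cx r (S \<union> U)) C"
      and "\<And>m s. s \<in> cells (chain_cx r ?S) m \<Longrightarrow> g' m s = g1 m s" by auto
    moreover have "s \<in> cells (chain_cx r ?S) m" if "s \<in> cells (chain_cx r S) m" for s m
      by (rule cx_mono[OF that]) blast
    ultimately show ?thesis using g1g by (metis (no_types, lifting))
  qed
qed

definition least :: "('v \<Rightarrow> 'v \<Rightarrow> bool) \<Rightarrow> 'v set \<Rightarrow> 'v" where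
  "least q c = (THE x. x \<in> c \<and> (\<forall>y\<in>c. q x y))"

lemma least_eqI: "porder q \<Longrightarrow> x \<in> c \<Longrightarrow> (\<And>y. y \<in> c \<Longrightarrow> q x y) \<Longrightarrow> least q c = x"
  unfolding least_def by (rule the_equality) (auto intro: porder_antisym)

lemma least_mem:
  assumes "porder q" "finite c" "c \<noteq> {}" "is_chain q c"
  shows "least q c \<in> c \<and> (\<forall>y\<in>c. q (least q c) y)"
proof -
  have "\<exists>x\<in>c. \<forall>y\<in>c. q x y"
    using assms(2-4)
  proof (induction rule: finite_ne_induct)
    case (singleton x)
    then show ?case using porder_refl[OF assms(1)] by auto
  next
    case (insert x F)
    then obtain z where "z \<in> F" "\<forall>y\<in>F. q z y" by (auto simp: is_chain_def)
    then show ?case using insert.prems porder_refl[OF assms(1)] porder_trans[OF assms(1)]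
      unfolding is_chain_def by (metis insert_iff)
  qed
  then show ?thesis using least_eqI[OF assms(1)] by metis
qed

text \<open>
The form of matching used throughout. The least vertex \<open>x\<close> of \<open>c\<close> in \<open>L\<close>, for the order or for
its reverse, determines the vertex \<open>\<nu> x\<close>, outside \<open>L\<close>, that is added or removed. Deleting \<open>x\<close>
moves the least vertex to a later one \<open>y\<close>, and then \<open>\<nu> y\<close> is incomparable to \<open>x\<close>, hence absent.
Therefore the number of vertices in \<open>L\<close> plus the number of all vertices is a measure for the matching.
\<close>

lemma shift_extension:
  assumes r: "porder r" and q: "q = r \<or> q = (\<lambda>x y. r y x)"
    and S: "down_closed S" and g: "g \<in> smap (chain_cx r S) C" and disj: "S \<inter> U = {}"
    and U: "finite U" "\<And>c. c \<in> U \<Longrightarrow> finite c \<and> is_chain r c"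
    and L: "\<And>c. c \<in> U \<Longrightarrow> c \<inter> L \<noteq> {}" "\<And>x. x \<in> L \<Longrightarrow> \<nu> x \<notin> L"
    and tog: "\<And>c x. c \<in> U \<Longrightarrow> x \<in> c \<inter> L \<Longrightarrow> (\<forall>y\<in>c \<inter> L. q x y) \<Longrightarrow>
      insert (\<nu> x) c \<in> U \<and> c - {\<nu> x} \<in> U"
    and fil: "\<And>c x. c \<in> U \<Longrightarrow> x \<in> c \<inter> L \<Longrightarrow> (\<forall>y\<in>c \<inter> L. q x y) \<Longrightarrow> \<nu> x \<in> c \<Longrightarrow>
      fills C (card c - 1) (rank r c (\<nu> x))"
    and faces: "\<And>c w. c \<in> U \<Longrightarrow> w \<in> c \<Longrightarrow> c - {w} \<in> S \<union> U"
    and inc: "\<And>x y. x \<in> L \<Longrightarrow> y \<in> L \<Longrightarrow> x \<noteq> y \<Longrightarrow> q x y \<Longrightarrow> \<not> r (\<nu> y) x \<and> \<not> r x (\<nu> y)"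
  shows "\<exists>g'\<in>smap (chain_cx r (S \<union> U)) C. \<forall>m. \<forall>s\<in>cells (chain_cx r S) m. g' m s = g m s"
proof -
  have pq: "porder q" using r q by (auto simp: porder_def reflp_def transp_def antisymp_def)
  define \<kappa> where "\<kappa> c = least q (c \<inter> L)" for c
  have k: "\<kappa> c \<in> c \<inter> L" "\<And>y. y \<in> c \<inter> L \<Longrightarrow> q (\<kappa> c) y" if "c \<in> U" for c
  proof -
    have "is_chain q (c \<inter> L)" using U(2)[OF that] q by (auto simp: is_chain_def)
    then show "\<kappa> c \<in> c \<inter> L" "\<And>y. y \<in> c \<inter> L \<Longrightarrow> q (\<kappa> c) y"
      using least_mem[OF pq _ L(1)[OF that]] U(2)[OF that] by (auto simp: \<kappa>_def)
  qed
  show ?thesis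
  \<comment> \<open>\<open>\<kappa> c\<close> depends only on the part of \<open>c\<close> in \<open>L\<close>, which toggling \<open>\<nu> (\<kappa> c)\<close> does not change\<close>
  proof (rule matching_extension[OF r U(1) S g disj U(2), where v = "\<lambda>c. \<nu> (\<kappa> c)"
        and \<mu> = "\<lambda>c. card (c \<inter> L) + card c"])
    fix c assume c: "c \<in> U"
    have "insert (\<nu> (\<kappa> c)) c \<inter> L = c \<inter> L" "(c - {\<nu> (\<kappa> c)}) \<inter> L = c \<inter> L"
      using L(2) k[OF c] by auto
    then show "insert (\<nu> (\<kappa> c)) c \<in> U \<and> c - {\<nu> (\<kappa> c)} \<in> U \<and>
      \<nu> (\<kappa> (insert (\<nu> (\<kappa> c)) c)) = \<nu> (\<kappa> c) \<and> \<nu> (\<kappa> (c - {\<nu> (\<kappa> c)})) = \<nu> (\<kappa> c)"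
      using tog[OF c] k[OF c] by (simp add: \<kappa>_def)
    assume v: "\<nu> (\<kappa> c) \<in> c"
    show "fills C (card c - 1) (rank r c (\<nu> (\<kappa> c)))" using fil[OF c _ _ v] k[OF c] by blast
    fix w assume w: "w \<in> c" "w \<noteq> \<nu> (\<kappa> c)"
    let ?d = "c - {w}"
    have fin: "finite c" using U(2)[OF c] by blast
    have "card ((?d - {\<nu> (\<kappa> ?d)}) \<inter> L) + card (?d - {\<nu> (\<kappa> ?d)})
        < card ((c - {\<nu> (\<kappa> c)}) \<inter> L) + card (c - {\<nu> (\<kappa> c)})" if d: "?d \<in> U"
    proof -
      have cL: "(c - {\<nu> (\<kappa> c)}) \<inter> L = c \<inter> L" using L(2) k[OF c] by auto
      have dL: "(?d - {\<nu> (\<kappa> ?d)}) \<inter> L = ?d \<inter> L" using L(2) k[OF d] by auto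
      show ?thesis
      proof (cases "w = \<kappa> c")
        case True
        have wL: "w \<in> L" "q w (\<kappa> ?d)" "\<kappa> ?d \<in> L" "\<kappa> ?d \<noteq> w"
          using True k[OF c] k[OF d] by auto
        then have "\<nu> (\<kappa> ?d) \<notin> c" using inc[OF wL(1,3)] w(1) U(2)[OF c] unfolding is_chain_def by metis
        then have "?d - {\<nu> (\<kappa> ?d)} = c - {w}" by auto
        moreover have "card (c - {w}) = card (c - {\<nu> (\<kappa> c)})" using w v fin by simp
        moreover have "card (?d \<inter> L) < card (c \<inter> L)"
          using w wL(1) fin by (intro psubset_card_mono) auto
        ultimately show ?thesis using cL dL by simp
      next
        case False
        then have "\<kappa> ?d = \<kappa> c" unfolding \<kappa>_def[of ?d] using k[OF c] by (intro least_eqI[OF pq]) auto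
        moreover have "card (c - {w} - {\<nu> (\<kappa> c)}) < card (c - {\<nu> (\<kappa> c)})"
          using w fin by (intro psubset_card_mono) auto
        moreover have "card (?d \<inter> L) \<le> card (c \<inter> L)" using fin by (intro card_mono) auto
        ultimately show ?thesis using cL dL by simp
      qed
    qed
    then show "?d \<in> S \<or> ?d \<in> U \<and> card ((?d - {\<nu> (\<kappa> ?d)}) \<inter> L) + card (?d - {\<nu> (\<kappa> ?d)})
        < card ((c - {\<nu> (\<kappa> c)}) \<inter> L) + card (c - {\<nu> (\<kappa> c)})"
      using faces[OF c w(1)] by blast
  qed
qed

lemma inner_rank:
  assumes "finite c" "v \<in> c" "x \<in> c" "y \<in> c" "x \<noteq> v" "y \<noteq> v" "r x v" "r v y" "porder r"
  shows "0 < rank r c v" "rank r c v < card c - 1"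
proof -
  show "0 < rank r c v" unfolding rank_def using assms by (auto simp: card_gt_0_iff)
  have "{z \<in> c. z \<noteq> v \<and> r z v} \<subset> c - {v}"
    using assms porder_antisym[OF assms(9)] by blast
  then have "rank r c v < card (c - {v})" unfolding rank_def using assms(1) by (intro psubset_card_mono) auto
  then show "rank r c v < card c - 1" using assms by simp
qed

section \<open>Homotopy extension for Kan complexes\<close>

lemma porder_rel_prod: "porder r \<Longrightarrow> porder s \<Longrightarrow> porder (rel_prod r s)"
  unfolding porder_def reflp_def transp_def antisymp_def rel_prod_conv by (auto; blast)

lemma porder_le: "porder ((\<le>) :: 'a::order \<Rightarrow> 'a \<Rightarrow> bool)"
  by (auto simp: porder_def reflp_def transp_def antisymp_def)

text \<open>
The part \<open>\<partial>\<Delta>\<^sup>n \<times> \<Delta>\<^sup>1 \<union> \<Delta>\<^sup>n \<times> {1}\<close> of the prism \<open>\<Delta>\<^sup>n \<times> \<Delta>\<^sup>1\<close>.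
\<close>

definition prism_walls :: "nat \<Rightarrow> (nat \<times> nat) set set" where
  "prism_walls n = {c. c \<subseteq> {..n} \<times> {..1} \<and> (\<not> {..n} \<subseteq> fst ` c \<or> snd ` c \<subseteq> {1})}"

lemma down_closed_prism_walls: "down_closed (prism_walls n)"
  unfolding down_closed_def prism_walls_def by blast

text \<open>
A chain outside the walls meets every \<open>{p} \<times> {0, 1}\<close> and contains a vertex of height \<open>0\<close>. Such
chains are matched by adding or removing \<open>(p, 1)\<close>, where \<open>(p, 0)\<close> is the last vertex of height \<open>0\<close>.
\<close>

lemma prism_extension:
  assumes C: "is_kan C" and g: "g \<in> smap (chain_cx prod_le (prism_walls n)) C"
  shows "\<exists>g'\<in>smap (chain_cx prod_le (Pow ({..n} \<times> {..1}))) C.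
    \<forall>m. \<forall>s\<in>cells (chain_cx prod_le (prism_walls n)) m. g' m s = g m s"
proof -
  define U :: "(nat \<times> nat) set set" where
    "U = {c. c \<subseteq> {..n} \<times> {..1} \<and> is_chain prod_le c \<and> {..n} \<subseteq> fst ` c \<and> 0 \<in> snd ` c}"
  have po: "porder prod_le" by (intro porder_rel_prod porder_le)
  have cover: "c \<in> prism_walls n \<union> U" if c: "c \<subseteq> {..n} \<times> {..1}" "is_chain prod_le c" for c
  proof -
    have "snd ` c \<subseteq> {1}" if "0 \<notin> snd ` c"
    proof
      fix y assume y: "y \<in> snd ` c"
      have "y \<noteq> 0" using y that by metis
      moreover have "y \<le> 1" using y c(1) by auto
      ultimately show "y \<in> {1}" by simp
    qed
    then show ?thesis using c unfolding prism_walls_def U_def by blast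
  qed
  have "\<exists>g'\<in>smap (chain_cx prod_le (prism_walls n \<union> U)) C.
    \<forall>m. \<forall>s\<in>cells (chain_cx prod_le (prism_walls n)) m. g' m s = g m s"
  proof (rule shift_extension[OF po _ down_closed_prism_walls g,
        \<comment> \<open>the reversed order selects the last vertex of height \<open>0\<close>\<close>
        where q = "\<lambda>x y. prod_le y x" and L = "{x. snd x = 0}" and \<nu> = "\<lambda>x. (fst x, 1)"])
    have "U \<subseteq> Pow ({..n} \<times> {..1})" unfolding U_def by blast
    then show "finite U" by (rule finite_subset) simp
    show "prism_walls n \<inter> U = {}" unfolding prism_walls_def U_def by force
    fix c assume c: "c \<in> U"
    then have sub: "c \<subseteq> {..n} \<times> {..1}" and tot: "is_chain prod_le c"
      and onto: "{..n} \<subseteq> fst ` c" and z: "0 \<in> snd ` c" unfolding U_def by auto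
    have fin: "finite c" using sub by (rule finite_subset) simp
    then show "finite c \<and> is_chain prod_le c" using tot by simp
    show "c \<inter> {x. snd x = 0} \<noteq> {}" using z by force
    {
      fix x assume x: "x \<in> c \<inter> {x. snd x = 0}" and max: "\<forall>y\<in>c \<inter> {x. snd x = 0}. prod_le y x"
      obtain p where p: "x = (p, 0)" using x by (cases x) auto
      have cmp: "prod_le y (p, 1) \<or> prod_le (p, 1) y" if "y \<in> c" for y
      proof (cases "snd y = 0")
        case True
        then have "prod_le y x" using max that by blast
        then show ?thesis using p by (cases y) auto
      next
        case False
        then have "prod_le x y" using tot x that p unfolding is_chain_def by (cases y) fastforce
        then show ?thesis using p False by (cases y) auto
      qed
      have "p \<le> n" using x p sub by auto
      moreover have "is_chain prod_le (insert (p, 1) c)"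
        using tot cmp porder_refl[OF po] unfolding is_chain_def by (metis insert_iff)
      ultimately have "insert (p, 1) c \<in> U" using sub onto z unfolding U_def by auto
      moreover have "c - {(p, 1)} \<in> U"
      proof -
        have "(p, 0) \<in> c - {(p, 1)}" using x p by simp
        then have "p \<in> fst ` (c - {(p, 1)})" "0 \<in> snd ` (c - {(p, 1)})" by force+
        moreover have "fst ` c \<subseteq> fst ` (c - {(p, 1)})"
        proof (rule image_subsetI)
          fix y assume "y \<in> c"
          then show "fst y \<in> fst ` (c - {(p, 1)})" using calculation by (cases "y = (p, 1)") auto
        qed
        ultimately show ?thesis using sub tot onto unfolding U_def is_chain_def by blast
      qed
      ultimately show "insert (fst x, 1) c \<in> U \<and> c - {(fst x, 1)} \<in> U" using p by simp
      assume "(fst x, 1) \<in> c"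
      then have "{(p, 0), (p, 1)} \<subseteq> c" using x p by auto
      from card_mono[OF fin this] have "card c - 1 \<ge> 1" by simp
      moreover have "rank prod_le c (fst x, 1) < card c"
        unfolding rank_def using fin \<open>(fst x, 1) \<in> c\<close> by (intro psubset_card_mono) auto
      ultimately show "fills C (card c - 1) (rank prod_le c (fst x, 1))"
        using C unfolding is_kan_def fills_def by simp
    }
    fix w
    have "is_chain prod_le (c - {w})" using tot unfolding is_chain_def by blast
    then show "c - {w} \<in> prism_walls n \<union> U" using sub by (intro cover) auto
  next
    fix x y :: "nat \<times> nat"
    assume "x \<in> {x. snd x = 0}" "y \<in> {x. snd x = 0}" "x \<noteq> y" "prod_le y x"
    then show "\<not> prod_le (fst y, 1) x \<and> \<not> prod_le x (fst y, 1)" by (cases x; cases y) auto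
  qed auto
  moreover have "chain_cx prod_le (prism_walls n \<union> U) = chain_cx prod_le (Pow ({..n} \<times> {..1}))"
  proof (rule smap_cx_cong)
    fix c :: "(nat \<times> nat) set" assume "\<And>x y. x \<in> c \<Longrightarrow> y \<in> c \<Longrightarrow> prod_le x y \<or> prod_le y x"
    then have "is_chain prod_le c" by (simp add: is_chain_def)
    then show "c \<in> prism_walls n \<union> U \<longleftrightarrow> c \<in> Pow ({..n} \<times> {..1})"
      using cover[of c] unfolding prism_walls_def U_def by blast
  qed
  ultimately show ?thesis by simp
qed

definition subobject :: "'b sset \<Rightarrow> (nat \<Rightarrow> 'b set) \<Rightarrow> bool" where
  "subobject B A \<longleftrightarrow> (\<forall>n. A n \<subseteq> cells B n) \<and>
     (\<forall>m n. \<forall>\<theta>\<in>Delta m n. \<forall>b\<in>A n. act B m n \<theta> b \<in> A m)"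

text \<open>
The domain \<open>A \<times> \<Delta>\<^sup>1 \<union> B \<times> {1}\<close> of the homotopy extension property.
\<close>

definition cylinder :: "'b sset \<Rightarrow> (nat \<Rightarrow> 'b set) \<Rightarrow> ((nat \<Rightarrow> nat) \<times> 'b) sset" where
  "cylinder B A = \<lparr>cells = (\<lambda>n. {(t, b). t \<in> Delta n 1 \<and> b \<in> cells B n \<and> (b \<in> A n \<or> (\<forall>i\<le>n. t i = 1))}),
     act = act (sprod (simplex 1) B)\<rparr>"

lemma mem_cylinder: "(t, b) \<in> cells (cylinder B A) n \<longleftrightarrow>
    t \<in> Delta n 1 \<and> b \<in> cells B n \<and> (b \<in> A n \<or> (\<forall>i\<le>n. t i = 1))"
  by (simp add: cylinder_def)

lemma act_cylinder: "act (cylinder B A) m n \<theta> (t, b) = (\<lambda>i\<in>{..m}. t (\<theta> i), act B m n \<theta> b)"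
  by (simp add: cylinder_def sprod_def simplex_def pnerve_def compose_def)

lemma cylinder_full: "cylinder B (cells B) = sprod (simplex 1) B"
proof -
  have "(\<lambda>n. {(t, b). t \<in> Delta n 1 \<and> b \<in> cells B n \<and> (b \<in> cells B n \<or> (\<forall>i\<le>n. t i = 1))}) =
    (\<lambda>n. cells (simplex 1) n \<times> cells B n)"
    by (auto simp: cells_simplex)
  then show ?thesis by (simp add: cylinder_def sprod_def)
qed

lemma subobject_cells: "is_sset B \<Longrightarrow> subobject B (cells B)"
  by (simp add: subobject_def sset_act_cell)

lemma cylinder_act_mem:
  assumes B: "is_sset B" and A: "subobject B A"
    and x: "(t, b) \<in> cells (cylinder B A) n" and \<theta>: "\<theta> \<in> Delta m n"
  shows "(\<lambda>i\<in>{..m}. t (\<theta> i), act B m n \<theta> b) \<in> cells (cylinder B A) m"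
  using x A \<theta> sset_act_cell[OF B \<theta>] Delta_comp[OF \<theta>, of t 1] Delta_le[OF \<theta>]
  by (auto simp: mem_cylinder subobject_def)

text \<open>
All values up to \<open>\<theta> i\<close> are attained on \<open>{..i}\<close>, and all values from \<open>\<theta> i\<close> on are attained on
\<open>{i..n}\<close>; counting gives both inequalities.
\<close>

lemma Delta_surj_id:
  assumes "\<theta> \<in> Delta n n" "{..n} \<subseteq> \<theta> ` {..n}" "i \<le> n"
  shows "\<theta> i = i"
proof -
  have "{..\<theta> i} \<subseteq> \<theta> ` {..i}"
  proof
    fix j assume j: "j \<in> {..\<theta> i}"
    then have "j \<le> n" using assms Delta_le[OF assms(1,3)] by simp
    then obtain a where a: "a \<le> n" "j = \<theta> a" using assms(2) by auto
    show "j \<in> \<theta> ` {..i}"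
    proof (cases "a \<le> i")
      case False
      then have "\<theta> i \<le> j" using a Delta_mono[OF assms(1), of i a] by simp
      then show ?thesis using j by auto
    qed (use a in auto)
  qed
  from card_mono[OF _ this] card_image_le[of "{..i}" \<theta>] have "\<theta> i \<le> i" by simp
  moreover have "{\<theta> i..n} \<subseteq> \<theta> ` {i..n}"
  proof
    fix j assume j: "j \<in> {\<theta> i..n}"
    then obtain a where a: "a \<le> n" "j = \<theta> a" using assms(2) by auto
    show "j \<in> \<theta> ` {i..n}"
    proof (cases "i \<le> a")
      case False
      then have "j \<le> \<theta> i" using a assms(3) Delta_mono[OF assms(1), of a i] by simp
      then show ?thesis using j assms(3) by auto
    qed (use a in auto)
  qed
  from card_mono[OF _ this] card_image_le[of "{i..n}" \<theta>] have "Suc n - \<theta> i \<le> Suc n - i" by simp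
  ultimately show ?thesis using assms(3) by simp
qed

lemma Delta_section:
  assumes \<theta>: "\<theta> \<in> Delta m n" and onto: "{..n} \<subseteq> \<theta> ` {..m}" and a: "a \<le> m"
  obtains \<delta> where "\<delta> \<in> Delta n m" "\<And>j. j \<le> n \<Longrightarrow> \<theta> (\<delta> j) = j" "\<delta> (\<theta> a) = a"
proof -
  have "\<forall>j\<in>{..n}. \<exists>i. i \<le> m \<and> \<theta> i = j" using onto by auto
  then obtain d where d: "\<And>j. j \<le> n \<Longrightarrow> d j \<le> m \<and> \<theta> (d j) = j" by (metis atMost_iff)
  \<comment> \<open>any choice of preimages is monotone, so the one at \<open>\<theta> a\<close> can be prescribed\<close>
  define \<delta> where "\<delta> = (\<lambda>j\<in>{..n}. if j = \<theta> a then a else d j)"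
  have sec: "\<delta> j \<le> m \<and> \<theta> (\<delta> j) = j" if "j \<le> n" for j using d[OF that] that a by (simp add: \<delta>_def)
  have "\<delta> i \<le> \<delta> j" if ij: "i \<le> j" "j \<le> n" for i j
  proof (rule ccontr)
    assume "\<not> \<delta> i \<le> \<delta> j"
    then have "\<theta> (\<delta> j) \<le> \<theta> (\<delta> i)" using sec[of i] ij by (intro Delta_mono[OF \<theta>]) auto
    then have "i = j" using sec[of i] sec[of j] ij by simp
    then show False using \<open>\<not> \<delta> i \<le> \<delta> j\<close> by simp
  qed
  then have "\<delta> \<in> Delta n m" using sec by (auto simp: mem_Delta \<delta>_def)
  moreover have "\<delta> (\<theta> a) = a" using Delta_le[OF \<theta> a] by (simp add: \<delta>_def)
  ultimately show thesis using that sec by blast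
qed

text \<open>
A map that omits a value \<open>j\<close> factors through the face \<open>[n - 1] \<rightarrow> [n]\<close> opposite \<open>j\<close>.
\<close>

lemma nonsurjective_mem:
  assumes B: "is_sset B" and A: "subobject B A" and low: "\<And>p. p < n \<Longrightarrow> cells B p \<subseteq> A p"
    and \<theta>: "\<theta> \<in> Delta m n" "\<not> {..n} \<subseteq> \<theta> ` {..m}" and b: "b \<in> cells B n"
  shows "act B m n \<theta> b \<in> A m"
proof -
  obtain j where j: "j \<le> n" "j \<notin> \<theta> ` {..m}" using \<theta>(2) by auto
  have "n \<ge> 1"
    using j Delta_le[OF \<theta>(1), of 0] by (cases n) auto
  define \<delta> where "\<delta> = (\<lambda>i\<in>{..n - 1}. if i < j then i else i + 1)"
  define \<phi> where "\<phi> = (\<lambda>i\<in>{..m}. if \<theta> i < j then \<theta> i else \<theta> i - 1)"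
  have \<delta>: "\<delta> \<in> Delta (n - 1) n" using \<open>n \<ge> 1\<close> by (auto simp: mem_Delta \<delta>_def)
  have ne: "\<theta> i \<noteq> j" if "i \<le> m" for i using j that by auto
  have \<phi>: "\<phi> \<in> Delta m (n - 1)"
    using \<open>n \<ge> 1\<close> j(1) Delta_le[OF \<theta>(1)] Delta_mono[OF \<theta>(1)] ne
    by (fastforce simp: mem_Delta \<phi>_def intro: diff_le_mono le_diff_conv)
  have "(\<lambda>i\<in>{..m}. \<delta> (\<phi> i)) = \<theta>"
  proof (rule ext)
    fix i show "(\<lambda>i\<in>{..m}. \<delta> (\<phi> i)) i = \<theta> i"
    proof (cases "i \<le> m")
      case True
      then show ?thesis using Delta_le[OF \<phi> True] ne[OF True] by (auto simp: \<delta>_def \<phi>_def)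
    next
      case False
      then show ?thesis using Delta_extensional[OF \<theta>(1)] by (simp add: extensional_def)
    qed
  qed
  then have "act B m n \<theta> b = act B m (n - 1) \<phi> (act B (n - 1) n \<delta> b)"
    using sset_act_act[OF B \<phi> \<delta> b] by simp
  moreover have "act B (n - 1) n \<delta> b \<in> A (n - 1)"
    using sset_act_cell[OF B \<delta> b] low[of "n - 1"] \<open>n \<ge> 1\<close> by auto
  ultimately show ?thesis using A \<phi> by (simp add: subobject_def)
qed

text \<open>
The uniqueness part of the Eilenberg--Zilber lemma, relative to a subobject that contains all
simplices of lower dimension. Both operators are surjective. A section \<open>\<delta>\<close> of \<open>\<theta>\<close> gives
\<open>b = b' \<cdot> (\<theta>' \<circ> \<delta>)\<close>, so \<open>\<theta>' \<circ> \<delta>\<close> is surjective, hence the identity. As \<open>\<delta>\<close> may be chosen to pass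
through any given element, the two operators agree everywhere.
\<close>

lemma eilenberg_zilber:
  assumes B: "is_sset B" and A: "subobject B A" and low: "\<And>p. p < n \<Longrightarrow> cells B p \<subseteq> A p"
    and \<theta>: "\<theta> \<in> Delta m n" and \<theta>': "\<theta>' \<in> Delta m n" and b: "b \<in> cells B n" and b': "b' \<in> cells B n"
    and eq: "act B m n \<theta> b = act B m n \<theta>' b'" and new: "act B m n \<theta> b \<notin> A m"
  shows "b = b' \<and> \<theta> = \<theta>'"
proof -
  have onto: "{..n} \<subseteq> \<theta> ` {..m}" using nonsurjective_mem[OF B A low \<theta> _ b] new by blast
  have "b \<notin> A n" using new A \<theta> by (auto simp: subobject_def)
  have main: "b = b' \<and> \<theta>' a = \<theta> a" if a: "a \<le> m" for a
  proof -
    obtain \<delta> where \<delta>: "\<delta> \<in> Delta n m" "\<And>j. j \<le> n \<Longrightarrow> \<theta> (\<delta> j) = j" "\<delta> (\<theta> a) = a"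
      using Delta_section[OF \<theta> onto a] by blast
    have "(\<lambda>i\<in>{..n}. \<theta> (\<delta> i)) = Delta_id n" using \<delta>(2) by (auto simp: Delta_id_def)
    then have "b = act B n m \<delta> (act B m n \<theta> b)"
      using sset_act_act[OF B \<delta>(1) \<theta> b] sset_act_id[OF B b] by simp
    then have bb: "b = act B n n (\<lambda>i\<in>{..n}. \<theta>' (\<delta> i)) b'"
      using sset_act_act[OF B \<delta>(1) \<theta>' b'] eq by simp
    let ?e = "\<lambda>i\<in>{..n}. \<theta>' (\<delta> i)"
    have e: "?e \<in> Delta n n" using Delta_comp[OF \<delta>(1) \<theta>'] .
    have "{..n} \<subseteq> ?e ` {..n}" using nonsurjective_mem[OF B A low e _ b'] bb \<open>b \<notin> A n\<close> by metis
    then have id: "?e i = i" if "i \<le> n" for i using Delta_surj_id[OF e] that by blast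
    then have "?e = Delta_id n" by (auto simp: Delta_id_def)
    then have "b = b'" using bb sset_act_id[OF B b'] by simp
    moreover have "\<theta>' a = \<theta> a" using id[of "\<theta> a"] \<delta>(3) Delta_le[OF \<theta> a] by simp
    ultimately show ?thesis by simp
  qed
  have "\<theta> a = \<theta>' a" for a
    using main[of a] Delta_extensional[OF \<theta>] Delta_extensional[OF \<theta>']
    by (cases "a \<le> m") (auto simp: extensional_def)
  then show ?thesis using main[of 0] by auto
qed

text \<open>
The union of \<open>A\<close> with the simplicial subset generated by the simplices of dimension below \<open>n\<close>.
\<close>

definition skeleton :: "'b sset \<Rightarrow> (nat \<Rightarrow> 'b set) \<Rightarrow> nat \<Rightarrow> nat \<Rightarrow> 'b set" where
  "skeleton B A n m = A m \<union> {act B m p \<theta> b | p \<theta> b. p < n \<and> \<theta> \<in> Delta m p \<and> b \<in> cells B p}"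

lemma skeleton_0: "skeleton B A 0 = A"
  by (auto simp: skeleton_def)

lemma skeleton_Suc:
  "skeleton B A (Suc n) m = skeleton B A n m \<union> {act B m n \<theta> b | \<theta> b. \<theta> \<in> Delta m n \<and> b \<in> cells B n}"
  by (auto simp: skeleton_def less_Suc_eq)

lemma subobject_skeleton:
  assumes B: "is_sset B" and A: "subobject B A"
  shows "subobject B (skeleton B A n)"
  unfolding subobject_def
proof (intro conjI allI ballI subsetI)
  fix m x assume "x \<in> skeleton B A n m"
  then show "x \<in> cells B m" using A sset_act_cell[OF B] by (auto simp: skeleton_def subobject_def)
next
  fix l m \<phi> x assume \<phi>: "\<phi> \<in> Delta l m" and x: "x \<in> skeleton B A n m"
  show "act B l m \<phi> x \<in> skeleton B A n l"
  proof (cases "x \<in> A m")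
    case True
    then show ?thesis using A \<phi> by (auto simp: skeleton_def subobject_def)
  next
    case False
    then obtain p \<theta> b where "p < n" "\<theta> \<in> Delta m p" "b \<in> cells B p" "x = act B m p \<theta> b"
      using x by (auto simp: skeleton_def)
    then have "p < n" "(\<lambda>i\<in>{..l}. \<theta> (\<phi> i)) \<in> Delta l p" "b \<in> cells B p"
      "act B l m \<phi> x = act B l p (\<lambda>i\<in>{..l}. \<theta> (\<phi> i)) b"
      using sset_act_act[OF B \<phi>] Delta_comp[OF \<phi>] by auto
    then show ?thesis unfolding skeleton_def by blast
  qed
qed

lemma skeleton_low:
  assumes "is_sset B" "m < n" shows "cells B m \<subseteq> skeleton B A n m"
proof
  fix x assume "x \<in> cells B m"
  then have "x = act B m m (Delta_id m) x" using sset_act_id[OF assms(1)] by simp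
  then show "x \<in> skeleton B A n m"
    using \<open>x \<in> cells B m\<close> assms(2) Delta_id_mem by (auto simp: skeleton_def)
qed

text \<open>
Each missing \<open>n\<close>-simplex \<open>b\<close> carries a map defined on the walls of a prism, which extends to the
prism. The extensions are chosen independently of each other. By \<open>eilenberg_zilber\<close>, every new
simplex arises from exactly one \<open>b\<close> by exactly one operator, so they fit together.
\<close>

lemma skeleton_step:
  assumes B: "is_sset B" and A: "subobject B A" and low: "\<And>p. p < n \<Longrightarrow> cells B p \<subseteq> A p"
    and C: "is_kan C" and g: "g \<in> smap (cylinder B A) C"
    and A': "\<And>m. A' m = A m \<union> {act B m n \<theta> b | \<theta> b. \<theta> \<in> Delta m n \<and> b \<in> cells B n}"
  shows "\<exists>g'\<in>smap (cylinder B A') C. \<forall>m. \<forall>x\<in>cells (cylinder B A) m. g' m x = g m x"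
proof -
  let ?W = "chain_cx prod_le (prism_walls n)" and ?P = "chain_cx prod_le (Pow ({..n} \<times> {..1}))"
  \<comment> \<open>the map on the walls of the prism over \<open>b\<close> that \<open>g\<close> determines\<close>
  define G where "G b = (\<lambda>m. \<lambda>s\<in>cells ?W m.
    g m (\<lambda>i\<in>{..m}. snd (s i), act B m n (\<lambda>i\<in>{..m}. fst (s i)) b))" for b
  have proj: "(\<lambda>i\<in>{..m}. fst (s i)) \<in> Delta m n \<and> (\<lambda>i\<in>{..m}. snd (s i)) \<in> Delta m 1"
    if "s \<in> cells ?P m" for s m
    using that by (fastforce simp: mem_cx mem_Delta rel_prod_sel)
  have wall: "((\<lambda>i\<in>{..m}. snd (s i)), act B m n (\<lambda>i\<in>{..m}. fst (s i)) b) \<in> cells (cylinder B A) m"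
    if s: "s \<in> cells ?W m" and b: "b \<in> cells B n" for s m b
  proof -
    have sP: "s \<in> cells ?P m" by (rule cx_mono[OF s]) (auto simp: prism_walls_def)
    have im: "fst ` s ` {..m} = (\<lambda>i\<in>{..m}. fst (s i)) ` {..m}" by force
    have "\<not> {..n} \<subseteq> fst ` s ` {..m} \<or> (\<forall>i\<le>m. snd (s i) = 1)"
      using s by (simp add: mem_cx prism_walls_def image_subset_iff)
    then show ?thesis
      using proj[OF sP] nonsurjective_mem[OF B A low _ _ b, of "\<lambda>i\<in>{..m}. fst (s i)" m]
        sset_act_cell[OF B _ b] im by (auto simp: mem_cylinder)
  qed
  have G: "G b \<in> smap ?W C" if b: "b \<in> cells B n" for b
  proof (rule smapI)
    fix m s assume "s \<in> cells ?W m"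
    then show "G b m s \<in> cells C m" using smap_cell[OF g wall[OF _ b]] by (simp add: G_def)
  next
    fix l m \<phi> s assume \<phi>: "\<phi> \<in> Delta l m" and s: "s \<in> cells ?W m"
    have sP: "s \<in> cells ?P m" by (rule cx_mono[OF s]) (auto simp: prism_walls_def)
    have e: "(\<lambda>i\<in>{..l}. snd ((\<lambda>i\<in>{..l}. s (\<phi> i)) i)) = (\<lambda>i\<in>{..l}. (\<lambda>i\<in>{..m}. snd (s i)) (\<phi> i))"
      "(\<lambda>i\<in>{..l}. fst ((\<lambda>i\<in>{..l}. s (\<phi> i)) i)) = (\<lambda>i\<in>{..l}. (\<lambda>i\<in>{..m}. fst (s i)) (\<phi> i))"
      using Delta_le[OF \<phi>] by auto
    show "G b l (act ?W l m \<phi> s) = act C l m \<phi> (G b m s)"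
      using smap_act[OF g \<phi> wall[OF s b]] cx_act_mem[OF down_closed_prism_walls s \<phi>] s
        sset_act_act[OF B \<phi> conjunct1[OF proj[OF sP]] b] e
      by (simp add: G_def act_cx act_cylinder)
  qed (simp add: G_def)
  have "\<forall>b. \<exists>F. b \<in> cells B n \<longrightarrow> F \<in> smap ?P C \<and> (\<forall>m. \<forall>s\<in>cells ?W m. F m s = G b m s)"
    using prism_extension[OF C G] by blast
  then obtain F where F: "\<And>b. b \<in> cells B n \<Longrightarrow> F b \<in> smap ?P C"
    and FG: "\<And>b m s. b \<in> cells B n \<Longrightarrow> s \<in> cells ?W m \<Longrightarrow> F b m s = G b m s" by metis
  define pr where "pr m \<theta> t = (\<lambda>i\<in>{..m}. (\<theta> i, t i))" for m and \<theta> t :: "nat \<Rightarrow> nat"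
  \<comment> \<open>the operator and the \<open>n\<close>-simplex from which a new simplex arises\<close>
  define dec where "dec m x = (SOME y. fst y \<in> Delta m n \<and> snd y \<in> cells B n \<and> x = act B m n (fst y) (snd y))"
    for m x
  define g' where "g' m x = (if x \<in> cells (cylinder B A) m then g m x
     else if x \<in> cells (cylinder B A') m then F (snd (dec m (snd x))) m (pr m (fst (dec m (snd x))) (fst x))
     else undefined)" for m x
  have pr: "pr m \<theta> t \<in> cells ?P m" if "\<theta> \<in> Delta m n" "t \<in> Delta m 1" for m \<theta> t
    using that by (auto simp: pr_def mem_cx mem_Delta)
  have new: "g' m (t, act B m n \<theta> b) = F b m (pr m \<theta> t)"
    if \<theta>: "\<theta> \<in> Delta m n" and t: "t \<in> Delta m 1" and b: "b \<in> cells B n" and bA: "b \<notin> A n" for m \<theta> t b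
  proof (cases "(t, act B m n \<theta> b) \<in> cells (cylinder B A) m")
    case True
    have p: "pr m \<theta> t \<in> cells ?W m"
    proof -
      have "\<not> {..n} \<subseteq> \<theta> ` {..m} \<or> (\<forall>i\<le>m. t i = 1)"
      proof (rule disjCI)
        assume "\<not> (\<forall>i\<le>m. t i = 1)"
        then have xA: "act B m n \<theta> b \<in> A m" using True unfolding mem_cylinder by blast
        show "\<not> {..n} \<subseteq> \<theta> ` {..m}"
        proof
          assume "{..n} \<subseteq> \<theta> ` {..m}"
          then obtain \<delta> where \<delta>: "\<delta> \<in> Delta n m" "\<And>j. j \<le> n \<Longrightarrow> \<theta> (\<delta> j) = j"
            using Delta_section[OF \<theta>, of 0] by blast
          then have "(\<lambda>i\<in>{..n}. \<theta> (\<delta> i)) = Delta_id n" by (auto simp: Delta_id_def)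
          then have "b = act B n m \<delta> (act B m n \<theta> b)"
            using sset_act_act[OF B \<delta>(1) \<theta> b] sset_act_id[OF B b] by simp
          then show False using xA A \<delta>(1) bA unfolding subobject_def by metis
        qed
      qed
      moreover have "fst ` pr m \<theta> t ` {..m} = \<theta> ` {..m}" "snd ` pr m \<theta> t ` {..m} = t ` {..m}"
        by (force simp: pr_def)+
      ultimately show ?thesis using pr[OF \<theta> t] by (auto simp: mem_cx prism_walls_def)
    qed
    have "(\<lambda>i\<in>{..m}. snd (pr m \<theta> t i)) = t" "(\<lambda>i\<in>{..m}. fst (pr m \<theta> t i)) = \<theta>"
      using Delta_extensional[OF \<theta>] Delta_extensional[OF t] by (auto simp: pr_def extensional_def)
    then show ?thesis using True FG[OF b p] p by (simp add: g'_def G_def)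
  next
    case False
    let ?x = "act B m n \<theta> b"
    have inA': "(t, ?x) \<in> cells (cylinder B A') m"
      using \<theta> t b sset_act_cell[OF B \<theta> b] unfolding mem_cylinder A' by blast
    have xA: "?x \<notin> A m" using False t sset_act_cell[OF B \<theta> b] by (simp add: mem_cylinder)
    let ?P = "\<lambda>y. fst y \<in> Delta m n \<and> snd y \<in> cells B n \<and> ?x = act B m n (fst y) (snd y)"
    have "?P (\<theta>, b)" using \<theta> b by simp
    then have "?P (dec m ?x)" unfolding dec_def by (rule someI)
    then have "b = snd (dec m ?x) \<and> \<theta> = fst (dec m ?x)"
      using eilenberg_zilber[OF B A low \<theta> _ b _ _ xA] by blast
    then show ?thesis using False inA' by (simp add: g'_def)
  qed
  have sub: "x \<in> cells (cylinder B A') m" if "x \<in> cells (cylinder B A) m" for x m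
    using that by (cases x) (auto simp: mem_cylinder A')
  have cases: "(t, x) \<in> cells (cylinder B A) m \<or>
      (\<exists>\<theta> b. \<theta> \<in> Delta m n \<and> t \<in> Delta m 1 \<and> b \<in> cells B n \<and> b \<notin> A n \<and> x = act B m n \<theta> b)"
    if "(t, x) \<in> cells (cylinder B A') m" for t x m
  proof (rule disjCI)
    assume "\<not> (\<exists>\<theta> b. \<theta> \<in> Delta m n \<and> t \<in> Delta m 1 \<and> b \<in> cells B n \<and> b \<notin> A n \<and> x = act B m n \<theta> b)"
    then show "(t, x) \<in> cells (cylinder B A) m"
      using that A unfolding mem_cylinder A' subobject_def by blast
  qed
  have "g' \<in> smap (cylinder B A') C"
  proof (rule smapI)
    fix m x assume x: "x \<in> cells (cylinder B A') m"
    obtain t y where [simp]: "x = (t, y)" by (cases x)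
    show "g' m x \<in> cells C m"
      using cases[OF x[simplified]]
    proof
      assume "(t, y) \<in> cells (cylinder B A) m"
      then show ?thesis using smap_cell[OF g] by (simp add: g'_def)
    next
      assume "\<exists>\<theta> b. \<theta> \<in> Delta m n \<and> t \<in> Delta m 1 \<and> b \<in> cells B n \<and> b \<notin> A n \<and> y = act B m n \<theta> b"
      then show ?thesis using new smap_cell[OF F pr] by auto
    qed
  next
    fix m x assume "x \<notin> cells (cylinder B A') m"
    then show "g' m x = undefined" using sub[of x m] unfolding g'_def by argo
  next
    fix l m \<phi> x assume \<phi>: "\<phi> \<in> Delta l m" and x: "x \<in> cells (cylinder B A') m"
    obtain t y where [simp]: "x = (t, y)" by (cases x)
    show "g' l (act (cylinder B A') l m \<phi> x) = act C l m \<phi> (g' m x)"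
      using cases[OF x[simplified]]
    proof
      assume old: "(t, y) \<in> cells (cylinder B A) m"
      then show ?thesis using smap_act[OF g \<phi> old] cylinder_act_mem[OF B A old \<phi>]
        by (simp add: g'_def act_cylinder)
    next
      assume "\<exists>\<theta> b. \<theta> \<in> Delta m n \<and> t \<in> Delta m 1 \<and> b \<in> cells B n \<and> b \<notin> A n \<and> y = act B m n \<theta> b"
      then obtain \<theta> b where \<theta>: "\<theta> \<in> Delta m n" and t: "t \<in> Delta m 1" and b: "b \<in> cells B n" "b \<notin> A n"
        and y: "y = act B m n \<theta> b" by blast
      have "(\<lambda>i\<in>{..l}. pr m \<theta> t (\<phi> i)) = pr l (\<lambda>i\<in>{..l}. \<theta> (\<phi> i)) (\<lambda>i\<in>{..l}. t (\<phi> i))"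
        using Delta_le[OF \<phi>] by (auto simp: pr_def)
      then show ?thesis
        using smap_act[OF F[OF b(1)] \<phi> pr[OF \<theta> t]] new[OF \<theta> t b]
          new[OF Delta_comp[OF \<phi> \<theta>] Delta_comp[OF \<phi> t] b] sset_act_act[OF B \<phi> \<theta> b(1)]
        by (simp add: act_cylinder act_cx y)
    qed
  qed
  moreover have "g' m x = g m x" if "x \<in> cells (cylinder B A) m" for m x
    using that by (simp add: g'_def)
  ultimately show ?thesis by blast
qed

text \<open>
Induction over the skeleta. The simplices of dimension \<open>m\<close> are reached at stage \<open>m + 1\<close>, and the
later stages do not change their values.
\<close>

lemma homotopy_extension:
  assumes B: "is_sset B" and A: "subobject B A" and C: "is_kan C" and g: "g \<in> smap (cylinder B A) C"
  shows "\<exists>g'\<in>smap (sprod (simplex 1) B) C. \<forall>m. \<forall>x\<in>cells (cylinder B A) m. g' m x = g m x"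
proof -
  let ?D = "\<lambda>n. cylinder B (skeleton B A n)"
  have "\<exists>G. \<forall>n. (G n \<in> smap (?D n) C \<and> (\<forall>m. \<forall>x\<in>cells (cylinder B A) m. G n m x = g m x)) \<and>
      (\<forall>m. \<forall>x\<in>cells (?D n) m. G (Suc n) m x = G n m x)"
  proof (rule dependent_nat_choice)
    show "\<exists>G. G \<in> smap (?D 0) C \<and> (\<forall>m. \<forall>x\<in>cells (cylinder B A) m. G m x = g m x)"
      using g by (auto simp: skeleton_0)
  next
    fix G n assume G: "G \<in> smap (?D n) C \<and> (\<forall>m. \<forall>x\<in>cells (cylinder B A) m. G m x = g m x)"
    obtain G' where G': "G' \<in> smap (?D (Suc n)) C" "\<And>m x. x \<in> cells (?D n) m \<Longrightarrow> G' m x = G m x"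
      using skeleton_step[OF B subobject_skeleton[OF B A] skeleton_low[OF B] C conjunct1[OF G] skeleton_Suc]
      by blast
    have "x \<in> cells (?D n) m" if "x \<in> cells (cylinder B A) m" for x m
      using that by (cases x) (auto simp: mem_cylinder skeleton_def)
    then show "\<exists>G'. (G' \<in> smap (?D (Suc n)) C \<and> (\<forall>m. \<forall>x\<in>cells (cylinder B A) m. G' m x = g m x)) \<and>
      (\<forall>m. \<forall>x\<in>cells (?D n) m. G' m x = G m x)"
      using G G' by metis
  qed
  then obtain G where G: "\<And>n. G n \<in> smap (?D n) C"
    and Gg: "\<And>n m x. x \<in> cells (cylinder B A) m \<Longrightarrow> G n m x = g m x"
    and GS: "\<And>n m x. x \<in> cells (?D n) m \<Longrightarrow> G (Suc n) m x = G n m x" by metis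
  have mono: "x \<in> cells (?D k) m" if "x \<in> cells (?D n) m" "n \<le> k" for n k x m
    using that by (cases x) (auto simp: mem_cylinder skeleton_def)
  have GG: "G k m x = G n m x" if "x \<in> cells (?D n) m" "n \<le> k" for n k m x
    using that(2)
  proof (induction k rule: dec_induct)
    case (step k)
    then show ?case using GS[OF mono[OF that(1)]] by simp
  qed simp
  have all: "x \<in> cells (?D n) m" if "x \<in> cells (sprod (simplex 1) B) m" "m < n" for x m n
    using that skeleton_low[OF B that(2)] by (cases x) (auto simp: mem_cylinder sprod_def cells_simplex)
  define g' where "g' m x = (if x \<in> cells (sprod (simplex 1) B) m then G (Suc m) m x else undefined)" for m x
  have g'G: "g' m x = G n m x" if "x \<in> cells (sprod (simplex 1) B) m" "m < n" for m x n
    using GG[OF all[OF that(1), of "Suc m"], of n] that by (simp add: g'_def)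
  have "g' \<in> smap (sprod (simplex 1) B) C"
  proof (rule smapI)
    fix m x assume x: "x \<in> cells (sprod (simplex 1) B) m"
    show "g' m x \<in> cells C m" using smap_cell[OF G all[OF x lessI]] x by (simp add: g'_def)
  next
    fix l m \<phi> x assume \<phi>: "\<phi> \<in> Delta l m" and x: "x \<in> cells (sprod (simplex 1) B) m"
    let ?n = "Suc (max l m)"
    let ?y = "act (sprod (simplex 1) B) l m \<phi> x"
    have y: "?y = act (?D ?n) l m \<phi> x" by (simp add: cylinder_def)
    have "?y \<in> cells (sprod (simplex 1) B) l"
      using x cylinder_act_mem[OF B subobject_cells[OF B] _ \<phi>]
      by (cases x) (auto simp: cylinder_full act_cylinder simp flip: act_cylinder[of B "cells B"])
    then show "g' l ?y = act C l m \<phi> (g' m x)"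
      using g'G[of ?y l ?n] g'G[OF x, of ?n] smap_act[OF G \<phi> all[OF x, of ?n]] y by simp
  qed (simp add: g'_def)
  moreover have "g' m x = g m x" if "x \<in> cells (cylinder B A) m" for m x
  proof -
    have "x \<in> cells (sprod (simplex 1) B) m"
      using that by (cases x) (auto simp: mem_cylinder sprod_def cells_simplex)
    then show ?thesis using g'G[of x m "Suc m"] Gg[OF that] by simp
  qed
  ultimately show ?thesis by blast
qed

section \<open>Mapping spaces and boxes in cubes\<close>

lemma cells_shom: "cells (shom X Y) n = smap (sprod (simplex n) X) Y"
  by (simp add: shom_def)

lemma mem_sprod: "(x, y) \<in> cells (sprod X Y) n \<longleftrightarrow> x \<in> cells X n \<and> y \<in> cells Y n"
  by (simp add: sprod_def)

lemma act_sprod: "act (sprod X Y) m n \<theta> (x, y) = (act X m n \<theta> x, act Y m n \<theta> y)"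
  by (simp add: sprod_def)

lemma is_sset_sprod:
  assumes "is_sset X" "is_sset Y" shows "is_sset (sprod X Y)"
proof (rule is_ssetI)
  fix m n \<theta> p assume "\<theta> \<in> Delta m n" "p \<in> cells (sprod X Y) n"
  then show "act (sprod X Y) m n \<theta> p \<in> cells (sprod X Y) m"
    using sset_act_cell[OF assms(1)] sset_act_cell[OF assms(2)] by (cases p) (auto simp: mem_sprod act_sprod)
next
  fix n p assume "p \<in> cells (sprod X Y) n"
  then show "act (sprod X Y) n n (Delta_id n) p = p"
    using sset_act_id[OF assms(1)] sset_act_id[OF assms(2)] by (cases p) (auto simp: mem_sprod act_sprod)
next
  fix l m n \<phi> \<theta> p assume "\<phi> \<in> Delta l m" "\<theta> \<in> Delta m n" "p \<in> cells (sprod X Y) n"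
  then show "act (sprod X Y) l n (\<lambda>i\<in>{..l}. \<theta> (\<phi> i)) p =
      act (sprod X Y) l m \<phi> (act (sprod X Y) m n \<theta> p)"
    using sset_act_act[OF assms(1)] sset_act_act[OF assms(2)] by (cases p) (auto simp: mem_sprod act_sprod)
qed

lemma act_simplex: "act (simplex n) k m \<theta> \<alpha> = (\<lambda>i\<in>{..k}. \<alpha> (\<theta> i))"
  by (simp add: simplex_cx act_cx)

lemma act_shom: "\<alpha> \<in> Delta k m \<Longrightarrow> x \<in> cells X k \<Longrightarrow>
    act (shom X Y) m n \<theta> f k (\<alpha>, x) = f k (\<lambda>i\<in>{..k}. \<theta> (\<alpha> i), x)"
  by (simp add: shom_def cells_simplex compose_def)

lemma act_shom_undefined: "\<not> (\<alpha> \<in> Delta k m \<and> x \<in> cells X k) \<Longrightarrow>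
    act (shom X Y) m n \<theta> f k (\<alpha>, x) = undefined"
  by (auto simp: shom_def cells_simplex)

lemma Delta_comp_id: "\<alpha> \<in> Delta k m \<Longrightarrow> (\<lambda>i\<in>{..k}. \<alpha> (Delta_id k i)) = \<alpha>"
  and Delta_id_comp: "\<alpha> \<in> Delta k m \<Longrightarrow> (\<lambda>i\<in>{..k}. Delta_id m (\<alpha> i)) = \<alpha>"
  by (auto simp: Delta_id_def mem_Delta extensional_def)

text \<open>
A map to a mapping space is determined by the values of its simplices on the tautological simplex
of \<open>\<Delta>\<^sup>l\<close>; \<open>uncurry\<close> and \<open>curry_map\<close> are the adjunction between products and internal homs.
\<close>

definition uncurry :: "'k sset \<Rightarrow> 'a sset \<Rightarrow> (nat \<Rightarrow> 'k \<Rightarrow> nat \<Rightarrow> (nat \<Rightarrow> nat) \<times> 'a \<Rightarrow> 'b) \<Rightarrow>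
    nat \<Rightarrow> 'k \<times> 'a \<Rightarrow> 'b" where
  "uncurry K X G = (\<lambda>l. \<lambda>(s, x)\<in>cells (sprod K X) l. G l s l (Delta_id l, x))"

definition curry_map :: "'k sset \<Rightarrow> 'a sset \<Rightarrow> (nat \<Rightarrow> 'k \<times> 'a \<Rightarrow> 'b) \<Rightarrow>
    nat \<Rightarrow> 'k \<Rightarrow> nat \<Rightarrow> (nat \<Rightarrow> nat) \<times> 'a \<Rightarrow> 'b" where
  "curry_map K X H = (\<lambda>l. \<lambda>s\<in>cells K l. \<lambda>k. \<lambda>(\<alpha>, x)\<in>cells (sprod (simplex l) X) k. H k (act K k l \<alpha> s, x))"

lemma uncurry_smap:
  assumes K: "is_sset K" and X: "is_sset X" and G: "G \<in> smap K (shom X Y)"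
  shows "uncurry K X G \<in> smap (sprod K X) Y"
proof (rule smapI)
  fix l p assume "p \<in> cells (sprod K X) l"
  then obtain s x where p: "p = (s, x)" "s \<in> cells K l" "x \<in> cells X l" by (cases p) (auto simp: mem_sprod)
  have "G l s \<in> smap (sprod (simplex l) X) Y" using smap_cell[OF G p(2)] by (simp add: cells_shom)
  then have "G l s l (Delta_id l, x) \<in> cells Y l"
    by (rule smap_cell) (simp add: mem_sprod p cells_simplex Delta_id_mem)
  then show "uncurry K X G l p \<in> cells Y l" using p by (simp add: uncurry_def mem_sprod)
next
  fix j l \<phi> p assume \<phi>: "\<phi> \<in> Delta j l" and "p \<in> cells (sprod K X) l"
  then obtain s x where p: "p = (s, x)" "s \<in> cells K l" "x \<in> cells X l" by (cases p) (auto simp: mem_sprod)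
  have Gs: "G l s \<in> smap (sprod (simplex l) X) Y" using smap_cell[OF G p(2)] by (simp add: cells_shom)
  have idx: "(Delta_id l, x) \<in> cells (sprod (simplex l) X) l"
    by (simp add: mem_sprod p cells_simplex Delta_id_mem)
  have "G j (act K j l \<phi> s) j (Delta_id j, act X j l \<phi> x) = G l s j (\<phi>, act X j l \<phi> x)"
    using smap_act[OF G \<phi> p(2)] Delta_comp_id[OF \<phi>]
    by (simp add: act_shom[OF Delta_id_mem sset_act_cell[OF X \<phi> p(3)]])
  also have "\<dots> = act Y j l \<phi> (G l s l (Delta_id l, x))"
    using smap_act[OF Gs \<phi> idx] Delta_id_comp[OF \<phi>] by (simp add: act_sprod act_simplex)
  finally show "uncurry K X G j (act (sprod K X) j l \<phi> p) = act Y j l \<phi> (uncurry K X G l p)"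
    using p sset_act_cell[OF K \<phi> p(2)] sset_act_cell[OF X \<phi> p(3)]
    by (simp add: uncurry_def mem_sprod act_sprod)
qed (simp add: uncurry_def)

lemma curry_smap:
  assumes K: "is_sset K" and X: "is_sset X" and H: "H \<in> smap (sprod K X) Y"
  shows "curry_map K X H \<in> smap K (shom X Y)"
proof (rule smapI)
  fix l s assume s: "s \<in> cells K l"
  have "curry_map K X H l s \<in> smap (sprod (simplex l) X) Y"
  proof (rule smapI)
    fix k p assume "p \<in> cells (sprod (simplex l) X) k"
    then obtain \<alpha> x where p: "p = (\<alpha>, x)" "\<alpha> \<in> Delta k l" "x \<in> cells X k"
      by (cases p) (auto simp: mem_sprod cells_simplex)
    then have "(act K k l \<alpha> s, x) \<in> cells (sprod K X) k" using sset_act_cell[OF K p(2) s] by (simp add: mem_sprod)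
    then show "curry_map K X H l s k p \<in> cells Y k"
      using smap_cell[OF H] p s by (simp add: curry_map_def mem_sprod cells_simplex)
  next
    fix j k \<phi> p assume \<phi>: "\<phi> \<in> Delta j k" and "p \<in> cells (sprod (simplex l) X) k"
    then obtain \<alpha> x where p: "p = (\<alpha>, x)" "\<alpha> \<in> Delta k l" "x \<in> cells X k"
      by (cases p) (auto simp: mem_sprod cells_simplex)
    then have sx: "(act K k l \<alpha> s, x) \<in> cells (sprod K X) k" using sset_act_cell[OF K p(2) s] by (simp add: mem_sprod)
    show "curry_map K X H l s j (act (sprod (simplex l) X) j k \<phi> p) = act Y j k \<phi> (curry_map K X H l s k p)"
      using smap_act[OF H \<phi> sx] p s sset_act_cell[OF X \<phi> p(3)] Delta_comp[OF \<phi> p(2)]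
        sset_act_act[OF K \<phi> p(2) s]
      by (simp add: curry_map_def mem_sprod cells_simplex act_sprod act_simplex)
  qed (use s in \<open>simp add: curry_map_def\<close>)
  then show "curry_map K X H l s \<in> cells (shom X Y) l" by (simp add: cells_shom)
next
  fix j l \<phi> s assume \<phi>: "\<phi> \<in> Delta j l" and s: "s \<in> cells K l"
  show "curry_map K X H j (act K j l \<phi> s) = act (shom X Y) j l \<phi> (curry_map K X H l s)"
  proof (intro ext)
    fix k p obtain \<alpha> x where p: "p = (\<alpha> :: nat \<Rightarrow> nat, x :: 'b)" by (cases p)
    show "curry_map K X H j (act K j l \<phi> s) k p = act (shom X Y) j l \<phi> (curry_map K X H l s) k p"
    proof (cases "\<alpha> \<in> Delta k j \<and> x \<in> cells X k")
      case True
      then show ?thesis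
        using p s sset_act_cell[OF K \<phi> s] Delta_comp[of \<alpha> k j \<phi> l] \<phi> sset_act_act[OF K _ \<phi> s, of \<alpha> k]
        by (simp add: curry_map_def mem_sprod cells_simplex act_shom)
    next
      case False
      then show ?thesis
        using p sset_act_cell[OF K \<phi> s]
        by (auto simp add: curry_map_def mem_sprod cells_simplex act_shom_undefined)
    qed
  qed
qed (simp add: curry_map_def)

lemma curry_uncurry:
  assumes K: "is_sset K" and G: "G \<in> smap K (shom X Y)"
    and s: "s \<in> cells K l" and \<alpha>: "\<alpha> \<in> Delta k l" and x: "x \<in> cells X k"
  shows "uncurry K X G k (act K k l \<alpha> s, x) = G l s k (\<alpha>, x)"
  using smap_act[OF G \<alpha> s] Delta_comp_id[OF \<alpha>] sset_act_cell[OF K \<alpha> s] x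
  by (simp add: uncurry_def mem_sprod act_shom[OF Delta_id_mem x])

text \<open>
The vertices of \<^term>\<open>paths i j\<close>, a cube with one coordinate for each element strictly between the
endpoints.
\<close>

definition path_sets :: "nat \<Rightarrow> nat \<Rightarrow> nat set set" where
  "path_sets i j = {S. S \<subseteq> {i..j} \<and> i \<in> S \<and> j \<in> S}"

lemma paths_cx: "paths i j = chain_cx (\<subseteq>) (Pow (path_sets i j))"
  by (simp add: paths_def pnerve_cx path_sets_def)

text \<open>
The part of the cube \<^term>\<open>paths 0 n\<close> that an inner horn \<open>\<Lambda>\<^sup>n\<^sub>k\<close> determines: the faces \<open>j \<notin> T\<close> with
\<open>j \<noteq> k\<close> come from the faces of the horn, and the faces \<open>j \<in> T\<close> come from composition.
\<close>

definition box :: "nat \<Rightarrow> nat \<Rightarrow> nat set set set" where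
  "box n k = {c. c \<subseteq> path_sets 0 n \<and>
     ((\<exists>j\<le>n. j \<noteq> k \<and> (\<forall>T\<in>c. j \<notin> T)) \<or> (\<exists>j. 0 < j \<and> j < n \<and> (\<forall>T\<in>c. j \<in> T)))}"

lemma down_closed_box: "down_closed (box n k)"
  unfolding down_closed_def box_def by blast

text \<open>
The cube is the product of its face \<open>k \<notin> T\<close> with an interval in the direction of \<open>k\<close>. The box
consists of the end \<open>k \<in> T\<close> of this interval and of the product of the interval with the boundary of
the face. Passing to the adjoint map with values in \<open>Y\<close>, it is a cylinder over the product of the
face with \<open>X\<close>, to which homotopy extension applies.
\<close>

lemma box_extension:
  fixes X :: "'a sset"
  assumes X: "is_sset X" and Y: "is_kan Y" and k: "0 < k" "k < n"
    and G: "G \<in> smap (chain_cx (\<subseteq>) (box n k)) (shom X Y)"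
  shows "\<exists>G'\<in>smap (paths 0 n) (shom X Y). \<forall>m. \<forall>s\<in>cells (chain_cx (\<subseteq>) (box n k)) m. G' m s = G m s"
proof -
  let ?Kb = "chain_cx (\<subseteq>) (box n k)"
  let ?K = "chain_cx (\<subseteq>) (Pow (path_sets 0 n))"
  \<comment> \<open>\<open>F\<close> is the face \<open>k \<notin> T\<close> of the cube, and \<open>A\<close> is its boundary times \<open>X\<close>\<close>
  define F where "F = chain_cx (\<subseteq>) (Pow {T \<in> path_sets 0 n. k \<notin> T})"
  define B where "B = sprod F X"
  define A where "A m = {(u, x). (u, x) \<in> cells B m \<and>
      (\<exists>j. 0 < j \<and> j < n \<and> j \<noteq> k \<and> ((\<forall>i\<le>m. j \<notin> u i) \<or> (\<forall>i\<le>m. j \<in> u i)))}" for m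
  define H where "H = uncurry ?Kb X G"
  have Kb: "is_sset ?Kb" by (rule is_sset_cx[OF down_closed_box])
  have Ksset: "is_sset ?K" by (rule is_sset_cx[OF down_closed_Pow])
  have Fsset: "is_sset F" unfolding F_def by (rule is_sset_cx[OF down_closed_Pow])
  have B: "is_sset B" unfolding B_def by (rule is_sset_sprod[OF Fsset X])
  have H: "H \<in> smap (sprod ?Kb X) Y" unfolding H_def by (rule uncurry_smap[OF Kb X G])
  have A: "subobject B A"
    unfolding subobject_def
  proof (intro conjI allI ballI)
    show "A m \<subseteq> cells B m" for m by (auto simp: A_def)
    fix l m \<phi> p assume \<phi>: "\<phi> \<in> Delta l m" and p: "p \<in> A m"
    obtain u x where [simp]: "p = (u, x)" by (cases p)
    have "act B l m \<phi> (u, x) = (\<lambda>i\<in>{..l}. u (\<phi> i), act X l m \<phi> x)"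
      by (simp add: B_def act_sprod F_def act_cx)
    moreover have "act B l m \<phi> (u, x) \<in> cells B l"
      using p sset_act_cell[OF B \<phi>] by (auto simp: A_def)
    moreover obtain j where "0 < j" "j < n" "j \<noteq> k" "(\<forall>i\<le>m. j \<notin> u i) \<or> (\<forall>i\<le>m. j \<in> u i)"
      using p by (auto simp: A_def)
    moreover from this have "(\<forall>i\<le>l. j \<notin> (\<lambda>i\<in>{..l}. u (\<phi> i)) i) \<or> (\<forall>i\<le>l. j \<in> (\<lambda>i\<in>{..l}. u (\<phi> i)) i)"
      using Delta_le[OF \<phi>] by auto
    ultimately show "act B l m \<phi> p \<in> A l" unfolding A_def by auto
  qed
  \<comment> \<open>\<open>jn\<close> identifies the product of the face and the interval with the cube, and \<open>sp\<close> below inverts it\<close>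
  define jn where "jn m t u = (\<lambda>i\<in>{..m}. u i \<union> (if t i = (1::nat) then {k} else {}))"
    for m :: nat and t :: "nat \<Rightarrow> nat" and u :: "nat \<Rightarrow> nat set"
  have jn: "jn m t u \<in> cells ?Kb m" and xX: "x \<in> cells X m"
    if p: "(t, u, x) \<in> cells (cylinder B A) m" for m t u x
  proof -
    have t: "t \<in> Delta m 1" and u: "u \<in> cells F m" and x: "x \<in> cells X m"
      and c: "(\<exists>j. 0 < j \<and> j < n \<and> j \<noteq> k \<and> ((\<forall>i\<le>m. j \<notin> u i) \<or> (\<forall>i\<le>m. j \<in> u i))) \<or> (\<forall>i\<le>m. t i = 1)"
      using p by (auto simp: mem_cylinder A_def B_def mem_sprod)
    show "x \<in> cells X m" by (rule x)
    have "jn m t u i \<subseteq> jn m t u j" if "i \<le> j" "j \<le> m" for i j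
    proof -
      have "u i \<subseteq> u j" using u that by (simp add: F_def mem_cx)
      moreover have "t i = 1 \<Longrightarrow> t j = 1" using t that Delta_mono[OF t that] Delta_le[OF t, of j] by simp
      ultimately show ?thesis using that by (auto simp: jn_def)
    qed
    moreover have "jn m t u ` {..m} \<in> box n k"
    proof -
      have "jn m t u i \<in> path_sets 0 n" if "i \<le> m" for i
      proof -
        have "u i \<in> path_sets 0 n" using u that by (auto simp: F_def mem_cx)
        then show ?thesis using that k by (auto simp: jn_def path_sets_def)
      qed
      then have "jn m t u ` {..m} \<subseteq> path_sets 0 n" by auto
      moreover from c have "(\<exists>j\<le>n. j \<noteq> k \<and> (\<forall>i\<le>m. j \<notin> jn m t u i)) \<or>
          (\<exists>j. 0 < j \<and> j < n \<and> (\<forall>i\<le>m. j \<in> jn m t u i))"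
      proof
        assume "\<forall>i\<le>m. t i = 1"
        then show ?thesis using k by (auto simp: jn_def)
      next
        assume "\<exists>j. 0 < j \<and> j < n \<and> j \<noteq> k \<and> ((\<forall>i\<le>m. j \<notin> u i) \<or> (\<forall>i\<le>m. j \<in> u i))"
        then obtain j where j: "0 < j" "j < n" "j \<noteq> k" and d: "(\<forall>i\<le>m. j \<notin> u i) \<or> (\<forall>i\<le>m. j \<in> u i)" by blast
        from d show ?thesis
        proof
          assume "\<forall>i\<le>m. j \<notin> u i"
          then have "\<forall>i\<le>m. j \<notin> jn m t u i" using j by (simp add: jn_def)
          then show ?thesis using j less_imp_le by blast
        next
          assume "\<forall>i\<le>m. j \<in> u i"
          then have "\<forall>i\<le>m. j \<in> jn m t u i" by (simp add: jn_def)
          then show ?thesis using j by blast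
        qed
      qed
      ultimately show ?thesis unfolding box_def by blast
    qed
    ultimately show "jn m t u \<in> cells ?Kb m" by (simp add: mem_cx jn_def)
  qed
  define g where "g = (\<lambda>m. \<lambda>(t, u, x)\<in>cells (cylinder B A) m. H m (jn m t u, x))"
  have g: "g \<in> smap (cylinder B A) Y"
  proof (rule smapI)
    fix m p assume p: "p \<in> cells (cylinder B A) m"
    obtain t u x where [simp]: "p = (t, u, x)" by (cases p) auto
    have "(jn m t u, x) \<in> cells (sprod ?Kb X) m" using jn xX p by (simp add: mem_sprod)
    then show "g m p \<in> cells Y m" using p smap_cell[OF H] by (simp add: g_def)
  next
    fix l m \<phi> p assume \<phi>: "\<phi> \<in> Delta l m" and p: "p \<in> cells (cylinder B A) m"
    obtain t u x where [simp]: "p = (t, u, x)" by (cases p) auto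
    have q: "(jn m t u, x) \<in> cells (sprod ?Kb X) m" using jn xX p by (simp add: mem_sprod)
    have a: "act B l m \<phi> (u, x) = (\<lambda>i\<in>{..l}. u (\<phi> i), act X l m \<phi> x)"
      by (simp add: B_def act_sprod F_def act_cx)
    have "jn l (\<lambda>i\<in>{..l}. t (\<phi> i)) (\<lambda>i\<in>{..l}. u (\<phi> i)) = (\<lambda>i\<in>{..l}. jn m t u (\<phi> i))"
      unfolding jn_def by (rule restrict_ext) (use Delta_le[OF \<phi>] in simp)
    then show "g l (act (cylinder B A) l m \<phi> p) = act Y l m \<phi> (g m p)"
      using p smap_act[OF H \<phi> q] cylinder_act_mem[OF B A _ \<phi>, of t "(u, x)"]
      by (simp add: g_def act_cylinder a act_sprod act_cx)
  qed (simp add: g_def)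
  obtain g' where g': "g' \<in> smap (sprod (simplex 1) B) Y"
    and g'g: "\<And>m p. p \<in> cells (cylinder B A) m \<Longrightarrow> g' m p = g m p"
    using homotopy_extension[OF B A Y g] by blast
  define sp where "sp m s x = (\<lambda>i\<in>{..m}. if k \<in> s i then 1 else 0 :: nat, \<lambda>i\<in>{..m}. s i - {k}, x)"
    for m :: nat and s :: "nat \<Rightarrow> nat set" and x :: 'a
  have sp: "sp m s x \<in> cells (sprod (simplex 1) B) m" if s: "s \<in> cells ?K m" and x: "x \<in> cells X m" for m s x
  proof -
    have mono: "s i \<subseteq> s j" if "i \<le> j" "j \<le> m" for i j using s that by (simp add: mem_cx)
    have "s i \<in> path_sets 0 n" if "i \<le> m" for i using s that by (auto simp: mem_cx)
    then have "(\<lambda>i\<in>{..m}. s i - {k}) ` {..m} \<subseteq> {T \<in> path_sets 0 n. k \<notin> T}"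
      using k by (auto simp: path_sets_def)
    then have "(\<lambda>i\<in>{..m}. s i - {k}) \<in> cells F m"
      using mono by (auto simp: F_def mem_cx; blast)
    moreover have "(\<lambda>i\<in>{..m}. if k \<in> s i then 1 else 0) \<in> Delta m 1"
      using mono by (auto simp: mem_Delta; blast)
    ultimately show ?thesis using x by (simp add: sp_def mem_sprod cells_simplex B_def)
  qed
  define H' where "H' = (\<lambda>m. \<lambda>(s, x)\<in>cells (sprod ?K X) m. g' m (sp m s x))"
  have H': "H' \<in> smap (sprod ?K X) Y"
  proof (rule smapI)
    fix m p assume p: "p \<in> cells (sprod ?K X) m"
    then show "H' m p \<in> cells Y m"
      using smap_cell[OF g' sp] by (cases p) (auto simp: H'_def mem_sprod)
  next
    fix l m \<phi> p assume \<phi>: "\<phi> \<in> Delta l m" and p: "p \<in> cells (sprod ?K X) m"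
    obtain s x where [simp]: "p = (s, x)" by (cases p)
    have s: "s \<in> cells ?K m" and x: "x \<in> cells X m" using p by (auto simp: mem_sprod)
    have "sp l (\<lambda>i\<in>{..l}. s (\<phi> i)) (act X l m \<phi> x) = act (sprod (simplex 1) B) l m \<phi> (sp m s x)"
      using Delta_le[OF \<phi>]
      by (auto simp: sp_def act_sprod B_def F_def act_cx act_simplex intro!: restrict_ext)
    then show "H' l (act (sprod ?K X) l m \<phi> p) = act Y l m \<phi> (H' m p)"
      using smap_act[OF g' \<phi> sp[OF s x]] p sset_act_cell[OF Ksset \<phi> s] sset_act_cell[OF X \<phi> x]
      by (simp add: H'_def act_sprod act_cx mem_sprod)
  qed (simp add: H'_def)
  have HH: "H' m (s, x) = H m (s, x)" if s: "s \<in> cells ?Kb m" and x: "x \<in> cells X m" for m s x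
  proof -
    have sK: "s \<in> cells ?K m" by (rule cx_mono[OF s]) (auto simp: box_def)
    have ps: "0 \<in> s i \<and> n \<in> s i" if "i \<le> m" for i
      using sK that by (auto simp: mem_cx path_sets_def)
    have "(\<exists>j. 0 < j \<and> j < n \<and> j \<noteq> k \<and> ((\<forall>i\<le>m. j \<notin> s i) \<or> (\<forall>i\<le>m. j \<in> s i))) \<or> (\<forall>i\<le>m. k \<in> s i)"
    proof -
      have "(\<exists>j\<le>n. j \<noteq> k \<and> (\<forall>i\<le>m. j \<notin> s i)) \<or> (\<exists>j. 0 < j \<and> j < n \<and> (\<forall>i\<le>m. j \<in> s i))"
        using s by (auto simp: mem_cx box_def)
      then show ?thesis
      proof
        assume "\<exists>j\<le>n. j \<noteq> k \<and> (\<forall>i\<le>m. j \<notin> s i)"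
        then obtain j where j: "j \<le> n" "j \<noteq> k" "\<forall>i\<le>m. j \<notin> s i" by blast
        then have "j \<notin> s 0" by blast
        then have "j \<noteq> 0" "j \<noteq> n" using ps[of 0] by (metis le0)+
        then show ?thesis using j by (metis le_neq_implies_less not_gr_zero)
      qed blast
    qed
    moreover have "sp m s x \<in> cells (sprod (simplex 1) B) m" by (rule sp[OF sK x])
    ultimately have mem: "sp m s x \<in> cells (cylinder B A) m"
      by (auto simp: sp_def mem_cylinder mem_sprod cells_simplex A_def)
    have "jn m (fst (sp m s x)) (fst (snd (sp m s x))) = s"
    proof (rule ext)
      fix i show "jn m (fst (sp m s x)) (fst (snd (sp m s x))) i = s i"
        using s by (cases "i \<le> m") (auto simp: jn_def sp_def mem_cx extensional_def)
    qed
    then show ?thesis using g'g[OF mem] mem sK x by (simp add: H'_def mem_sprod g_def sp_def)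
  qed
  have "curry_map ?K X H' \<in> smap (paths 0 n) (shom X Y)"
    unfolding paths_cx by (rule curry_smap[OF Ksset X H'])
  moreover have "curry_map ?K X H' m s = G m s" if s: "s \<in> cells ?Kb m" for m s
  proof (intro ext)
    fix i p obtain \<alpha> x where p: "p = (\<alpha> :: nat \<Rightarrow> nat, x :: 'a)" by (cases p)
    have sK: "s \<in> cells ?K m" by (rule cx_mono[OF s]) (auto simp: box_def)
    have Gs: "G m s \<in> smap (sprod (simplex m) X) Y" using smap_cell[OF G s] by (simp add: cells_shom)
    show "curry_map ?K X H' m s i p = G m s i p"
    proof (cases "\<alpha> \<in> Delta i m \<and> x \<in> cells X i")
      case True
      then have "act ?Kb i m \<alpha> s \<in> cells ?Kb i" using sset_act_cell[OF Kb _ s] by simp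
      then have "H' i (act ?K i m \<alpha> s, x) = H i (act ?Kb i m \<alpha> s, x)" using HH True by (simp add: act_cx)
      then show ?thesis using curry_uncurry[OF Kb G s] True sK p
        by (simp add: curry_map_def mem_sprod cells_simplex H_def)
    next
      case False
      then show ?thesis using sK p smap_undefined[OF Gs, of p i]
        by (auto simp: curry_map_def mem_sprod cells_simplex)
    qed
  qed
  ultimately show ?thesis by blast
qed

lemma restrict_eqI: "s \<in> extensional A \<Longrightarrow> (\<And>x. x \<in> A \<Longrightarrow> f x = s x) \<Longrightarrow> restrict f A = s"
  by (rule extensionalityI[of _ A]) auto

lemma paths_extensional: "s \<in> cells (paths i j) d \<Longrightarrow> s \<in> extensional {..d}"
  by (simp add: paths_cx mem_cx)

section \<open>The homotopy coherent nerve\<close>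

lemma mem_hc_nerve:
  "(a, F) \<in> cells (hc_nerve C) n \<longleftrightarrow>
     a \<in> extensional {..n} \<and> (\<forall>i\<le>n. a i \<in> sobj C) \<and>
     F \<in> extensional (tri n) \<and> (\<forall>i j. i \<le> j \<and> j \<le> n \<longrightarrow> F (i, j) \<in> smap (paths i j) (smor C (a i) (a j))) \<and>
     (\<forall>i\<le>n. \<forall>m. F (i, i) m (\<lambda>_\<in>{..m}. {i}) = sidn C (a i) m) \<and>
     (\<forall>i j k. i \<le> j \<and> j \<le> k \<and> k \<le> n \<longrightarrow>
        (\<forall>m. \<forall>s \<in> cells (paths i j) m. \<forall>t \<in> cells (paths j k) m.
           F (i, k) m (\<lambda>l\<in>{..m}. s l \<union> t l) =
             scomp C (a i) (a j) (a k) m (F (j, k) m t) (F (i, j) m s)))"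
  by (auto simp: hc_nerve_def PiE_def Pi_def tri_def)

lemma act_hc_nerve:
  "act (hc_nerve C) m n \<theta> (a, F) =
     (\<lambda>i\<in>{..m}. a (\<theta> i), \<lambda>(i, j)\<in>tri m. pull (\<subseteq>) (Pow (path_sets i j)) ((`) \<theta>) (F (\<theta> i, \<theta> j)))"
  by (simp add: hc_nerve_def compose_def pull_def paths_cx)

lemma path_sets_image:
  assumes "\<theta> \<in> Delta m n" "j \<le> m" "S \<in> path_sets i j"
  shows "\<theta> ` S \<in> path_sets (\<theta> i) (\<theta> j)"
proof -
  have "\<theta> l \<in> {\<theta> i..\<theta> j}" if "l \<in> S" for l
    using that assms Delta_mono[OF assms(1), of i l] Delta_mono[OF assms(1), of l j]
    by (auto simp: path_sets_def)
  then show ?thesis using assms(3) by (auto simp: path_sets_def)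
qed

lemma paths_image:
  assumes "\<theta> \<in> Delta m n" "j \<le> m" "s \<in> cells (paths i j) d"
  shows "(\<lambda>l\<in>{..d}. \<theta> ` s l) \<in> cells (paths (\<theta> i) (\<theta> j)) d"
  using assms(3) unfolding paths_cx by (rule map_cells) (use path_sets_image[OF assms(1,2)] in auto)

lemma paths_union:
  assumes "s \<in> cells (paths i j) m" "t \<in> cells (paths j k) m"
  shows "(\<lambda>l\<in>{..m}. s l \<union> t l) \<in> cells (paths i k) m"
proof -
  have "s l \<union> t l \<in> path_sets i k" if "l \<le> m" for l
  proof -
    have "s l \<in> path_sets i j" "t l \<in> path_sets j k" using assms that by (auto simp: paths_cx mem_cx)
    then show ?thesis unfolding path_sets_def by fastforce
  qed
  then show ?thesis using assms by (auto simp: paths_cx mem_cx) blast+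
qed

text \<open>
An operator acts by taking images of vertex sets. This preserves singletons and unions, so that the
identity and composition laws are inherited.
\<close>

lemma is_sset_hc_nerve: "is_sset (hc_nerve C)"
proof (rule is_ssetI)
  fix m n \<theta> p assume \<theta>: "\<theta> \<in> Delta m n" and p: "p \<in> cells (hc_nerve C) n"
  obtain a F where [simp]: "p = (a, F)" by (cases p)
  note aF = p[simplified, unfolded mem_hc_nerve]
  have law: "F (i, k) d (\<lambda>l\<in>{..d}. s l \<union> t l) = scomp C (a i) (a j) (a k) d (F (j, k) d t) (F (i, j) d s)"
    if "i \<le> j" "j \<le> k" "k \<le> n" "s \<in> cells (paths i j) d" "t \<in> cells (paths j k) d" for i j k d s t
    using aF that by blast
  let ?F = "\<lambda>(i, j)\<in>tri m. pull (\<subseteq>) (Pow (path_sets i j)) ((`) \<theta>) (F (\<theta> i, \<theta> j))"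
  have Feq: "?F (i, j) d s = F (\<theta> i, \<theta> j) d (\<lambda>l\<in>{..d}. \<theta> ` s l)"
    if "i \<le> j" "j \<le> m" "s \<in> cells (paths i j) d" for i j d s
    using that by (simp add: pull_def tri_def paths_cx)
  have "?F (i, j) \<in> smap (paths i j) (smor C (a (\<theta> i)) (a (\<theta> j)))" if ij: "i \<le> j" "j \<le> m" for i j
  proof -
    have "F (\<theta> i, \<theta> j) \<in> smap (paths (\<theta> i) (\<theta> j)) (smor C (a (\<theta> i)) (a (\<theta> j)))"
      using aF Delta_mono[OF \<theta> ij] Delta_le[OF \<theta> ij(2)] by blast
    then have "pull (\<subseteq>) (Pow (path_sets i j)) ((`) \<theta>) (F (\<theta> i, \<theta> j)) \<in>
        smap (paths i j) (smor C (a (\<theta> i)) (a (\<theta> j)))"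
      unfolding paths_cx
      by (rule pull_smap[OF _ down_closed_Pow]) (use path_sets_image[OF \<theta> ij(2)] in auto)
    then show ?thesis using ij by (simp add: tri_def)
  qed
  moreover have "?F (i, i) d (\<lambda>_\<in>{..d}. {i}) = sidn C (a (\<theta> i)) d" if "i \<le> m" for i d
  proof -
    have "(\<lambda>_\<in>{..d}. {i}) \<in> cells (paths i i) d" by (auto simp: paths_cx mem_cx path_sets_def)
    then have "?F (i, i) d (\<lambda>_\<in>{..d}. {i}) = F (\<theta> i, \<theta> i) d (\<lambda>l\<in>{..d}. \<theta> ` (\<lambda>_\<in>{..d}. {i}) l)"
      using Feq that by blast
    also have "(\<lambda>l\<in>{..d}. \<theta> ` (\<lambda>_\<in>{..d}. {i}) l) = (\<lambda>_\<in>{..d}. {\<theta> i})" by (rule restrict_ext) simp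
    also have "F (\<theta> i, \<theta> i) d (\<lambda>_\<in>{..d}. {\<theta> i}) = sidn C (a (\<theta> i)) d"
      using aF Delta_le[OF \<theta> that] by blast
    finally show ?thesis .
  qed
  moreover have "?F (i, k) d (\<lambda>l\<in>{..d}. s l \<union> t l) =
      scomp C (a (\<theta> i)) (a (\<theta> j)) (a (\<theta> k)) d (?F (j, k) d t) (?F (i, j) d s)"
    if ijk: "i \<le> j" "j \<le> k" "k \<le> m" and s: "s \<in> cells (paths i j) d" and t: "t \<in> cells (paths j k) d"
    for i j k d s t
  proof -
    have "i \<le> k" "j \<le> m" using ijk by auto
    have "(\<lambda>l\<in>{..d}. \<theta> ` (\<lambda>l\<in>{..d}. s l \<union> t l) l) =
        (\<lambda>l\<in>{..d}. (\<lambda>l\<in>{..d}. \<theta> ` s l) l \<union> (\<lambda>l\<in>{..d}. \<theta> ` t l) l)"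
      by (rule restrict_ext) (simp add: image_Un)
    moreover have "F (\<theta> i, \<theta> k) d (\<lambda>l\<in>{..d}. (\<lambda>l\<in>{..d}. \<theta> ` s l) l \<union> (\<lambda>l\<in>{..d}. \<theta> ` t l) l) =
        scomp C (a (\<theta> i)) (a (\<theta> j)) (a (\<theta> k)) d (F (\<theta> j, \<theta> k) d (\<lambda>l\<in>{..d}. \<theta> ` t l))
          (F (\<theta> i, \<theta> j) d (\<lambda>l\<in>{..d}. \<theta> ` s l))"
      by (rule law[OF Delta_mono[OF \<theta> ijk(1) \<open>j \<le> m\<close>] Delta_mono[OF \<theta> ijk(2,3)] Delta_le[OF \<theta> ijk(3)]
            paths_image[OF \<theta> \<open>j \<le> m\<close> s] paths_image[OF \<theta> ijk(3) t]])
    ultimately show ?thesis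
      using Feq[OF \<open>i \<le> k\<close> ijk(3) paths_union[OF s t]] Feq[OF ijk(1) \<open>j \<le> m\<close> s] Feq[OF ijk(2,3) t]
      by argo
  qed
  moreover have "a (\<theta> i) \<in> sobj C" if "i \<le> m" for i using aF Delta_le[OF \<theta> that] by blast
  ultimately show "act (hc_nerve C) m n \<theta> p \<in> cells (hc_nerve C) m"
    by (simp add: act_hc_nerve mem_hc_nerve)
next
  fix n p assume p: "p \<in> cells (hc_nerve C) n"
  obtain a F where [simp]: "p = (a, F)" by (cases p)
  note aF = p[simplified, unfolded mem_hc_nerve]
  have "(\<lambda>i\<in>{..n}. a (Delta_id n i)) = a" using aF by (auto simp: Delta_id_def extensional_def)
  moreover have "(\<lambda>(i, j)\<in>tri n. pull (\<subseteq>) (Pow (path_sets i j)) ((`) (Delta_id n)) (F (Delta_id n i, Delta_id n j))) = F"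
  proof (rule ext)
    fix ij obtain i j :: nat where [simp]: "ij = (i, j)" by (cases ij)
    show "(\<lambda>(i, j)\<in>tri n. pull (\<subseteq>) (Pow (path_sets i j)) ((`) (Delta_id n)) (F (Delta_id n i, Delta_id n j))) ij = F ij"
    proof (cases "(i, j) \<in> tri n")
      case True
      then have F: "F (i, j) \<in> smap (paths i j) (smor C (a i) (a j))" using aF by (auto simp: tri_def)
      have "pull (\<subseteq>) (Pow (path_sets i j)) ((`) (Delta_id n)) (F (i, j)) d s = F (i, j) d s" for d s
      proof (cases "s \<in> cells (paths i j) d")
        case s: True
        have "Delta_id n ` s l = s l" if "l \<le> d" for l
        proof -
          have "s l \<in> path_sets i j" using s that by (auto simp: paths_cx mem_cx)
          then have "s l \<subseteq> {..n}" using True by (auto simp: path_sets_def tri_def)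
          then have "Delta_id n ` s l = (\<lambda>x. x) ` s l"
            by (intro image_cong) (auto simp: Delta_id_def)
          then show ?thesis by simp
        qed
        then have "(\<lambda>l\<in>{..d}. Delta_id n ` s l) = s"
          by (intro restrict_eqI[OF paths_extensional[OF s]]) simp
        then show ?thesis using s by (simp add: pull_def paths_cx)
      qed (use smap_undefined[OF F] in \<open>simp add: pull_def paths_cx\<close>)
      then show ?thesis using True by (auto simp: Delta_id_def tri_def intro!: ext)
    next
      case False
      then show ?thesis using aF by (simp add: extensional_def)
    qed
  qed
  ultimately show "act (hc_nerve C) n n (Delta_id n) p = p" by (simp add: act_hc_nerve)
next
  fix l m n \<phi> \<theta> p assume \<phi>: "\<phi> \<in> Delta l m" and \<theta>: "\<theta> \<in> Delta m n" and "p \<in> cells (hc_nerve C) n"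
  obtain a F where [simp]: "p = (a, F)" by (cases p)
  have "pull (\<subseteq>) (Pow (path_sets i j)) ((`) (\<lambda>i\<in>{..l}. \<theta> (\<phi> i))) (F (\<theta> (\<phi> i), \<theta> (\<phi> j))) =
    pull (\<subseteq>) (Pow (path_sets i j)) ((`) \<phi>)
      (pull (\<subseteq>) (Pow (path_sets (\<phi> i) (\<phi> j))) ((`) \<theta>) (F (\<theta> (\<phi> i), \<theta> (\<phi> j))))"
    if ij: "i \<le> j" "j \<le> l" for i j
  proof (intro ext)
    fix d s
    show "pull (\<subseteq>) (Pow (path_sets i j)) ((`) (\<lambda>i\<in>{..l}. \<theta> (\<phi> i))) (F (\<theta> (\<phi> i), \<theta> (\<phi> j))) d s =
      pull (\<subseteq>) (Pow (path_sets i j)) ((`) \<phi>)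
        (pull (\<subseteq>) (Pow (path_sets (\<phi> i) (\<phi> j))) ((`) \<theta>) (F (\<theta> (\<phi> i), \<theta> (\<phi> j)))) d s"
    proof (cases "s \<in> cells (paths i j) d")
      case s: True
      have "(\<lambda>i\<in>{..l}. \<theta> (\<phi> i)) ` s x = \<theta> ` \<phi> ` s x" if "x \<le> d" for x
      proof -
        have "s x \<in> path_sets i j" using s that by (auto simp: paths_cx mem_cx)
        then have "s x \<subseteq> {..l}" using ij by (auto simp: path_sets_def)
        then have "(\<lambda>i\<in>{..l}. \<theta> (\<phi> i)) ` s x = (\<lambda>i. \<theta> (\<phi> i)) ` s x"
          by (intro image_cong) auto
        then show ?thesis by (simp add: image_image)
      qed
      then have "(\<lambda>x\<in>{..d}. (\<lambda>i\<in>{..l}. \<theta> (\<phi> i)) ` s x) = (\<lambda>x\<in>{..d}. \<theta> ` (\<lambda>x\<in>{..d}. \<phi> ` s x) x)"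
        by (intro restrict_ext) simp
      then show ?thesis using s paths_image[OF \<phi> ij(2) s] by (simp add: pull_def paths_cx)
    qed (simp add: pull_def paths_cx)
  qed
  moreover have "(\<phi> i, \<phi> j) \<in> tri m" if "(i, j) \<in> tri l" for i j
    using that Delta_mono[OF \<phi>] Delta_le[OF \<phi>] by (auto simp: tri_def)
  ultimately show "act (hc_nerve C) l n (\<lambda>i\<in>{..l}. \<theta> (\<phi> i)) p =
      act (hc_nerve C) l m \<phi> (act (hc_nerve C) m n \<theta> p)"
    using Delta_le[OF \<phi>]
    by (auto simp: act_hc_nerve tri_def intro!: restrict_ext)
qed

subsection \<open>Composition in the simplicial category of Kan complexes\<close>

abbreviation kcomp :: "'a sset \<Rightarrow> 'a sset \<Rightarrow> 'a sset \<Rightarrow> nat \<Rightarrow> 'a kan_mor \<Rightarrow> 'a kan_mor \<Rightarrow> 'a kan_mor" where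
  "kcomp \<equiv> scomp kan_cat"

lemma kcomp_apply: "kcomp X Y Z n g f k (\<alpha>, x) =
    (if \<alpha> \<in> Delta k n \<and> x \<in> cells X k then g k (\<alpha>, f k (\<alpha>, x)) else undefined)"
  by (simp add: kan_cat_def cells_simplex)

lemma mem_shom_apply:
  "f \<in> cells (shom X Y) n \<Longrightarrow> \<alpha> \<in> Delta k n \<Longrightarrow> x \<in> cells X k \<Longrightarrow> f k (\<alpha>, x) \<in> cells Y k"
  unfolding cells_shom by (erule smap_cell) (simp add: mem_sprod cells_simplex)

lemma shom_undefined:
  "f \<in> cells (shom X Y) n \<Longrightarrow> \<not> (\<alpha> \<in> Delta k n \<and> x \<in> cells X k) \<Longrightarrow> f k (\<alpha>, x) = undefined"
  unfolding cells_shom by (erule smap_undefined) (simp add: mem_sprod cells_simplex)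

lemma shom_natural:
  assumes "f \<in> cells (shom X Y) n" "\<phi> \<in> Delta j k" "\<alpha> \<in> Delta k n" "x \<in> cells X k"
  shows "f j (\<lambda>i\<in>{..j}. \<alpha> (\<phi> i), act X j k \<phi> x) = act Y j k \<phi> (f k (\<alpha>, x))"
  using smap_act[OF assms(1)[unfolded cells_shom] assms(2), of "(\<alpha>, x)"] assms(3,4)
  by (simp add: mem_sprod cells_simplex act_sprod act_simplex)

lemma kcomp_mem:
  assumes X: "is_sset X" and g: "g \<in> cells (shom Y Z) n" and f: "f \<in> cells (shom X Y) n"
  shows "kcomp X Y Z n g f \<in> cells (shom X Z) n"
  unfolding cells_shom
proof (rule smapI)
  fix k p assume "p \<in> cells (sprod (simplex n) X) k"
  then show "kcomp X Y Z n g f k p \<in> cells Z k"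
    using mem_shom_apply[OF g] mem_shom_apply[OF f]
    by (cases p) (auto simp: mem_sprod cells_simplex kcomp_apply)
next
  fix k p assume "p \<notin> cells (sprod (simplex n) X) k"
  then show "kcomp X Y Z n g f k p = undefined"
    by (cases p) (auto simp: mem_sprod cells_simplex kcomp_apply)
next
  fix j k \<phi> p assume \<phi>: "\<phi> \<in> Delta j k" and "p \<in> cells (sprod (simplex n) X) k"
  then obtain \<alpha> x where p: "p = (\<alpha>, x)" "\<alpha> \<in> Delta k n" "x \<in> cells X k"
    by (cases p) (auto simp: mem_sprod cells_simplex)
  show "kcomp X Y Z n g f j (act (sprod (simplex n) X) j k \<phi> p) = act Z j k \<phi> (kcomp X Y Z n g f k p)"
    using p Delta_comp[OF \<phi> p(2)] sset_act_cell[OF X \<phi> p(3)] shom_natural[OF f \<phi> p(2,3)]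
      shom_natural[OF g \<phi> p(2) mem_shom_apply[OF f p(2,3)]]
    by (simp add: act_sprod act_simplex kcomp_apply)
qed

lemma kcomp_act:
  assumes g: "g \<in> cells (shom Y Z) n" and f: "f \<in> cells (shom X Y) n" and \<theta>: "\<theta> \<in> Delta m n"
  shows "act (shom X Z) m n \<theta> (kcomp X Y Z n g f) =
    kcomp X Y Z m (act (shom Y Z) m n \<theta> g) (act (shom X Y) m n \<theta> f)"
proof (intro ext)
  fix k p obtain \<alpha> x where p: "p = (\<alpha> :: nat \<Rightarrow> nat, x :: 'a)" by (cases p)
  show "act (shom X Z) m n \<theta> (kcomp X Y Z n g f) k p =
    kcomp X Y Z m (act (shom Y Z) m n \<theta> g) (act (shom X Y) m n \<theta> f) k p"
  proof (cases "\<alpha> \<in> Delta k m \<and> x \<in> cells X k")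
    case True
    then have "(\<lambda>i\<in>{..k}. \<theta> (\<alpha> i)) \<in> Delta k n" using Delta_comp \<theta> by blast
    then show ?thesis using True p mem_shom_apply[OF f, of _ k x]
      by (simp add: act_shom kcomp_apply)
  next
    case False
    then show ?thesis using p by (auto simp: act_shom_undefined kcomp_apply)
  qed
qed

lemma kcomp_assoc:
  assumes "f \<in> cells (shom X Y) n"
  shows "kcomp X Y W n (kcomp Y Z W n h g) f = kcomp X Z W n h (kcomp X Y Z n g f)"
proof (intro ext)
  fix k p obtain \<alpha> x where p: "p = (\<alpha> :: nat \<Rightarrow> nat, x :: 'a)" by (cases p)
  show "kcomp X Y W n (kcomp Y Z W n h g) f k p = kcomp X Z W n h (kcomp X Y Z n g f) k p"
    using mem_shom_apply[OF assms] by (auto simp: p kcomp_apply)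
qed

lemma sidn_kan: "sidn kan_cat X n k (\<alpha>, x) = (if \<alpha> \<in> Delta k n \<and> x \<in> cells X k then x else undefined)"
  by (simp add: kan_cat_def cells_simplex)

lemma kcomp_idl: 
  assumes "f \<in> cells (shom X Y) n" shows "kcomp X Y Y n (sidn kan_cat Y n) f = f"
proof (intro ext)
  fix k p obtain \<alpha> x where p: "p = (\<alpha> :: nat \<Rightarrow> nat, x :: 'a)" by (cases p)
  show "kcomp X Y Y n (sidn kan_cat Y n) f k p = f k p"
    using mem_shom_apply[OF assms] shom_undefined[OF assms] by (auto simp: p kcomp_apply sidn_kan)
qed

lemma kcomp_idr: 
  assumes "f \<in> cells (shom X Y) n" shows "kcomp X X Y n f (sidn kan_cat X n) = f"
proof (intro ext)
  fix k p obtain \<alpha> x where p: "p = (\<alpha> :: nat \<Rightarrow> nat, x :: 'a)" by (cases p)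
  show "kcomp X X Y n f (sidn kan_cat X n) k p = f k p"
    using shom_undefined[OF assms] by (auto simp: p kcomp_apply sidn_kan)
qed

subsection \<open>Retractions of a simplex onto its faces\<close>

text \<open>
The retraction of \<open>[n]\<close> onto the nonempty subset \<open>T\<close> that rounds down, and rounds up below the least
element of \<open>T\<close>. As an endomorphism of \<open>[n]\<close>, it represents the face spanned by \<open>T\<close> by a simplex of
dimension \<open>n\<close>, in which the vertices keep their names.
\<close>

definition ret :: "nat \<Rightarrow> nat set \<Rightarrow> nat \<Rightarrow> nat" where
  "ret n T = (\<lambda>l\<in>{..n}. if \<exists>t\<in>T. t \<le> l then Max {t \<in> T. t \<le> l} else Min T)"

lemma ret:
  assumes T: "T \<subseteq> {..n}" "T \<noteq> {}"
  shows ret_mem: "l \<le> n \<Longrightarrow> ret n T l \<in> T" and ret_id: "l \<in> T \<Longrightarrow> ret n T l = l"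
    and ret_Delta: "ret n T \<in> Delta n n"
proof -
  have fin: "finite T" "\<And>l. finite {t \<in> T. t \<le> l}" using T(1) finite_subset by auto
  show mem: "ret n T l \<in> T" if "l \<le> n" for l
  proof (cases "\<exists>t\<in>T. t \<le> l")
    case True
    then have "Max {t \<in> T. t \<le> l} \<in> {t \<in> T. t \<le> l}" by (intro Max_in fin) auto
    then show ?thesis using that True by (auto simp: ret_def)
  next
    case False
    then show ?thesis using that Min_in[OF fin(1) T(2)] by (auto simp: ret_def)
  qed
  show "ret n T l = l" if "l \<in> T" for l
  proof -
    have "Max {t \<in> T. t \<le> l} = l" using that by (intro Max_eqI fin) auto
    moreover have "l \<le> n" using that T by auto
    ultimately show ?thesis using that by (auto simp: ret_def)
  qed
  have "ret n T i \<le> ret n T j" if "i \<le> j" "j \<le> n" for i j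
  proof (cases "\<exists>t\<in>T. t \<le> i")
    case True
    then have "\<exists>t\<in>T. t \<le> j" using that by (meson order_trans)
    moreover have "Max {t \<in> T. t \<le> i} \<le> Max {t \<in> T. t \<le> j}"
      using True that by (intro Max_mono fin) auto
    ultimately show ?thesis using True that by (simp add: ret_def)
  next
    case False
    then show ?thesis using that mem[of j] Min_le[OF fin(1)] by (simp add: ret_def)
  qed
  then show "ret n T \<in> Delta n n" using mem T(1) by (auto simp: mem_Delta) (auto simp: ret_def)
qed

lemma ret_comp:
  assumes "T \<subseteq> {..n}" "T' \<noteq> {}" "T' \<subseteq> T"
  shows "(\<lambda>i\<in>{..n}. ret n T (ret n T' i)) = ret n T'"
proof (rule ext)
  fix i show "(\<lambda>i\<in>{..n}. ret n T (ret n T' i)) i = ret n T' i"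
  proof (cases "i \<le> n")
    case True
    then have "ret n T' i \<in> T'" using assms by (intro ret_mem) auto
    then show ?thesis using True assms ret_id[of T n "ret n T' i"] by auto
  qed (simp add: ret_def)
qed

lemma ret_absorb:
  assumes "\<theta> \<in> Delta m n" "\<theta> ` {..m} \<subseteq> T" "T \<subseteq> {..n}"
  shows "(\<lambda>i\<in>{..m}. ret n T (\<theta> i)) = \<theta>"
proof (rule ext)
  fix i show "(\<lambda>i\<in>{..m}. ret n T (\<theta> i)) i = \<theta> i"
  proof (cases "i \<le> m")
    case True
    then have "\<theta> i \<in> T" using assms by auto
    then show ?thesis using True assms ret_id[of T n "\<theta> i"] by auto
  qed (use assms in \<open>simp add: mem_Delta extensional_def\<close>)
qed

section \<open>Inner horns of spaces\<close>

lemma path_set_subset: "i \<le> j \<Longrightarrow> s \<in> cells (paths i j) d \<Longrightarrow> l \<le> d \<Longrightarrow> s l \<in> path_sets i j"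
  by (auto simp: paths_cx mem_cx)

lemma paths_mono: "s \<in> cells (paths i j) d \<Longrightarrow> l \<le> l' \<Longrightarrow> l' \<le> d \<Longrightarrow> s l \<subseteq> s l'"
  by (simp add: paths_cx mem_cx)

lemma paths_restrict:
  assumes s: "s \<in> cells (paths i k) d" and j: "i \<le> j" "j \<le> k" "j \<in> s 0"
  shows "(\<lambda>l\<in>{..d}. s l \<inter> {..j}) \<in> cells (paths i j) d"
    and "(\<lambda>l\<in>{..d}. s l \<inter> {j..}) \<in> cells (paths j k) d"
proof -
  have "s l \<in> path_sets i k" "j \<in> s l" if "l \<le> d" for l
    using path_set_subset[OF _ s that] paths_mono[OF s _ that, of 0] j by auto
  then have "s l \<inter> {..j} \<in> path_sets i j" "s l \<inter> {j..} \<in> path_sets j k" if "l \<le> d" for l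
    using that j by (fastforce simp: path_sets_def)+
  moreover have "s l \<inter> {..j} \<subseteq> s l' \<inter> {..j}" "s l \<inter> {j..} \<subseteq> s l' \<inter> {j..}" if "l \<le> l'" "l' \<le> d" for l l'
    using paths_mono[OF s that] by auto
  ultimately show "(\<lambda>l\<in>{..d}. s l \<inter> {..j}) \<in> cells (paths i j) d"
    "(\<lambda>l\<in>{..d}. s l \<inter> {j..}) \<in> cells (paths j k) d"
    by (auto simp: paths_cx mem_cx)
qed

text \<open>
A map from an inner horn to the homotopy coherent nerve is a compatible family of simplicial
functors, one for each face.
\<close>

locale inner_horn =
  fixes n k :: nat and h :: "nat \<Rightarrow> (nat \<Rightarrow> nat) \<Rightarrow> 'a spaces_cell"
  assumes k: "0 < k" "k < n" and h: "h \<in> smap (horn n k) (hc_nerve kan_cat)"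
begin

text \<open>
The vertex sets of the faces of the horn.
\<close>

definition good :: "nat set \<Rightarrow> bool" where
  "good T \<longleftrightarrow> T \<subseteq> {..n} \<and> T \<noteq> {} \<and> \<not> {..n} - {k} \<subseteq> T"

text \<open>
The objects and the maps of mapping spaces of the face spanned by \<open>T\<close>. Because \<open>ret n T\<close> fixes the
elements of \<open>T\<close>, they are indexed by the vertices of \<open>\<Delta>\<^sup>n\<close>; only the indices in \<open>T\<close> carry
information.
\<close>

definition obs :: "nat set \<Rightarrow> nat \<Rightarrow> 'a sset" where "obs T = fst (h n (ret n T))"
definition maps :: "nat set \<Rightarrow> nat \<times> nat \<Rightarrow> nat \<Rightarrow> (nat \<Rightarrow> nat set) \<Rightarrow> 'a kan_mor" where
  "maps T = snd (h n (ret n T))"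

lemma good_subset: "good T \<Longrightarrow> T' \<subseteq> T \<Longrightarrow> T' \<noteq> {} \<Longrightarrow> good T'"
  by (auto simp: good_def)

lemma good_interval: "i \<le> j \<Longrightarrow> j \<le> n \<Longrightarrow> (i, j) \<noteq> (0, n) \<Longrightarrow> good {i..j}"
proof -
  assume ij: "i \<le> j" "j \<le> n" "(i, j) \<noteq> (0, n)"
  then have "0 \<in> {..n} - {k} - {i..j} \<or> n \<in> {..n} - {k} - {i..j}" using k by auto
  then show "good {i..j}" using ij unfolding good_def by auto
qed

lemma ret_horn: "good T \<Longrightarrow> ret n T \<in> cells (horn n k) n"
  unfolding good_def using ret_Delta[of T n] ret_mem[of T n]
  by (force simp: horn_def)

lemma face_cell: "good T \<Longrightarrow> (obs T, maps T) \<in> cells (hc_nerve kan_cat) n"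
  using smap_cell[OF h ret_horn] by (simp add: obs_def maps_def)

lemma face_face:
  assumes "good T" "T' \<subseteq> T" "T' \<noteq> {}"
  shows "act (hc_nerve kan_cat) n n (ret n T') (obs T, maps T) = (obs T', maps T')"
proof -
  have g: "T \<subseteq> {..n}" "T' \<subseteq> {..n}" using assms by (auto simp: good_def)
  have "act (horn n k) n n (ret n T') (ret n T) = (\<lambda>i\<in>{..n}. ret n T (ret n T' i))"
    by (simp add: horn_cx act_cx)
  then have "h n (ret n T') = act (hc_nerve kan_cat) n n (ret n T') (h n (ret n T))"
    using smap_act[OF h ret_Delta[OF g(2) assms(3)] ret_horn[OF assms(1)]]
      ret_comp[OF g(1) assms(3,2)] by simp
  then show ?thesis by (simp add: obs_def maps_def)
qed

lemma obs_face:
  assumes "good T" "T' \<subseteq> T" "i \<in> T'" shows "obs T' i = obs T i"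
proof -
  have g: "T' \<subseteq> {..n}" "T' \<noteq> {}" using assms by (auto simp: good_def)
  have "obs T' i = obs T (ret n T' i)"
    using arg_cong[OF face_face[OF assms(1,2) g(2)], of "\<lambda>p. fst p i"] assms(3) g
    by (auto simp: act_hc_nerve)
  then show ?thesis using ret_id[OF g assms(3)] by simp
qed

text \<open>
Two faces agree on their common part, because restricting the larger one along the retraction onto
the smaller one does not move the vertices in question.
\<close>

lemma maps_face:
  assumes T: "good T" "T' \<subseteq> T" and ij: "i \<le> j" "i \<in> T'" "j \<in> T'"
    and s: "s \<in> cells (paths i j) d" "s d \<subseteq> T'"
  shows "maps T' (i, j) d s = maps T (i, j) d s"
proof -
  have g: "T' \<subseteq> {..n}" "T' \<noteq> {}" using assms by (auto simp: good_def)
  have "(i, j) \<in> tri n" using ij g by (auto simp: tri_def)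
  then have "maps T' (i, j) = pull (\<subseteq>) (Pow (path_sets i j)) ((`) (ret n T')) (maps T (ret n T' i, ret n T' j))"
    using arg_cong[OF face_face[OF T g(2)], of "\<lambda>p. snd p (i, j)"] by (simp add: act_hc_nerve)
  then have "maps T' (i, j) d s = maps T (i, j) d (\<lambda>l\<in>{..d}. ret n T' ` s l)"
    using s ret_id[OF g ij(2)] ret_id[OF g ij(3)] by (simp add: pull_def paths_cx)
  also have "(\<lambda>l\<in>{..d}. ret n T' ` s l) = s"
  proof (rule ext)
    fix l show "(\<lambda>l\<in>{..d}. ret n T' ` s l) l = s l"
    proof (cases "l \<le> d")
      case True
      then have "s l \<subseteq> T'" using paths_mono[OF s(1) True] s(2) by auto
      then have "ret n T' ` s l = s l" using ret_id[OF g] by (force simp: image_iff)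
      then show ?thesis using True by simp
    next
      case False
      then show ?thesis using s by (simp add: paths_cx mem_cx extensional_def)
    qed
  qed
  finally show ?thesis .
qed

definition ob :: "nat \<Rightarrow> 'a sset" where "ob = (\<lambda>i\<in>{..n}. obs {i} i)"
text \<open>
Off \<open>(0, n)\<close>, the interval \<open>{i..j}\<close> spans a face of the horn, which determines the map.
\<close>

definition mp :: "nat \<times> nat \<Rightarrow> nat \<Rightarrow> (nat \<Rightarrow> nat set) \<Rightarrow> 'a kan_mor" where
  "mp = (\<lambda>(i, j). maps {i..j} (i, j))"

lemma obs_ob: "good T \<Longrightarrow> i \<in> T \<Longrightarrow> obs T i = ob i"
  using obs_face[of T "{i}" i] by (auto simp: ob_def good_def)

lemma maps_mp:
  assumes "good T" "i \<le> j" "i \<in> T" "j \<in> T" "s \<in> cells (paths i j) d" "s d \<subseteq> T" "(i, j) \<noteq> (0, n)"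
  shows "maps T (i, j) d s = mp (i, j) d s"
proof -
  have "j \<le> n" using assms by (auto simp: good_def)
  have sd: "i \<in> s d" "j \<in> s d" "s d \<subseteq> {i..j}"
    using path_set_subset[OF assms(2,5), of d] by (auto simp: path_sets_def)
  show ?thesis
    using maps_face[OF assms(1,6,2) sd(1,2) assms(5)]
      maps_face[OF good_interval[OF assms(2) \<open>j \<le> n\<close> assms(7)] sd(3) assms(2) sd(1,2) assms(5)]
    by (simp add: mp_def)
qed

lemma ob_kan: "i \<le> n \<Longrightarrow> is_kan (ob i)"
proof -
  assume i: "i \<le> n"
  have "good {i..i}" using k i by (intro good_interval) auto
  then have "good {i}" by simp
  from face_cell[OF this] show ?thesis using i by (simp add: mem_hc_nerve ob_def kan_cat_def)
qed

lemma ob_sset: "i \<le> n \<Longrightarrow> is_sset (ob i)"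
  using ob_kan by (simp add: is_kan_def)

lemma maps_smap:
  assumes "good T" "i \<le> j" "i \<in> T" "j \<in> T"
  shows "maps T (i, j) \<in> smap (paths i j) (shom (ob i) (ob j))"
proof -
  have "j \<le> n" using assms by (auto simp: good_def)
  then have "maps T (i, j) \<in> smap (paths i j) (smor kan_cat (obs T i) (obs T j))"
    using face_cell[OF assms(1)] assms(2) unfolding mem_hc_nerve by blast
  then show ?thesis using obs_ob[OF assms(1,3)] obs_ob[OF assms(1,4)] by (simp add: kan_cat_def)
qed

lemma maps_comp:
  assumes T: "good T" and ijk: "i \<le> j" "j \<le> l" "i \<in> T" "j \<in> T" "l \<in> T"
    and s: "s \<in> cells (paths i j) d" and t: "t \<in> cells (paths j l) d"
  shows "maps T (i, l) d (\<lambda>x\<in>{..d}. s x \<union> t x) =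
    kcomp (ob i) (ob j) (ob l) d (maps T (j, l) d t) (maps T (i, j) d s)"
proof -
  have "l \<le> n" using assms by (auto simp: good_def)
  then show ?thesis using face_cell[OF T] obs_ob[OF T] ijk s t by (simp add: mem_hc_nerve)
qed

lemma mp_smap:
  assumes "i \<le> j" "j \<le> n" "(i, j) \<noteq> (0, n)"
  shows "mp (i, j) \<in> smap (paths i j) (shom (ob i) (ob j))"
  using maps_smap[OF good_interval[OF assms]] assms by (simp add: mp_def)

lemma mp_comp:
  assumes ijk: "i \<le> j" "j \<le> l" "l \<le> n" "(i, l) \<noteq> (0, n)"
    and s: "s \<in> cells (paths i j) d" and t: "t \<in> cells (paths j l) d"
  shows "mp (i, l) d (\<lambda>x\<in>{..d}. s x \<union> t x) =
    kcomp (ob i) (ob j) (ob l) d (mp (j, l) d t) (mp (i, j) d s)"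
proof -
  have g: "good {i..l}" using good_interval ijk by auto
  have "s d \<subseteq> {i..l}" "t d \<subseteq> {i..l}"
    using path_set_subset[OF ijk(1) s, of d] path_set_subset[OF ijk(2) t, of d] ijk
    unfolding path_sets_def by fastforce+
  then have "maps {i..l} (j, l) d t = mp (j, l) d t" "maps {i..l} (i, j) d s = mp (i, j) d s"
    using maps_mp[OF g ijk(2) _ _ t] maps_mp[OF g ijk(1) _ _ s] ijk by auto
  then show ?thesis using maps_comp[OF g ijk(1,2) _ _ _ s t] ijk by (simp add: mp_def)
qed

text \<open>
The value at a chain of sets that contain \<open>j\<close>, as forced by the composition law at \<open>j\<close>.
\<close>

definition via :: "nat \<Rightarrow> nat \<Rightarrow> (nat \<Rightarrow> nat set) \<Rightarrow> 'a kan_mor" where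
  "via j d s = kcomp (ob 0) (ob j) (ob n) d
     (mp (j, n) d (\<lambda>x\<in>{..d}. s x \<inter> {j..})) (mp (0, j) d (\<lambda>x\<in>{..d}. s x \<inter> {..j}))"

lemma split_union:
  assumes "s \<in> cells (paths i l) d"
  shows "(\<lambda>x\<in>{..d}. (\<lambda>x\<in>{..d}. s x \<inter> {..j}) x \<union> (\<lambda>x\<in>{..d}. s x \<inter> {j..}) x) = s"
proof (rule ext)
  fix x show "(\<lambda>x\<in>{..d}. (\<lambda>x\<in>{..d}. s x \<inter> {..j}) x \<union> (\<lambda>x\<in>{..d}. s x \<inter> {j..}) x) x = s x"
    using assms by (cases "x \<le> d") (auto simp: paths_cx mem_cx extensional_def)
qed

lemma via_maps:
  assumes s: "s \<in> cells (paths 0 n) d" and T: "good (s d)" and j: "0 < j" "j < n" "j \<in> s 0"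
  shows "maps (s d) (0, n) d s = via j d s"
proof -
  let ?s = "\<lambda>x\<in>{..d}. s x \<inter> {..j}" and ?t = "\<lambda>x\<in>{..d}. s x \<inter> {j..}"
  have st: "?s \<in> cells (paths 0 j) d" "?t \<in> cells (paths j n) d"
    using paths_restrict[OF s _ _ j(3)] j by auto
  have m: "0 \<in> s d" "n \<in> s d" using path_set_subset[OF _ s, of d] by (auto simp: path_sets_def)
  have jd: "j \<in> s d" using paths_mono[OF s, of 0 d] j by auto
  have e: "maps (s d) (0, n) d s =
    kcomp (ob 0) (ob j) (ob n) d (maps (s d) (j, n) d ?t) (maps (s d) (0, j) d ?s)"
    using maps_comp[OF T _ _ m(1) jd m(2) st] j split_union[OF s, of j] by simp
  have e1: "maps (s d) (j, n) d ?t = mp (j, n) d ?t"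
    using j by (intro maps_mp[OF T _ jd m(2) st(2)]) auto
  have e2: "maps (s d) (0, j) d ?s = mp (0, j) d ?s"
    using j by (intro maps_mp[OF T _ m(1) jd st(1)]) auto
  show ?thesis unfolding e e1 e2 via_def ..
qed

text \<open>
The composites through two vertices agree, by associativity and the composition laws for \<open>(j, n)\<close>
and \<open>(0, j')\<close>.
\<close>

lemma via_via:
  assumes s: "s \<in> cells (paths 0 n) d" and j: "0 < j" "j < j'" "j' < n" "j \<in> s 0" "j' \<in> s 0"
  shows "via j d s = via j' d s"
proof -
  let ?a = "\<lambda>x\<in>{..d}. s x \<inter> {..j}" and ?b = "\<lambda>x\<in>{..d}. s x \<inter> {j..}"
  let ?a' = "\<lambda>x\<in>{..d}. s x \<inter> {..j'}" and ?b' = "\<lambda>x\<in>{..d}. s x \<inter> {j'..}"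
  let ?c = "\<lambda>x\<in>{..d}. ?a' x \<inter> {j..}"
  have a: "?a \<in> cells (paths 0 j) d" and b: "?b \<in> cells (paths j n) d"
    using paths_restrict[OF s _ _ j(4)] j by auto
  have a': "?a' \<in> cells (paths 0 j') d" and b': "?b' \<in> cells (paths j' n) d"
    using paths_restrict[OF s _ _ j(5)] j by auto
  have c: "?c \<in> cells (paths j j') d" using paths_restrict(2)[OF a'] j by auto
  have eb: "?b = (\<lambda>x\<in>{..d}. ?c x \<union> ?b' x)" using j by (intro restrict_ext) auto
  have ea: "?a' = (\<lambda>x\<in>{..d}. ?a x \<union> ?c x)" using j by (intro restrict_ext) auto
  have "mp (0, j) d ?a \<in> cells (shom (ob 0) (ob j)) d"
    using smap_cell[OF mp_smap a] j by simp
  note assoc = kcomp_assoc[OF this]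
  have "mp (j, n) d ?b = kcomp (ob j) (ob j') (ob n) d (mp (j', n) d ?b') (mp (j, j') d ?c)"
    unfolding eb using j by (intro mp_comp[OF _ _ _ _ c b']) auto
  moreover have "mp (0, j') d ?a' = kcomp (ob 0) (ob j) (ob j') d (mp (j, j') d ?c) (mp (0, j) d ?a)"
    by (subst ea) (use j in \<open>intro mp_comp[OF _ _ _ _ a c]; auto\<close>)
  ultimately show ?thesis using assoc by (simp add: via_def)
qed

lemma via_mem:
  assumes s: "s \<in> cells (paths 0 n) d" and j: "0 < j" "j < n" "j \<in> s 0"
  shows "via j d s \<in> cells (shom (ob 0) (ob n)) d"
  unfolding via_def using paths_restrict[OF s _ _ j(3)] j ob_sset
  by (intro kcomp_mem smap_cell[OF mp_smap]) auto

lemma via_act: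
  assumes s: "s \<in> cells (paths 0 n) d" and j: "0 < j" "j < n" "j \<in> s 0" and \<theta>: "\<theta> \<in> Delta e d"
  shows "via j e (\<lambda>l\<in>{..e}. s (\<theta> l)) = act (shom (ob 0) (ob n)) e d \<theta> (via j d s)"
proof -
  let ?s = "\<lambda>x\<in>{..d}. s x \<inter> {..j}" and ?t = "\<lambda>x\<in>{..d}. s x \<inter> {j..}"
  let ?u = "\<lambda>l\<in>{..e}. s (\<theta> l)"
  have st: "?s \<in> cells (paths 0 j) d" "?t \<in> cells (paths j n) d"
    using paths_restrict[OF s _ _ j(3)] j by auto
  have S: "mp (0, j) \<in> smap (paths 0 j) (shom (ob 0) (ob j))"
    and T: "mp (j, n) \<in> smap (paths j n) (shom (ob j) (ob n))"
    using j by (auto intro!: mp_smap)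
  have "(\<lambda>x\<in>{..e}. ?u x \<inter> {..j}) = act (paths 0 j) e d \<theta> ?s"
    "(\<lambda>x\<in>{..e}. ?u x \<inter> {j..}) = act (paths j n) e d \<theta> ?t"
    using Delta_le[OF \<theta>] by (auto simp: paths_cx act_cx intro!: restrict_ext)
  then show ?thesis
    using smap_act[OF S \<theta> st(1)] smap_act[OF T \<theta> st(2)]
      kcomp_act[OF smap_cell[OF T st(2)] smap_cell[OF S st(1)] \<theta>]
    by (simp add: via_def)
qed

text \<open>
The prescribed part of the missing map. On chains outside the faces of the horn an inner vertex has
to be chosen; by \<open>via_via\<close> the choice does not matter.
\<close>

definition on_box :: "nat \<Rightarrow> (nat \<Rightarrow> nat set) \<Rightarrow> 'a kan_mor" where
  "on_box = (\<lambda>d. \<lambda>s\<in>cells (chain_cx (\<subseteq>) (box n k)) d.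
     if good (s d) then maps (s d) (0, n) d s else via (SOME j. 0 < j \<and> j < n \<and> j \<in> s 0) d s)"

lemma box_paths: "s \<in> cells (chain_cx (\<subseteq>) (box n k)) d \<Longrightarrow> s \<in> cells (paths 0 n) d"
  unfolding paths_cx by (erule cx_mono) (auto simp: box_def)

lemma on_box_good: "s \<in> cells (chain_cx (\<subseteq>) (box n k)) d \<Longrightarrow> good (s d) \<Longrightarrow> on_box d s = maps (s d) (0, n) d s"
  by (simp add: on_box_def)

lemma on_box_via:
  assumes s: "s \<in> cells (chain_cx (\<subseteq>) (box n k)) d" and j: "0 < j" "j < n" "j \<in> s 0"
  shows "on_box d s = via j d s"
proof (cases "good (s d)")
  case True
  then show ?thesis using on_box_good[OF s] via_maps[OF box_paths[OF s] True j] by simp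
next
  case False
  define i where "i = (SOME j. 0 < j \<and> j < n \<and> j \<in> s 0)"
  have i: "0 < i" "i < n" "i \<in> s 0" using someI[of "\<lambda>j. 0 < j \<and> j < n \<and> j \<in> s 0" j] j by (auto simp: i_def)
  have "via i d s = via j d s"
    using via_via[OF box_paths[OF s]] i j by (metis linorder_neqE_nat)
  then show ?thesis using False s by (simp add: on_box_def i_def)
qed

lemma box_cases:
  assumes s: "s \<in> cells (chain_cx (\<subseteq>) (box n k)) d"
  obtains "good (s d)" | j where "0 < j" "j < n" "j \<in> s 0"
proof -
  have p: "s d \<subseteq> {..n}" "s d \<noteq> {}" using path_set_subset[OF _ box_paths[OF s], of d] by (auto simp: path_sets_def)
  have "(\<exists>j\<le>n. j \<noteq> k \<and> (\<forall>T\<in>s ` {..d}. j \<notin> T)) \<or> (\<exists>j. 0 < j \<and> j < n \<and> (\<forall>T\<in>s ` {..d}. j \<in> T))"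
    using s by (simp add: mem_cx box_def)
  then have "good (s d) \<or> (\<exists>j. 0 < j \<and> j < n \<and> j \<in> s 0)"
  proof
    assume "\<exists>j\<le>n. j \<noteq> k \<and> (\<forall>T\<in>s ` {..d}. j \<notin> T)"
    then obtain j where "j \<le> n" "j \<noteq> k" "j \<notin> s d" by auto
    then show ?thesis using p unfolding good_def by blast
  next
    assume "\<exists>j. 0 < j \<and> j < n \<and> (\<forall>T\<in>s ` {..d}. j \<in> T)"
    then show ?thesis by auto
  qed
  then show thesis using that by blast
qed

lemma good_box:
  assumes "s \<in> cells (paths 0 n) d" "good (s d)" shows "s \<in> cells (chain_cx (\<subseteq>) (box n k)) d"
proof -
  obtain j where j: "j \<le> n" "j \<noteq> k" "j \<notin> s d" using assms(2) by (auto simp: good_def)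
  then have "\<forall>T\<in>s ` {..d}. j \<notin> T" using paths_mono[OF assms(1)] by blast
  then have "s ` {..d} \<in> box n k" using j assms(1) unfolding box_def by (auto simp: paths_cx mem_cx)
  then show ?thesis using assms(1) by (simp add: paths_cx mem_cx)
qed

lemma via_box:
  assumes "s \<in> cells (paths 0 n) d" "0 < j" "j < n" "j \<in> s 0" shows "s \<in> cells (chain_cx (\<subseteq>) (box n k)) d"
proof -
  have "\<forall>T\<in>s ` {..d}. j \<in> T" using paths_mono[OF assms(1), of 0] assms(4) by blast
  then have "s ` {..d} \<in> box n k" using assms unfolding box_def by (auto simp: paths_cx mem_cx)
  then show ?thesis using assms(1) by (simp add: paths_cx mem_cx)
qed

lemma on_box_smap: "on_box \<in> smap (chain_cx (\<subseteq>) (box n k)) (shom (ob 0) (ob n))"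
proof (rule smapI)
  fix d s assume s: "s \<in> cells (chain_cx (\<subseteq>) (box n k)) d"
  note sp = box_paths[OF s]
  have m: "0 \<in> s d" "n \<in> s d" using path_set_subset[OF _ sp, of d] by (auto simp: path_sets_def)
  show "on_box d s \<in> cells (shom (ob 0) (ob n)) d"
    using s
  proof (cases rule: box_cases)
    case 1
    then show ?thesis using on_box_good[OF s] smap_cell[OF maps_smap[OF 1 _ m] sp] by simp
  next
    case (2 j)
    then show ?thesis using on_box_via[OF s] via_mem[OF sp] by simp
  qed
next
  fix e d \<theta> s assume \<theta>: "\<theta> \<in> Delta e d" and s: "s \<in> cells (chain_cx (\<subseteq>) (box n k)) d"
  let ?u = "\<lambda>l\<in>{..e}. s (\<theta> l)"
  note sp = box_paths[OF s]
  have u: "?u \<in> cells (chain_cx (\<subseteq>) (box n k)) e" by (rule cx_act_mem[OF down_closed_box s \<theta>])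
  note up = box_paths[OF u]
  have m: "0 \<in> s d" "n \<in> s d" using path_set_subset[OF _ sp, of d] by (auto simp: path_sets_def)
  have mu: "0 \<in> ?u e" "n \<in> ?u e" using path_set_subset[OF _ up, of e] by (auto simp: path_sets_def)
  have "on_box e ?u = act (shom (ob 0) (ob n)) e d \<theta> (on_box d s)"
    using s
  proof (cases rule: box_cases)
    case 1
    have sub: "?u e \<subseteq> s d" using paths_mono[OF sp, of "\<theta> e" d] Delta_le[OF \<theta>, of e] by simp
    then have g: "good (?u e)" using good_subset[OF 1] mu by blast
    have "on_box e ?u = maps (?u e) (0, n) e ?u" by (rule on_box_good[OF u g])
    also have "\<dots> = maps (s d) (0, n) e ?u" by (rule maps_face[OF 1 sub _ mu up]) auto
    also have "\<dots> = act (shom (ob 0) (ob n)) e d \<theta> (maps (s d) (0, n) d s)"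
      using smap_act[OF maps_smap[OF 1 _ m] \<theta> sp] by (simp add: paths_cx act_cx)
    finally show ?thesis using on_box_good[OF s 1] by simp
  next
    case (2 j)
    have "j \<in> ?u 0" using paths_mono[OF sp, of 0 "\<theta> 0"] Delta_le[OF \<theta>, of 0] 2 by auto
    then show ?thesis using on_box_via[OF u 2(1,2)] on_box_via[OF s 2] via_act[OF sp 2 \<theta>] by simp
  qed
  then show "on_box e (act (chain_cx (\<subseteq>) (box n k)) e d \<theta> s) = act (shom (ob 0) (ob n)) e d \<theta> (on_box d s)"
    by (simp add: act_cx)
qed (simp add: on_box_def)

text \<open>
The box extends to the cube, which completes the given maps to a simplicial functor. Its composition
law at \<open>(0, n)\<close> holds for inner vertices because the composites lie in the box, and for the two end
vertices by the unit laws.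
\<close>

lemma filler: "\<exists>\<sigma>\<in>smap (simplex n) (hc_nerve kan_cat). \<forall>m. \<forall>\<theta>\<in>cells (horn n k) m. \<sigma> m \<theta> = h m \<theta>"
proof -
  let ?C = "hc_nerve kan_cat :: 'a spaces_cell sset"
  obtain G where G: "G \<in> smap (paths 0 n) (shom (ob 0) (ob n))"
    and Gb: "\<And>d s. s \<in> cells (chain_cx (\<subseteq>) (box n k)) d \<Longrightarrow> G d s = on_box d s"
    using box_extension[OF ob_sset ob_kan k on_box_smap] by auto
  define F where "F = (\<lambda>(i, j)\<in>tri n. if (i, j) = (0, n) then G else mp (i, j))"
  have F0: "F (0, n) = G" and Fmp: "\<And>i j. i \<le> j \<Longrightarrow> j \<le> n \<Longrightarrow> (i, j) \<noteq> (0, n) \<Longrightarrow> F (i, j) = mp (i, j)"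
    by (auto simp: F_def tri_def)
  have Fsmap: "F (i, j) \<in> smap (paths i j) (shom (ob i) (ob j))" if "i \<le> j" "j \<le> n" for i j
    using G F0 Fmp[OF that] mp_smap[OF that] by (cases "(i, j) = (0, n)") auto
  have Fmaps: "maps T (i, j) d s = F (i, j) d s"
    if T: "good T" and ij: "i \<le> j" "i \<in> T" "j \<in> T" and s: "s \<in> cells (paths i j) d" "s d \<subseteq> T" for T i j d s
  proof (cases "(i, j) = (0, n)")
    case False
    moreover have "j \<le> n" using T ij by (auto simp: good_def)
    ultimately show ?thesis using maps_mp[OF T ij s] Fmp ij by simp
  next
    case True
    then have s0: "s \<in> cells (paths 0 n) d" using s by simp
    have sd: "0 \<in> s d" "n \<in> s d" using path_set_subset[OF _ s0, of d] by (auto simp: path_sets_def)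
    then have g: "good (s d)" using good_subset[OF T s(2)] by blast
    have "maps T (0, n) d s = maps (s d) (0, n) d s"
      using maps_face[OF T s(2) _ sd s0] by simp
    then show ?thesis using True F0 Gb[OF good_box[OF s0 g]] on_box_good[OF good_box[OF s0 g] g] by simp
  qed
  have Fid: "F (i, i) d (\<lambda>_\<in>{..d}. {i}) = sidn kan_cat (ob i) d" if i: "i \<le> n" for i d
  proof -
    have ne: "(i, i) \<noteq> (0, n)" using k by auto
    have g: "good {i..i}" by (rule good_interval[OF _ i ne]) simp
    have "maps {i..i} (i, i) d (\<lambda>_\<in>{..d}. {i}) = sidn kan_cat (obs {i..i} i) d"
      using face_cell[OF g] i by (simp add: mem_hc_nerve)
    then show ?thesis using obs_ob[OF g, of i] Fmp[OF _ i ne] by (simp add: mp_def)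
  qed
  have Fcomp: "F (i, l) d (\<lambda>x\<in>{..d}. s x \<union> t x) = kcomp (ob i) (ob j) (ob l) d (F (j, l) d t) (F (i, j) d s)"
    if ijl: "i \<le> j" "j \<le> l" "l \<le> n" and s: "s \<in> cells (paths i j) d" and t: "t \<in> cells (paths j l) d"
    for i j l d s t
  proof (cases "(i, l) = (0, n)")
    case False
    then have "(i, j) \<noteq> (0, n)" "(j, l) \<noteq> (0, n)" using ijl by auto
    then show ?thesis using mp_comp[OF ijl False s t] Fmp ijl False by simp
  next
    case il: True
    have ps: "s x \<in> path_sets i j" "t x \<in> path_sets j l" if "x \<le> d" for x
      using path_set_subset[OF ijl(1) s that] path_set_subset[OF ijl(2) t that] by auto
    consider "j = 0" | "j = n" | "0 < j" "j < n" using ijl by fastforce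
    then show ?thesis
    proof cases
      case 1
      have t': "t \<in> cells (paths 0 n) d" using t il 1 by simp
      from 1 have s0: "s x = {0}" if "x \<le> d" for x using ps[OF that] il by (auto simp: path_sets_def)
      then have es: "s = (\<lambda>_\<in>{..d}. {0})"
        by (intro restrict_eqI[OF paths_extensional[OF s], symmetric]) simp
      have eu: "(\<lambda>x\<in>{..d}. s x \<union> t x) = t"
      proof (rule ext)
        fix x show "(\<lambda>x\<in>{..d}. s x \<union> t x) x = t x"
          using s0 ps[of x] t 1 by (cases "x \<le> d") (auto simp: path_sets_def paths_cx mem_cx extensional_def)
      qed
      show ?thesis
        unfolding eu using es il 1 Fid[of 0 d] kcomp_idr[OF smap_cell[OF Fsmap[of 0 n] t']] ijl t by simp
    next
      case 2
      then have t0: "t x = {n}" if "x \<le> d" for x using ps[OF that] il by (auto simp: path_sets_def)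
      then have et: "t = (\<lambda>_\<in>{..d}. {n})"
        by (intro restrict_eqI[OF paths_extensional[OF t], symmetric]) simp
      have eu: "(\<lambda>x\<in>{..d}. s x \<union> t x) = s"
      proof (rule ext)
        fix x show "(\<lambda>x\<in>{..d}. s x \<union> t x) x = s x"
          using t0 ps[of x] s 2 by (cases "x \<le> d") (auto simp: path_sets_def paths_cx mem_cx extensional_def)
      qed
      show ?thesis
        unfolding eu using et il 2 Fid[of n d] kcomp_idl[OF smap_cell[OF Fsmap s]] ijl by simp
    next
      case 3
      let ?u = "\<lambda>x\<in>{..d}. s x \<union> t x"
      have u: "?u \<in> cells (paths 0 n) d" using paths_union[OF s t] il by simp
      have j0: "j \<in> ?u 0" using ps[of 0] by (auto simp: path_sets_def)
      have ub: "?u \<in> cells (chain_cx (\<subseteq>) (box n k)) d" by (rule via_box[OF u 3 j0])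
      have es: "(\<lambda>x\<in>{..d}. ?u x \<inter> {..j}) = s"
      proof (rule ext)
        fix x show "(\<lambda>x\<in>{..d}. ?u x \<inter> {..j}) x = s x"
        proof (cases "x \<le> d")
          case True
          then have "(s x \<union> t x) \<inter> {..j} = s x" using ps[OF True] unfolding path_sets_def by fastforce
          then show ?thesis using True by simp
        qed (use s in \<open>auto simp: paths_cx mem_cx extensional_def\<close>)
      qed
      have et: "(\<lambda>x\<in>{..d}. ?u x \<inter> {j..}) = t"
      proof (rule ext)
        fix x show "(\<lambda>x\<in>{..d}. ?u x \<inter> {j..}) x = t x"
        proof (cases "x \<le> d")
          case True
          then have "(s x \<union> t x) \<inter> {j..} = t x" using ps[OF True] unfolding path_sets_def by fastforce
          then show ?thesis using True by simp
        qed (use t in \<open>auto simp: paths_cx mem_cx extensional_def\<close>)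
      qed
      have "F (0, n) d ?u = kcomp (ob 0) (ob j) (ob n) d (mp (j, n) d t) (mp (0, j) d s)"
        unfolding F0 Gb[OF ub] on_box_via[OF ub 3 j0] via_def es et ..
      moreover have "i = 0" "l = n" using il by auto
      moreover have "F (j, n) = mp (j, n)" "F (0, j) = mp (0, j)" using 3 by (auto intro!: Fmp)
      ultimately show ?thesis by simp
    qed
  qed
  have kan: "sobj kan_cat = {X :: 'a sset. is_kan X}" "smor kan_cat = (shom :: 'a sset \<Rightarrow> _)"
    by (simp_all add: kan_cat_def)
  have cell: "(ob, F) \<in> cells ?C n"
  proof -
    have "ob \<in> extensional {..n}" "F \<in> extensional (tri n)" by (auto simp: ob_def F_def)
    moreover have "\<forall>i\<le>n. ob i \<in> sobj kan_cat" using ob_kan by (simp add: kan)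
    moreover have "\<forall>i j. i \<le> j \<and> j \<le> n \<longrightarrow> F (i, j) \<in> smap (paths i j) (smor kan_cat (ob i) (ob j))"
      using Fsmap by (simp add: kan)
    ultimately show ?thesis unfolding mem_hc_nerve using Fid Fcomp by blast
  qed
  \<comment> \<open>it is enough to compare with \<open>h\<close> on the retractions onto the faces\<close>
  have faces: "act ?C n n (ret n T) (ob, F) = (obs T, maps T)" if T: "good T" for T
  proof -
    have g: "T \<subseteq> {..n}" "T \<noteq> {}" using T by (auto simp: good_def)
    have R: "ret n T \<in> Delta n n" by (rule ret_Delta[OF g])
    have idem: "act ?C n n (ret n T) (obs T, maps T) = (obs T, maps T)"
      by (rule face_face[OF T order_refl g(2)])
    have "(\<lambda>i\<in>{..n}. ob (ret n T i)) = (\<lambda>i\<in>{..n}. obs T (ret n T i))"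
      using obs_ob[OF T ret_mem[OF g]] by (intro restrict_ext) auto
    moreover
    have "pull (\<subseteq>) (Pow (path_sets i j)) ((`) (ret n T)) (F (ret n T i, ret n T j)) =
      pull (\<subseteq>) (Pow (path_sets i j)) ((`) (ret n T)) (maps T (ret n T i, ret n T j))" if ij: "i \<le> j" "j \<le> n" for i j
    proof (rule ext, rule ext)
      fix d s
      show "pull (\<subseteq>) (Pow (path_sets i j)) ((`) (ret n T)) (F (ret n T i, ret n T j)) d s =
        pull (\<subseteq>) (Pow (path_sets i j)) ((`) (ret n T)) (maps T (ret n T i, ret n T j)) d s"
      proof (cases "s \<in> cells (paths i j) d")
        case s: True
        have "s d \<subseteq> {..n}" using path_set_subset[OF ij(1) s, of d] ij by (auto simp: path_sets_def)
        then have "ret n T ` s d \<subseteq> T" using ret_mem[OF g] by auto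
        then show ?thesis
          using Fmaps[OF T Delta_mono[OF R ij] ret_mem[OF g] ret_mem[OF g] paths_image[OF R ij(2) s]] s ij
          by (simp add: pull_def paths_cx)
      qed (simp add: pull_def paths_cx)
    qed
    then have "(\<lambda>(i, j)\<in>tri n. pull (\<subseteq>) (Pow (path_sets i j)) ((`) (ret n T)) (F (ret n T i, ret n T j))) =
      (\<lambda>(i, j)\<in>tri n. pull (\<subseteq>) (Pow (path_sets i j)) ((`) (ret n T)) (maps T (ret n T i, ret n T j)))"
      by (intro restrict_ext) (auto simp: tri_def)
    ultimately show ?thesis using idem by (simp add: act_hc_nerve)
  qed
  define \<sigma> where "\<sigma> = (\<lambda>m. \<lambda>\<theta>\<in>Delta m n. act ?C m n \<theta> (ob, F))"
  have "\<sigma> \<in> smap (simplex n) ?C"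
  proof (rule smapI)
    fix m \<theta> assume "\<theta> \<in> cells (simplex n) m"
    then show "\<sigma> m \<theta> \<in> cells ?C m"
      using sset_act_cell[OF is_sset_hc_nerve _ cell] by (simp add: \<sigma>_def cells_simplex)
  next
    fix l m \<phi> \<theta> assume "\<phi> \<in> Delta l m" "\<theta> \<in> cells (simplex n) m"
    then show "\<sigma> l (act (simplex n) l m \<phi> \<theta>) = act ?C l m \<phi> (\<sigma> m \<theta>)"
      using sset_act_act[OF is_sset_hc_nerve _ _ cell] Delta_comp
      by (simp add: \<sigma>_def cells_simplex act_simplex)
  qed (simp add: \<sigma>_def cells_simplex)
  moreover have "\<sigma> m \<theta> = h m \<theta>" if \<theta>: "\<theta> \<in> cells (horn n k) m" for m \<theta>
  proof -
    let ?T = "\<theta> ` {..m}"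
    have D: "\<theta> \<in> Delta m n" and T: "good ?T" using \<theta> by (auto simp: horn_def good_def mem_Delta)
    have sub: "?T \<subseteq> {..n}" "?T \<noteq> {}" using T by (auto simp: good_def)
    have ab: "(\<lambda>i\<in>{..m}. ret n ?T (\<theta> i)) = \<theta>" by (rule ret_absorb[OF D order_refl sub(1)])
    have "\<sigma> m \<theta> = act ?C m n \<theta> (act ?C n n (ret n ?T) (ob, F))"
      using sset_act_act[OF is_sset_hc_nerve D ret_Delta[OF sub] cell] D ab by (simp add: \<sigma>_def)
    also have "\<dots> = act ?C m n \<theta> (h n (ret n ?T))" using faces[OF T] by (simp add: obs_def maps_def)
    also have "\<dots> = h m (act (horn n k) m n \<theta> (ret n ?T))"
      using smap_act[OF h D ret_horn[OF T]] by simp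
    also have "act (horn n k) m n \<theta> (ret n ?T) = \<theta>" using ab by (simp add: horn_cx act_cx)
    finally show ?thesis .
  qed
  ultimately show ?thesis by blast
qed

end

lemma spaces_inner_fills:
  assumes "0 < k" "k < n" shows "fills (spaces :: 'a spaces_cell sset) n k"
  unfolding fills_def spaces_def
proof
  fix h assume "h \<in> smap (horn n k) (hc_nerve kan_cat :: 'a spaces_cell sset)"
  then interpret inner_horn n k h by unfold_locales (use assms in auto)
  show "\<exists>\<sigma>\<in>smap (simplex n) (hc_nerve kan_cat). \<forall>m. \<forall>\<theta>\<in>cells (horn n k) m. \<sigma> m \<theta> = h m \<theta>"
    by (rule filler)
qed

section \<open>Terminal objects of slices\<close>

text \<open>
The complex \<open>\<partial>\<Delta>\<^sup>n \<star> P\<close>.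
\<close>

definition cone_boundary :: "nat \<Rightarrow> 'v set \<Rightarrow> (nat + 'v) set set" where
  "cone_boundary n P = {c. c \<subseteq> {..n} <+> P \<and> \<not> {..n} \<subseteq> Inl -` c}"

lemma down_closed_cone_boundary: "down_closed (cone_boundary n P)"
  unfolding down_closed_def cone_boundary_def by blast

lemma cells_slice: "cells (slice C P r p) n = {F \<in> smap (chain_cx (join_le (\<le>) r) (Pow ({..n} <+> P))) C.
    \<forall>m. \<forall>s\<in>cells (chain_cx r (Pow P)) m. F m (\<lambda>i\<in>{..m}. Inr (s i)) = p m s}"
  by (simp add: slice_def pnerve_cx)

lemma act_slice: "act (slice C P r p) m n \<theta> F = pull (join_le (\<le>) r) (Pow ({..m} <+> P)) (map_sum \<theta> id) F"
  by (simp add: slice_def pnerve_cx pull_def)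

lemma map_sum_mono:
  assumes "\<theta> \<in> Delta m n" "c \<subseteq> {..m} <+> P" "x \<in> c" "y \<in> c" "join_le (\<le>) r x y"
  shows "join_le (\<le>) r (map_sum \<theta> id x) (map_sum \<theta> id y)"
  using assms Delta_mono[OF assms(1)] by (cases x; cases y) (auto simp: subset_iff)

lemma map_sum_image:
  assumes "\<theta> \<in> Delta m n" "c \<subseteq> {..m} <+> P"
  shows "map_sum \<theta> id ` c \<subseteq> {..n} <+> P" "Inl -` (map_sum \<theta> id ` c) \<subseteq> \<theta> ` {..m}"
proof -
  show "map_sum \<theta> id ` c \<subseteq> {..n} <+> P"
  proof (rule image_subsetI)
    fix x assume "x \<in> c"
    then have "x \<in> {..m} <+> P" using assms(2) by blast
    then show "map_sum \<theta> id x \<in> {..n} <+> P" using Delta_le[OF assms(1)] by auto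
  qed
  show "Inl -` (map_sum \<theta> id ` c) \<subseteq> \<theta> ` {..m}"
  proof
    fix i assume "i \<in> Inl -` (map_sum \<theta> id ` c)"
    then obtain x where x: "x \<in> c" "Inl i = map_sum \<theta> id x" by auto
    then have "x \<in> {..m} <+> P" using assms(2) by blast
    then show "i \<in> \<theta> ` {..m}" using x(2) by auto
  qed
qed

lemma map_sum_cells:
  assumes \<theta>: "\<theta> \<in> Delta m n" and s: "s \<in> cells (chain_cx (join_le (\<le>) r) (Pow ({..m} <+> P))) k"
  shows "(\<lambda>i\<in>{..k}. map_sum \<theta> id (s i)) \<in> cells (chain_cx (join_le (\<le>) r) (Pow ({..n} <+> P))) k"
proof (rule map_cells[OF s])
  fix c assume c: "c \<in> Pow ({..m} <+> P)"
  then show "map_sum \<theta> id ` c \<in> Pow ({..n} <+> P)" using map_sum_image(1)[OF \<theta>, of c P] by simp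
  show "join_le (\<le>) r (map_sum \<theta> id x) (map_sum \<theta> id y)"
    if "x \<in> c" "y \<in> c" "join_le (\<le>) r x y" for x y
    using map_sum_mono[OF \<theta> _ that, of P] c by simp
qed

lemma map_sum_pull:
  assumes \<theta>: "\<theta> \<in> Delta m n" and G: "G \<in> smap (chain_cx (join_le (\<le>) r) (Pow ({..n} <+> P))) C"
  shows "pull (join_le (\<le>) r) (Pow ({..m} <+> P)) (map_sum \<theta> id) G
    \<in> smap (chain_cx (join_le (\<le>) r) (Pow ({..m} <+> P))) C"
proof (rule pull_smap[OF G down_closed_Pow])
  fix c assume c: "c \<in> Pow ({..m} <+> P)"
  then show "map_sum \<theta> id ` c \<in> Pow ({..n} <+> P)" using map_sum_image(1)[OF \<theta>, of c P] by simp
  show "join_le (\<le>) r (map_sum \<theta> id x) (map_sum \<theta> id y)"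
    if "x \<in> c" "y \<in> c" "join_le (\<le>) r x y" for x y
    using map_sum_mono[OF \<theta> _ that, of P] c by simp
qed

lemma map_sum_pull_comp:
  assumes \<phi>: "\<phi> \<in> Delta l m"
  shows "pull (join_le (\<le>) r) (Pow ({..l} <+> P)) (map_sum (\<lambda>i\<in>{..l}. \<theta> (\<phi> i)) id) g =
    pull (join_le (\<le>) r) (Pow ({..l} <+> P)) (map_sum \<phi> id)
      (pull (join_le (\<le>) r) (Pow ({..m} <+> P)) (map_sum \<theta> id) g)" (is "?L = ?R")
proof (rule ext, rule ext)
  fix k s show "?L k s = ?R k s"
  proof (cases "s \<in> cells (chain_cx (join_le (\<le>) r) (Pow ({..l} <+> P))) k")
    case s: True
    have "map_sum (\<lambda>i\<in>{..l}. \<theta> (\<phi> i)) id (s i) = map_sum \<theta> id (map_sum \<phi> id (s i))" if "i \<le> k" for i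
    proof -
      have "s i \<in> {..l} <+> P" using s that by (auto simp: mem_cx)
      then show ?thesis by auto
    qed
    then show ?thesis using s map_sum_cells[OF \<phi> s] by (simp add: pull_def cong: restrict_cong)
  qed (simp add: pull_def)
qed

lemma ret_boundary:
  assumes "T \<subseteq> {..n}" "T \<noteq> {}" "\<not> {..n} \<subseteq> T" shows "ret n T \<in> cells (boundary n) n"
  using ret_Delta[OF assms(1,2)] ret_mem[OF assms(1,2)] assms(3) by (auto simp: boundary_def)

lemma map_sum_ret:
  assumes "T \<subseteq> {..n}" "T \<noteq> {}" "s \<in> extensional {..m}" "\<And>i j. i \<le> m \<Longrightarrow> s i = Inl j \<Longrightarrow> j \<in> T"
  shows "(\<lambda>i\<in>{..m}. map_sum (ret n T) id (s i)) = s"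
proof (rule restrict_eqI[OF assms(3)])
  fix i assume "i \<in> {..m}"
  then show "map_sum (ret n T) id (s i) = s i"
    using assms(4)[of i] ret_id[OF assms(1,2)] by (cases "s i") auto
qed

lemma Inl_support: "i \<le> m \<Longrightarrow> s i = Inl j \<Longrightarrow> j \<in> Inl -` (s ` {..m})"
  by (rule vimageI2) (metis atMost_iff image_eqI)

lemma act_simplex_id: "\<theta> \<in> Delta m n \<Longrightarrow> act (simplex n) m n \<theta> (Delta_id n) = \<theta>"
  by (simp add: act_simplex Delta_id_comp)

lemma act_boundary: "act (boundary n) m k \<theta> \<alpha> = (\<lambda>i\<in>{..m}. \<alpha> (\<theta> i))"
  by (simp add: boundary_cx act_cx)

lemma cells_boundary: "cells (boundary n) m = {\<theta> \<in> Delta m n. \<not> {..n} \<subseteq> \<theta> ` {..m}}"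
  by (simp add: boundary_def)

text \<open>
A map \<open>\<partial>\<Delta>\<^sup>n \<rightarrow> C\<^bsub>/p\<^esub>\<close> is a map \<open>\<partial>\<Delta>\<^sup>n \<star> P \<rightarrow> C\<close> that restricts to \<open>p\<close>, so a terminal object solves
extension problems for joins. The universal simplex of the extended map is the wanted extension.
\<close>

lemma terminal_extension:
  fixes r :: "'v \<Rightarrow> 'v \<Rightarrow> bool"
  defines "J \<equiv> join_le (\<le>) r"
  assumes t: "is_terminal (slice C P r p) t" and n: "n \<ge> 1"
    and g: "g \<in> smap (chain_cx J (cone_boundary n P)) C"
    and gp: "\<And>m s. s \<in> cells (chain_cx r (Pow P)) m \<Longrightarrow> g m (\<lambda>i\<in>{..m}. Inr (s i)) = p m s"
    and gt: "\<And>m s. s \<in> cells (chain_cx J (Pow ({..0} <+> P))) m \<Longrightarrow> g m (\<lambda>i\<in>{..m}. map_sum (\<lambda>_. n) id (s i)) = t m s"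
  shows "\<exists>G\<in>smap (chain_cx J (Pow ({..n} <+> P))) C. \<forall>m. \<forall>s\<in>cells (chain_cx J (cone_boundary n P)) m. G m s = g m s"
proof -
  let ?S = "slice C P r p"
  have Jmono: "J (map_sum \<theta> id x) (map_sum \<theta> id y)"
    if "\<theta> \<in> Delta m k" "c \<in> Pow ({..m} <+> P)" "x \<in> c" "y \<in> c" "J x y" for \<theta> m k c x y
    using map_sum_mono[OF that(1) _ that(3,4)] that(2,5) unfolding J_def by blast
  define h where "h = (\<lambda>m. \<lambda>\<theta>\<in>cells (boundary n) m. pull J (Pow ({..m} <+> P)) (map_sum \<theta> id) g)"
  have into: "map_sum \<theta> id ` c \<in> cone_boundary n P"
    if \<theta>: "\<theta> \<in> cells (boundary n) m" and c: "c \<in> Pow ({..m} <+> P)" for \<theta> m c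
  proof -
    have \<theta>': "\<theta> \<in> Delta m n" "\<not> {..n} \<subseteq> \<theta> ` {..m}" using \<theta> by (auto simp: cells_boundary)
    have c': "c \<subseteq> {..m} <+> P" using c by simp
    have "\<not> {..n} \<subseteq> Inl -` (map_sum \<theta> id ` c)"
      using \<theta>'(2) map_sum_image(2)[OF \<theta>'(1) c'] by (meson order_trans)
    moreover have "map_sum \<theta> id ` c \<subseteq> {..n} <+> P" by (rule map_sum_image(1)[OF \<theta>'(1) c'])
    ultimately show ?thesis unfolding cone_boundary_def by simp
  qed
  have hcell: "h m \<theta> \<in> smap (chain_cx J (Pow ({..m} <+> P))) C" if \<theta>: "\<theta> \<in> cells (boundary n) m" for m \<theta>
  proof -
    have "\<theta> \<in> Delta m n" using \<theta> by (simp add: cells_boundary)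
    then have "pull J (Pow ({..m} <+> P)) (map_sum \<theta> id) g \<in> smap (chain_cx J (Pow ({..m} <+> P))) C"
      by (intro pull_smap[OF g down_closed_Pow Jmono] into[OF \<theta>])
    then show ?thesis using \<theta> by (simp add: h_def)
  qed
  have "h \<in> smap (boundary n) ?S"
  proof (rule smapI)
    fix m \<theta> assume \<theta>: "\<theta> \<in> cells (boundary n) m"
    have "h m \<theta> k (\<lambda>i\<in>{..k}. Inr (s i)) = p k s" if s: "s \<in> cells (chain_cx r (Pow P)) k" for k s
    proof -
      have "(\<lambda>i\<in>{..k}. Inr (s i) :: nat + 'v) \<in> cells (chain_cx J (Pow ({..m} <+> P))) k"
        by (rule map_cells[OF s]) (auto simp: J_def)
      moreover have "(\<lambda>i\<in>{..k}. map_sum \<theta> id ((\<lambda>i\<in>{..k}. Inr (s i)) i)) = (\<lambda>i\<in>{..k}. Inr (s i))"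
        by (rule restrict_ext) simp
      ultimately show ?thesis using gp[OF s] \<theta> by (simp add: h_def pull_def)
    qed
    then show "h m \<theta> \<in> cells ?S m" using hcell[OF \<theta>] by (simp add: cells_slice J_def)
  next
    fix l m \<phi> \<theta> assume \<phi>: "\<phi> \<in> Delta l m" and \<theta>: "\<theta> \<in> cells (boundary n) m"
    let ?\<psi> = "\<lambda>i\<in>{..l}. \<theta> (\<phi> i)"
    have \<psi>: "?\<psi> \<in> cells (boundary n) l"
      using cx_act_mem[OF _ \<theta>[unfolded boundary_cx] \<phi>] by (fastforce simp: boundary_cx down_closed_def)
    have "pull J (Pow ({..l} <+> P)) (map_sum ?\<psi> id) g =
      pull J (Pow ({..l} <+> P)) (map_sum \<phi> id) (pull J (Pow ({..m} <+> P)) (map_sum \<theta> id) g)"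
      unfolding J_def by (rule map_sum_pull_comp[OF \<phi>])
    then show "h l (act (boundary n) l m \<phi> \<theta>) = act ?S l m \<phi> (h m \<theta>)"
      using \<theta> \<psi> by (simp add: h_def act_slice act_boundary J_def)
  qed (simp add: h_def)
  moreover have "h 0 (\<lambda>_\<in>{..0}. n) = t"
  proof (rule smap_eqI)
    have b: "(\<lambda>_\<in>{..0}. n) \<in> cells (boundary n) 0"
      using n by (auto simp: cells_boundary mem_Delta)
    show "h 0 (\<lambda>_\<in>{..0}. n) \<in> smap (chain_cx J (Pow ({..0} <+> P))) C" by (rule hcell[OF b])
    show "t \<in> smap (chain_cx J (Pow ({..0} <+> P))) C"
      using t unfolding is_terminal_def cells_slice J_def by blast
    fix m s assume s: "s \<in> cells (chain_cx J (Pow ({..0} <+> P))) m"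
    have "(\<lambda>i\<in>{..m}. map_sum (\<lambda>_\<in>{..0}. n) id (s i)) = (\<lambda>i\<in>{..m}. map_sum (\<lambda>_. n) id (s i))"
    proof (rule restrict_ext)
      fix i assume "i \<in> {..m}"
      then have "s i \<in> {..0} <+> P" using s by (auto simp: mem_cx)
      then show "map_sum (\<lambda>_\<in>{..0}. n) id (s i) = map_sum (\<lambda>_. n) id (s i)" by auto
    qed
    then show "h 0 (\<lambda>_\<in>{..0}. n) m s = t m s" using gt[OF s] s b by (simp add: h_def pull_def)
  qed
  ultimately obtain \<sigma> where \<sigma>: "\<sigma> \<in> smap (simplex n) ?S"
    and \<sigma>h: "\<And>m \<theta>. \<theta> \<in> cells (boundary n) m \<Longrightarrow> \<sigma> m \<theta> = h m \<theta>"
    using t n unfolding is_terminal_def by blast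
  have idc: "Delta_id n \<in> cells (simplex n) n" by (simp add: cells_simplex Delta_id_mem)
  have "\<sigma> n (Delta_id n) \<in> smap (chain_cx J (Pow ({..n} <+> P))) C"
    using smap_cell[OF \<sigma> idc] by (simp add: cells_slice J_def)
  moreover have "\<sigma> n (Delta_id n) m s = g m s" if s: "s \<in> cells (chain_cx J (cone_boundary n P)) m" for m s
  proof -
    define I where "I = Inl -` (s ` {..m})"
    \<comment> \<open>a retraction needs a nonempty image; any vertex will do for simplices of \<open>P\<close>\<close>
    define T where "T = (if I = {} then {0} else I)"
    have "s ` {..m} \<in> cone_boundary n P" using s by (simp add: mem_cx)
    then have "I \<subseteq> {..n}" "\<not> {..n} \<subseteq> I" unfolding I_def cone_boundary_def by auto
    moreover have "\<not> {..n} \<subseteq> {0}" using n by (auto simp: subset_iff)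
    ultimately have T: "T \<subseteq> {..n}" "T \<noteq> {}" "\<not> {..n} \<subseteq> T" by (auto simp: T_def)
    have e: "(\<lambda>i\<in>{..m}. map_sum (ret n T) id (s i)) = s"
    proof (rule map_sum_ret[OF T(1,2)])
      show "s \<in> extensional {..m}" using s by (simp add: mem_cx)
      show "k \<in> T" if "i \<le> m" "s i = Inl k" for i k
        using Inl_support[of i m s k] that unfolding T_def I_def by auto
    qed
    have sm: "s \<in> cells (chain_cx J (Pow ({..n} <+> P))) m"
      by (rule cx_mono[OF s]) (auto simp: cone_boundary_def)
    have R: "ret n T \<in> Delta n n" by (rule ret_Delta[OF T(1,2)])
    have "\<sigma> n (ret n T) = act ?S n n (ret n T) (\<sigma> n (Delta_id n))"
      using smap_act[OF \<sigma> R idc] act_simplex_id[OF R] by simp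
    then have "\<sigma> n (ret n T) m s = \<sigma> n (Delta_id n) m s"
      using e sm by (simp add: act_slice pull_def J_def)
    moreover have "\<sigma> n (ret n T) m s = g m s"
      using \<sigma>h[OF ret_boundary[OF T]] ret_boundary[OF T] e sm by (simp add: h_def pull_def)
    ultimately show ?thesis by simp
  qed
  ultimately show ?thesis by blast
qed

text \<open>
The converse of \<open>terminal_extension\<close>. A map \<open>h\<close> on \<open>\<partial>\<Delta>\<^sup>n\<close> is turned into a map on \<open>\<partial>\<Delta>\<^sup>n \<star> P\<close> by
evaluating, at a simplex \<open>s\<close>, the cell that \<open>h\<close> assigns to the retraction onto the vertices of \<open>s\<close>
in \<open>[n]\<close>. Any larger proper face of \<open>\<Delta>\<^sup>n\<close> gives the same value, which yields naturality.
\<close>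

lemma terminal_intro:
  fixes r :: "'v \<Rightarrow> 'v \<Rightarrow> bool"
  defines "J \<equiv> join_le (\<le>) r"
  assumes t: "t \<in> cells (slice C P r p) 0"
    and ext: "\<And>n g. n \<ge> 1 \<Longrightarrow> g \<in> smap (chain_cx J (cone_boundary n P)) C \<Longrightarrow>
      (\<And>m s. s \<in> cells (chain_cx r (Pow P)) m \<Longrightarrow> g m (\<lambda>i\<in>{..m}. Inr (s i)) = p m s) \<Longrightarrow>
      (\<And>m s. s \<in> cells (chain_cx J (Pow ({..0} <+> P))) m \<Longrightarrow> g m (\<lambda>i\<in>{..m}. map_sum (\<lambda>_. n) id (s i)) = t m s) \<Longrightarrow>
      \<exists>G\<in>smap (chain_cx J (Pow ({..n} <+> P))) C. \<forall>m. \<forall>s\<in>cells (chain_cx J (cone_boundary n P)) m. G m s = g m s"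
  shows "is_terminal (slice C P r p) t"
  unfolding is_terminal_def
proof (intro conjI allI ballI impI)
  let ?S = "slice C P r p"
  show "t \<in> cells ?S 0" by (rule t)
  fix n :: nat and h assume n: "1 \<le> n" and h: "h \<in> smap (boundary n) ?S" and h0: "h 0 (\<lambda>_\<in>{..0}. n) = t"
  define valid where "valid T \<longleftrightarrow> T \<subseteq> {..n} \<and> T \<noteq> {} \<and> \<not> {..n} \<subseteq> T" for T
  have hT: "h n (ret n T) \<in> smap (chain_cx J (Pow ({..n} <+> P))) C"
    and hp: "\<And>m s. s \<in> cells (chain_cx r (Pow P)) m \<Longrightarrow> h n (ret n T) m (\<lambda>i\<in>{..m}. Inr (s i)) = p m s"
    if "valid T" for T
    using smap_cell[OF h ret_boundary[of T n]] that by (auto simp: valid_def cells_slice J_def)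
  define supp where "supp m s = Inl -` (s ` {..m})" for m :: nat and s :: "nat \<Rightarrow> nat + 'v"
  \<comment> \<open>the value at simplices of \<open>P\<close> is that of \<open>p\<close>, whichever vertex is used\<close>
  define T where "T m s = (if supp m s = {} then {0} else supp m s)" for m s
  define g where "g = (\<lambda>m. \<lambda>s\<in>cells (chain_cx J (cone_boundary n P)) m. h n (ret n (T m s)) m s)"
  have zero: "valid {0}" using n by (auto simp: valid_def subset_iff)
  have Tvalid: "valid (T m s)" and supp_T: "supp m s \<subseteq> T m s"
    and sJ: "s \<in> cells (chain_cx J (Pow ({..n} <+> P))) m"
    if s: "s \<in> cells (chain_cx J (cone_boundary n P)) m" for m s
  proof -
    have "s ` {..m} \<in> cone_boundary n P" using s by (simp add: mem_cx)
    then have "supp m s \<subseteq> {..n}" "\<not> {..n} \<subseteq> supp m s" unfolding supp_def cone_boundary_def by auto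
    then show "valid (T m s)" using zero by (auto simp: T_def valid_def)
    show "supp m s \<subseteq> T m s" by (simp add: T_def)
    show "s \<in> cells (chain_cx J (Pow ({..n} <+> P))) m" by (rule cx_mono[OF s]) (auto simp: cone_boundary_def)
  qed
  have hInr: "h n (ret n T') m s = p m (\<lambda>i\<in>{..m}. projr (s i))"
    if T': "valid T'" and s: "s \<in> cells (chain_cx J (Pow ({..n} <+> P))) m" and e: "supp m s = {}" for T' m s
  proof -
    have c: "\<exists>x\<in>P. s i = Inr x" if "i \<le> m" for i
    proof -
      have "s i \<in> {..n} <+> P" using s that by (auto simp: mem_cx)
      moreover have "s i \<noteq> Inl j" for j using e Inl_support[OF that, of s j] by (auto simp: supp_def)
      ultimately show ?thesis by auto
    qed
    have mono: "J (s i) (s j)" if "i \<le> j" "j \<le> m" for i j using s that by (simp add: mem_cx)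
    have "r (projr (s i)) (projr (s j))" if "i \<le> j" "j \<le> m" for i j
      using c[of i] c[of j] mono[OF that] that by (auto simp: J_def)
    then have "(\<lambda>i\<in>{..m}. projr (s i)) \<in> cells (chain_cx r (Pow P)) m"
      using c by (fastforce simp: mem_cx)
    moreover have "(\<lambda>i\<in>{..m}. Inr ((\<lambda>i\<in>{..m}. projr (s i)) i)) = s"
    proof (rule restrict_eqI)
      show "s \<in> extensional {..m}" using s by (simp add: mem_cx)
      show "Inr ((\<lambda>i\<in>{..m}. projr (s i)) i) = s i" if "i \<in> {..m}" for i
        using c[of i] that by auto
    qed
    ultimately show ?thesis using hp[OF T'] by metis
  qed
  have hsub: "h n (ret n T1) m s = h n (ret n T2) m s"
    if T2: "valid T2" and T1: "T1 \<subseteq> T2" "T1 \<noteq> {}" and s: "s \<in> cells (chain_cx J (Pow ({..n} <+> P))) m"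
      and I: "supp m s \<subseteq> T1" for T1 T2 m s
  proof -
    have T: "T2 \<subseteq> {..n}" "T1 \<subseteq> {..n}" using T1 T2 by (auto simp: valid_def)
    have "h n (ret n T1) = act ?S n n (ret n T1) (h n (ret n T2))"
    proof -
      have "ret n T2 \<in> cells (boundary n) n" using T2 unfolding valid_def by (intro ret_boundary) auto
      then show ?thesis
        using smap_act[OF h ret_Delta[OF T(2) T1(2)]] ret_comp[OF T(1) T1(2,1)] by (metis act_boundary)
    qed
    moreover have "(\<lambda>i\<in>{..m}. map_sum (ret n T1) id (s i)) = s"
    proof (rule map_sum_ret[OF T(2) T1(2)])
      show "s \<in> extensional {..m}" using s by (simp add: mem_cx)
      show "k \<in> T1" if "i \<le> m" "s i = Inl k" for i k
        using Inl_support[of i m s k] that I unfolding supp_def by auto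
    qed
    ultimately show ?thesis using s by (simp add: act_slice pull_def J_def)
  qed
  have gT: "g m s = h n (ret n T') m s"
    if T': "valid T'" "supp m s \<subseteq> T'" and s: "s \<in> cells (chain_cx J (cone_boundary n P)) m" for T' m s
  proof (cases "supp m s = {}")
    case True
    then show ?thesis using hInr[OF T'(1) sJ[OF s]] hInr[OF Tvalid[OF s] sJ[OF s]] s by (simp add: g_def)
  next
    case False
    then show ?thesis using hsub[OF T' _ sJ[OF s]] s by (simp add: g_def T_def)
  qed
  have "\<exists>G\<in>smap (chain_cx J (Pow ({..n} <+> P))) C. \<forall>m. \<forall>s\<in>cells (chain_cx J (cone_boundary n P)) m. G m s = g m s"
  proof (rule ext[OF n])
    show "g \<in> smap (chain_cx J (cone_boundary n P)) C"
    proof (rule smapI)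
      fix m s assume s: "s \<in> cells (chain_cx J (cone_boundary n P)) m"
      then show "g m s \<in> cells C m" using smap_cell[OF hT[OF Tvalid[OF s]] sJ[OF s]] by (simp add: g_def)
    next
      fix l m \<phi> s assume \<phi>: "\<phi> \<in> Delta l m" and s: "s \<in> cells (chain_cx J (cone_boundary n P)) m"
      let ?u = "\<lambda>i\<in>{..l}. s (\<phi> i)"
      have u: "?u \<in> cells (chain_cx J (cone_boundary n P)) l" by (rule cx_act_mem[OF down_closed_cone_boundary s \<phi>])
      have "supp l ?u \<subseteq> supp m s" using Delta_le[OF \<phi>] by (auto simp: supp_def)
      then have "g l ?u = h n (ret n (T m s)) l ?u" using gT[OF Tvalid[OF s] _ u] supp_T[OF s] by blast
      then show "g l (act (chain_cx J (cone_boundary n P)) l m \<phi> s) = act C l m \<phi> (g m s)"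
        using smap_act[OF hT[OF Tvalid[OF s]] \<phi> sJ[OF s]] s by (simp add: act_cx g_def)
    qed (simp add: g_def)
    fix m s assume s: "s \<in> cells (chain_cx r (Pow P)) m"
    let ?u = "\<lambda>i\<in>{..m}. Inr (s i) :: nat + 'v"
    have "?u \<in> cells (chain_cx J (cone_boundary n P)) m"
      by (rule map_cells[OF s]) (auto simp: J_def cone_boundary_def)
    moreover have "supp m ?u \<subseteq> {0}" by (auto simp: supp_def)
    ultimately show "g m ?u = p m s" using gT[OF zero] hp[OF zero s] by simp
  next
    fix m s assume s: "s \<in> cells (chain_cx J (Pow ({..0} <+> P))) m"
    let ?u = "\<lambda>i\<in>{..m}. map_sum (\<lambda>_. n) id (s i)"
    let ?z = "\<lambda>_\<in>{..n}. 0 :: nat"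
    have z: "?z \<in> Delta n 0" by (auto simp: mem_Delta)
    have n0: "(\<lambda>_\<in>{..0}. n) \<in> cells (boundary n) 0" using n by (auto simp: cells_boundary mem_Delta)
    have vn: "valid {n}" using n by (auto simp: valid_def subset_iff)
    have rn: "ret n {n} = (\<lambda>_\<in>{..n}. n)"
      using ret_mem[of "{n}" n] ret_Delta[of "{n}" n] by (auto simp: mem_Delta extensional_def)
    have si: "s i \<in> {..0} <+> P" if "i \<le> m" for i using s that by (auto simp: mem_cx)
    have u: "?u \<in> cells (chain_cx J (cone_boundary n P)) m"
    proof (rule map_cells[OF s])
      fix c x y assume c: "c \<in> Pow ({..0} <+> P)" and xy: "x \<in> c" "y \<in> c" "J x y"
      show "J (map_sum (\<lambda>_. n) id x) (map_sum (\<lambda>_. n) id y)"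
        using xy by (cases x; cases y) (auto simp: J_def)
    next
      fix c assume c: "c \<in> Pow ({..0::nat} <+> P)"
      have "map_sum (\<lambda>_. n) id x \<in> {n} <+> P" if "x \<in> c" for x
      proof -
        have "x \<in> {..0} <+> P" using c that by blast
        then show ?thesis by auto
      qed
      then have "map_sum (\<lambda>_. n) id ` c \<subseteq> {n} <+> P" by blast
      then have "map_sum (\<lambda>_. n) id ` c \<subseteq> {..n} <+> P" "Inl 0 \<notin> map_sum (\<lambda>_. n) id ` c"
        using n by auto
      then show "map_sum (\<lambda>_. n) id ` c \<in> cone_boundary n P" by (auto simp: cone_boundary_def subset_iff)
    qed
    have "supp m ?u \<subseteq> {n}" 
    proof
      fix j assume "j \<in> supp m ?u"
      then obtain i where "i \<le> m" "map_sum (\<lambda>_. n) id (s i) = Inl j" by (auto simp: supp_def)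
      then show "j \<in> {n}" by (cases "s i") auto
    qed
    then have "g m ?u = h n (\<lambda>_\<in>{..n}. n) m ?u" using gT[OF vn _ u] rn by simp
    also have "h n (\<lambda>_\<in>{..n}. n) = act ?S n 0 ?z t"
    proof -
      have "(\<lambda>_\<in>{..n}. n) = act (boundary n) n 0 ?z (\<lambda>_\<in>{..0}. n)"
        unfolding act_boundary by (rule restrict_ext) simp
      then show ?thesis using smap_act[OF h z n0] h0 by simp
    qed
    also have "\<dots> m ?u = t m (\<lambda>i\<in>{..m}. map_sum ?z id (?u i))"
      using sJ[OF u] by (simp add: act_slice pull_def J_def)
    also have "(\<lambda>i\<in>{..m}. map_sum ?z id (?u i)) = s"
    proof (rule restrict_eqI)
      show "s \<in> extensional {..m}" using s by (simp add: mem_cx)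
      fix i assume "i \<in> {..m}"
      then show "map_sum ?z id (?u i) = s i" using si[of i] by auto
    qed
    finally show "g m ?u = t m s" .
  qed
  then obtain G where G: "G \<in> smap (chain_cx J (Pow ({..n} <+> P))) C"
    and Gg: "\<And>m s. s \<in> cells (chain_cx J (cone_boundary n P)) m \<Longrightarrow> G m s = g m s" by blast
  define \<sigma> where "\<sigma> = (\<lambda>m. \<lambda>\<theta>\<in>Delta m n. pull J (Pow ({..m} <+> P)) (map_sum \<theta> id) G)"
  have pushJ: "(\<lambda>i\<in>{..k}. map_sum \<theta> id (s i)) \<in> cells (chain_cx J (Pow ({..l} <+> P))) k"
    if \<theta>: "\<theta> \<in> Delta m l" and s: "s \<in> cells (chain_cx J (Pow ({..m} <+> P))) k" for \<theta> m k l s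
    unfolding J_def by (rule map_sum_cells[OF \<theta> s[unfolded J_def]])
  have pGm: "pull J (Pow ({..m} <+> P)) (map_sum \<theta> id) G \<in> smap (chain_cx J (Pow ({..m} <+> P))) C"
    if \<theta>: "\<theta> \<in> Delta m n" for m \<theta>
    unfolding J_def by (rule map_sum_pull[OF \<theta> G[unfolded J_def]])
  have "\<sigma> \<in> smap (simplex n) ?S"
  proof (rule smapI)
    fix m \<theta> assume "\<theta> \<in> cells (simplex n) m"
    then have \<theta>: "\<theta> \<in> Delta m n" by (simp add: cells_simplex)
    have "\<sigma> m \<theta> k (\<lambda>i\<in>{..k}. Inr (s i)) = p k s" if s: "s \<in> cells (chain_cx r (Pow P)) k" for k s
    proof -
      let ?u = "\<lambda>i\<in>{..k}. Inr (s i) :: nat + 'v"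
      have u: "?u \<in> cells (chain_cx J (Pow ({..m} <+> P))) k"
        by (rule map_cells[OF s]) (auto simp: J_def)
      have u': "?u \<in> cells (chain_cx J (cone_boundary n P)) k"
        by (rule map_cells[OF s]) (auto simp: J_def cone_boundary_def)
      have "(\<lambda>i\<in>{..k}. map_sum \<theta> id (?u i)) = ?u" by (rule restrict_ext) simp
      then have "\<sigma> m \<theta> k ?u = g k ?u" using \<theta> u Gg[OF u'] by (simp add: \<sigma>_def pull_def)
      moreover have "supp k ?u \<subseteq> {0}" by (auto simp: supp_def)
      ultimately show ?thesis using gT[OF zero _ u'] hp[OF zero s] by simp
    qed
    then show "\<sigma> m \<theta> \<in> cells ?S m" using pGm[OF \<theta>] \<theta> by (simp add: cells_slice \<sigma>_def J_def)
  next
    fix l m \<phi> \<theta> assume \<phi>: "\<phi> \<in> Delta l m" and "\<theta> \<in> cells (simplex n) m"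
    then have \<theta>: "\<theta> \<in> Delta m n" by (simp add: cells_simplex)
    let ?\<psi> = "\<lambda>i\<in>{..l}. \<theta> (\<phi> i)"
    have "pull J (Pow ({..l} <+> P)) (map_sum ?\<psi> id) G =
      pull J (Pow ({..l} <+> P)) (map_sum \<phi> id) (pull J (Pow ({..m} <+> P)) (map_sum \<theta> id) G)"
      unfolding J_def by (rule map_sum_pull_comp[OF \<phi>])
    then show "\<sigma> l (act (simplex n) l m \<phi> \<theta>) = act ?S l m \<phi> (\<sigma> m \<theta>)"
      using \<theta> Delta_comp[OF \<phi> \<theta>] by (simp add: \<sigma>_def act_slice act_simplex J_def)
  qed (simp add: \<sigma>_def cells_simplex)
  moreover have "\<sigma> m \<theta> = h m \<theta>" if b: "\<theta> \<in> cells (boundary n) m" for m \<theta>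
  proof (rule smap_eqI)
    have \<theta>: "\<theta> \<in> Delta m n" and vT: "valid (\<theta> ` {..m})"
      using b by (auto simp: cells_boundary valid_def mem_Delta)
    show "\<sigma> m \<theta> \<in> smap (chain_cx J (Pow ({..m} <+> P))) C" using pGm[OF \<theta>] \<theta> by (simp add: \<sigma>_def)
    show "h m \<theta> \<in> smap (chain_cx J (Pow ({..m} <+> P))) C"
      using smap_cell[OF h b] by (simp add: cells_slice J_def)
    fix k s assume s: "s \<in> cells (chain_cx J (Pow ({..m} <+> P))) k"
    let ?u = "\<lambda>i\<in>{..k}. map_sum \<theta> id (s i)"
    let ?T = "\<theta> ` {..m}"
    have uJ: "?u \<in> cells (chain_cx J (Pow ({..n} <+> P))) k" by (rule pushJ[OF \<theta> s])
    have sm: "s ` {..k} \<subseteq> {..m} <+> P" using s by (simp add: mem_cx)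
    have im: "?u ` {..k} = map_sum \<theta> id ` (s ` {..k})" by auto
    have su: "supp k ?u \<subseteq> ?T" unfolding supp_def im by (rule map_sum_image(2)[OF \<theta> sm])
    have "?u ` {..k} \<in> cone_boundary n P"
    proof -
      have "\<not> {..n} \<subseteq> supp k ?u" using su vT unfolding valid_def by (meson order_trans)
      then show ?thesis using uJ by (simp add: cone_boundary_def mem_cx supp_def)
    qed
    then have u: "?u \<in> cells (chain_cx J (cone_boundary n P)) k" using uJ by (simp add: mem_cx)
    have "\<sigma> m \<theta> k s = g k ?u" using Gg[OF u] \<theta> s by (simp add: \<sigma>_def pull_def)
    also have "\<dots> = h n (ret n ?T) k ?u" by (rule gT[OF vT su u])
    also have "\<dots> = act ?S m n \<theta> (h n (ret n ?T)) k s" using s by (simp add: act_slice pull_def J_def)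
    also have "act ?S m n \<theta> (h n (ret n ?T)) = h m (act (boundary n) m n \<theta> (ret n ?T))"
    proof -
      have "ret n ?T \<in> cells (boundary n) n" using vT unfolding valid_def by (intro ret_boundary) auto
      then show ?thesis using smap_act[OF h \<theta>] by simp
    qed
    also have "act (boundary n) m n \<theta> (ret n ?T) = \<theta>"
      using ret_absorb[OF \<theta> order_refl] vT by (simp add: act_boundary valid_def)
    finally show "\<sigma> m \<theta> k s = h m \<theta> k s" .
  qed
  ultimately show "\<exists>\<sigma>\<in>smap (simplex n) ?S. \<forall>m. \<forall>\<theta>\<in>cells (boundary n) m. \<sigma> m \<theta> = h m \<theta>" by blast
qed

section \<open>Retracts of pullback squares\<close>

lemma porder_join: "porder r \<Longrightarrow> porder s \<Longrightarrow> porder (join_le r s)"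
  unfolding porder_def
proof (intro conjI reflpI transpI antisympI)
  assume rs: "reflp r \<and> transp r \<and> antisymp r" "reflp s \<and> transp s \<and> antisymp s"
  fix x y z
  show "join_le r s x x" using rs by (cases x) (auto dest: reflpD)
  show "join_le r s x z" if "join_le r s x y" "join_le r s y z"
    using rs that by (cases x; cases y; cases z) (auto dest: transpD)
  show "x = y" if "join_le r s x y" "join_le r s y x"
    using rs that by (cases x; cases y) (auto dest: antisympD)
qed

abbreviation level_le :: "('p \<Rightarrow> 'p \<Rightarrow> bool) \<Rightarrow> nat + nat \<times> 'p \<Rightarrow> nat + nat \<times> 'p \<Rightarrow> bool" where
  "level_le rp \<equiv> join_le (\<le>) (rel_prod (\<le>) rp)"

text \<open>
The combinatorial core of composing with a map of diagrams. The shape consists of the vertices of a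
simplex, below levels that are copies of a poset. If \<open>(b + 1, x)\<close> is the first vertex of a
chain on level \<open>b + 1\<close>, then \<open>(b, x)\<close> is comparable with the whole chain, and it lies strictly
between a vertex of the simplex and \<open>(b + 1, x)\<close>. Toggling it is a matching by inner vertices.
\<close>

lemma level_extension:
  fixes rp :: "'p \<Rightarrow> 'p \<Rightarrow> bool"
  defines "K \<equiv> level_le rp"
  assumes fills: "\<And>n k. 0 < k \<Longrightarrow> k < n \<Longrightarrow> fills C n k" and rp: "porder rp"
    and S: "down_closed S" and G: "G \<in> smap (chain_cx K S) C" and disj: "S \<inter> U = {}"
    and U: "finite U" "\<And>c. c \<in> U \<Longrightarrow> finite c \<and> is_chain K c"
    and ne: "\<And>c. c \<in> U \<Longrightarrow> \<exists>i. Inl i \<in> c" "\<And>c. c \<in> U \<Longrightarrow> \<exists>x. Inr (Suc b, x) \<in> c"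
    and tog: "\<And>c x. c \<in> U \<Longrightarrow> Inr (Suc b, x) \<in> c \<Longrightarrow> is_chain K (insert (Inr (b, x)) c) \<Longrightarrow>
      insert (Inr (b, x)) c \<in> U \<and> c - {Inr (b, x)} \<in> U"
    and faces: "\<And>c w. c \<in> U \<Longrightarrow> w \<in> c \<Longrightarrow> c - {w} \<in> S \<union> U"
  shows "\<exists>G'\<in>smap (chain_cx K (S \<union> U)) C. \<forall>m. \<forall>s\<in>cells (chain_cx K S) m. G' m s = G m s"
proof -
  have pK: "porder K" unfolding K_def by (intro porder_join porder_rel_prod porder_le rp)
  define L where "L = range (\<lambda>x :: 'p. Inr (Suc b, x) :: nat + nat \<times> 'p)"
  define \<nu> where "\<nu> z = (case z of Inl i \<Rightarrow> Inl i | Inr (l, x) \<Rightarrow> Inr (b, x))" for z :: "nat + nat \<times> 'p"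
  show ?thesis
  proof (rule shift_extension[OF pK _ S G disj U, where q = K and L = L and \<nu> = \<nu>])
    fix c assume c: "c \<in> U"
    show "c \<inter> L \<noteq> {}" using ne(2)[OF c] by (auto simp: L_def)
    {
      fix x assume x: "x \<in> c \<inter> L" and min: "\<forall>y\<in>c \<inter> L. K x y"
      obtain p where p: "x = Inr (Suc b, p)" using x by (auto simp: L_def)
      have cmp: "K y (Inr (b, p)) \<or> K (Inr (b, p)) y" if y: "y \<in> c" for y
      proof (cases y)
        case (Inr z)
        obtain l w where z: "z = (l, w)" by (cases z)
        have t: "K x y \<or> K y x" using U(2)[OF c] x y by (auto simp: is_chain_def)
        consider "l \<le> b" | "l = Suc b" | "l > Suc b" by linarith
        then show ?thesis
        proof cases
          case 2
          then have "K x y" using min y Inr z by (auto simp: L_def)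
          then show ?thesis using 2 Inr z p by (simp add: K_def)
        qed (use t Inr z p in \<open>auto simp: K_def\<close>)
      qed (simp add: K_def)
      have "is_chain K (insert (Inr (b, p)) c)"
        using U(2)[OF c] cmp porder_refl[OF pK] unfolding is_chain_def by (metis insert_iff)
      then show "insert (\<nu> x) c \<in> U \<and> c - {\<nu> x} \<in> U" using tog[OF c] x p by (simp add: \<nu>_def)
      assume v: "\<nu> x \<in> c"
      obtain i where i: "Inl i \<in> c" using ne(1)[OF c] by blast
      have "0 < rank K c (\<nu> x)" "rank K c (\<nu> x) < card c - 1"
        using x U(2)[OF c] p porder_refl[OF rp]
        by (intro inner_rank[OF _ v i _ _ _ _ _ pK, of x]; simp add: \<nu>_def K_def)+
      then show "fills C (card c - 1) (rank K c (\<nu> x))" by (rule fills)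
    }
    fix w assume "w \<in> c"
    then show "c - {w} \<in> S \<union> U" by (rule faces[OF c])
  next
    fix x y assume xy: "x \<in> L" "y \<in> L" "x \<noteq> y" "K x y"
    then show "\<not> K (\<nu> y) x \<and> \<not> K x (\<nu> y)"
      using porder_antisym[OF rp] by (auto simp: L_def \<nu>_def K_def)
  qed (auto simp: L_def \<nu>_def)
qed

lemma mem_square: "(a, b) \<in> square_shape \<longleftrightarrow> a \<le> 1 \<and> b \<le> 1"
  by (auto simp: square_shape_def)

lemma square_cases: "x \<in> square_shape \<longleftrightarrow> x = (0, 0) \<or> x \<in> cospan_shape" and cospan_nz: "(0, 0) \<notin> cospan_shape"
  by (auto simp: cospan_shape_def square_shape_def)

lemma prod_le_zero: "prod_le (0, 0) x" and prod_le_zero_iff: "prod_le x (0, 0) \<longleftrightarrow> x = (0, 0)"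
  by (cases x; simp)+

lemma finite_square: "finite square_shape"
  by (simp add: square_shape_def)

text \<open>
The square is the join of its initial vertex and the cospan; collapsing the point of the join to
that vertex gives the cone.
\<close>

lemma square_cone_cell:
  assumes q: "q \<in> smap (pnerve square_shape prod_le) C"
  shows "square_cone q \<in> cells (slice C cospan_shape prod_le (square_cospan q)) 0"
proof -
  let ?J = "join_le (\<le>) prod_le :: nat + nat \<times> nat \<Rightarrow> _"
  have e: "square_cone q = pull ?J (Pow ({..0} <+> cospan_shape)) (case_sum (\<lambda>_. (0, 0)) id) q"
    by (simp add: square_cone_def pull_def pnerve_cx)
  have "pull ?J (Pow ({..0} <+> cospan_shape)) (case_sum (\<lambda>_. (0, 0)) id) q
      \<in> smap (chain_cx ?J (Pow ({..0} <+> cospan_shape))) C"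
  proof (rule pull_smap[OF q[unfolded pnerve_cx] down_closed_Pow])
    fix c and x y :: "nat + nat \<times> nat" assume "?J x y"
    then show "prod_le (case_sum (\<lambda>_. (0, 0)) id x) (case_sum (\<lambda>_. (0, 0)) id y)"
      by (cases x; cases y) (auto simp: prod_le_zero)
  next
    fix c :: "(nat + nat \<times> nat) set" assume "c \<in> Pow ({..0} <+> cospan_shape)"
    then have "case_sum (\<lambda>_. (0, 0)) id x \<in> square_shape" if "x \<in> c" for x
      using that square_cases by (cases x) auto
    then show "case_sum (\<lambda>_. (0, 0)) id ` c \<in> Pow square_shape" by blast
  qed
  moreover have "square_cone q m (\<lambda>i\<in>{..m}. Inr (s i)) = square_cospan q m s"
    if s: "s \<in> cells (chain_cx prod_le (Pow cospan_shape)) m" for m s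
  proof -
    have "(\<lambda>i\<in>{..m}. Inr (s i) :: nat + nat \<times> nat) \<in> cells (chain_cx ?J (Pow ({..0} <+> cospan_shape))) m"
      by (rule map_cells[OF s]) auto
    moreover have "(\<lambda>i\<in>{..m}. case_sum (\<lambda>_. (0, 0)) id ((\<lambda>i\<in>{..m}. Inr (s i) :: nat + nat \<times> nat) i)) = s"
      using s by (intro restrict_eqI) (auto simp: mem_cx)
    ultimately show ?thesis using s by (simp add: e pull_def square_cospan_def pnerve_cx)
  qed
  ultimately show ?thesis by (simp add: cells_slice e)
qed

text \<open>
The diagram \<open>R\<close> has shape \<open>[2] \<times> [1] \<times> [1]\<close>. Its level \<open>1\<close> is the pullback square \<open>q'\<close>, and its
restriction to the levels \<open>0\<close> and \<open>2\<close> is degenerate, with both squares equal to \<open>q\<close>.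

Given \<open>g\<close> on \<open>\<partial>\<Delta>\<^sup>n \<star> P\<close>, with \<open>P\<close> the cospan and with last cone \<open>q\<close>, let \<open>V\<close> be the set of vertices
of \<open>\<Delta>\<^sup>n\<close> other than the last one. The last vertex, together with \<open>P\<close>, is a square, and the proof
replaces it by the three squares of \<open>R\<close>: all maps live on complexes of chains of \<open>V \<star> ([2] \<times> [1] \<times> [1])\<close>.
The vertices that correspond to the last one are the \<open>cones\<close> \<open>(l, (0, 0))\<close>.
\<close>

theorem pullback_retract:
  fixes R :: "nat \<Rightarrow> (nat \<Rightarrow> nat \<times> nat \<times> nat) \<Rightarrow> 'c"
  assumes fills: "\<And>n k. 0 < k \<Longrightarrow> k < n \<Longrightarrow> fills C n k"
    and R: "R \<in> smap (chain_cx (rel_prod (\<le>) prod_le) (Pow ({..2} \<times> square_shape))) C"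
    and q: "q \<in> smap (pnerve square_shape prod_le) C"
    and q': "is_pullback C q'"
    and Rq': "\<And>m s. s \<in> cells (pnerve square_shape prod_le) m \<Longrightarrow> R m (\<lambda>i\<in>{..m}. (1, s i)) = q' m s"
    and Rq: "\<And>m s. s \<in> cells (chain_cx (rel_prod (\<le>) prod_le) (Pow ({0, 2} \<times> square_shape))) m \<Longrightarrow>
      R m s = q m (\<lambda>i\<in>{..m}. snd (s i))"
  shows "is_pullback C q"
  unfolding is_pullback_def
proof (intro conjI q terminal_intro square_cone_cell)
  let ?P = cospan_shape
  let ?J = "join_le (\<le>) prod_le :: nat + nat \<times> nat \<Rightarrow> nat + nat \<times> nat \<Rightarrow> bool"
  let ?K = "level_le prod_le"
  fix n :: nat and g
  assume n: "n \<ge> 1" and g: "g \<in> smap (chain_cx ?J (cone_boundary n ?P)) C"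
    and gt: "\<And>m s. s \<in> cells (chain_cx ?J (Pow ({..0} <+> ?P))) m \<Longrightarrow>
      g m (\<lambda>i\<in>{..m}. map_sum (\<lambda>_. n) id (s i)) = square_cone q m s"
  have po: "porder prod_le" by (intro porder_rel_prod porder_le)
  define V :: "(nat + nat \<times> nat \<times> nat) set" where "V = Inl ` {..<n}"
  define B :: "nat set \<Rightarrow> (nat + nat \<times> nat \<times> nat) set" where "B A = Inr ` (A \<times> square_shape)" for A
  define cones :: "(nat + nat \<times> nat \<times> nat) set" where "cones = range (\<lambda>l. Inr (l, (0, 0)))"
  \<comment> \<open>\<open>\<pi>\<close> forgets the level and \<open>j l\<close> embeds \<open>[n] \<star> P\<close> at level \<open>l\<close>\<close>
  define \<pi> :: "nat + nat \<times> nat \<times> nat \<Rightarrow> nat + nat \<times> nat" where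
    "\<pi> z = (case z of Inl i \<Rightarrow> Inl i | Inr (l, x) \<Rightarrow> if x = (0, 0) then Inl n else Inr x)" for z
  define j :: "nat \<Rightarrow> nat + nat \<times> nat \<Rightarrow> nat + nat \<times> nat \<times> nat" where
    "j l z = (case z of Inl i \<Rightarrow> if i < n then Inl i else Inr (l, (0, 0)) | Inr x \<Rightarrow> Inr (l, x))" for l z
  define Z where "Z = V \<union> B {..2}"
  have [simp]: "\<pi> (Inl i) = Inl i" "\<pi> (Inr (l, x)) = (if x = (0, 0) then Inl n else Inr x)" for i l x
    by (simp_all add: \<pi>_def)
  have [simp]: "j l (Inl i) = (if i < n then Inl i else Inr (l, (0, 0)))" "j l (Inr x) = Inr (l, x)" for i l x
    by (simp_all add: j_def)
  have [simp]: "Inl i \<in> V \<longleftrightarrow> i < n" "Inr y \<notin> V" "Inl i \<notin> B A" "Inr (l, x) \<in> B A \<longleftrightarrow> l \<in> A \<and> x \<in> square_shape"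
      "Inl i \<notin> cones" "Inr (l, x) \<in> cones \<longleftrightarrow> x = (0, 0)" for i y A l x
    by (auto simp: V_def B_def cones_def)
  have projr_mem: "projr x \<in> A \<times> square_shape" if "x \<in> B A" for x A using that by (auto simp: B_def)
  have projr_mono: "rel_prod (\<le>) prod_le (projr x) (projr y)" if "x \<in> B A" "y \<in> B A" "?K x y" for x y A
    using that by (cases x; cases y) auto
  have finZ: "finite Z" by (simp add: Z_def V_def B_def finite_square)
  have BZ: "B A \<subseteq> Z" if "A \<subseteq> {..2}" for A using that by (auto simp: Z_def B_def)
  have VZ: "V \<subseteq> Z" by (simp add: Z_def)
  have Vne: "Inl 0 \<in> V" using n by simp

  have \<pi>_mono: "?J (\<pi> x) (\<pi> y)" if "x \<in> Z" "y \<in> Z" "?K x y" for x y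
    using that
    by (cases x; cases y) (auto simp: Z_def prod_le_zero_iff)
  have \<pi>_mem: "\<pi> x \<in> {..n} <+> ?P" if "x \<in> Z" for x
    using that square_cases by (cases x) (auto simp: Z_def)
  have j_mono: "?K (j l x) (j l y)" if "x \<in> {..n} <+> ?P" "y \<in> {..n} <+> ?P" "?J x y" for l x y
    using that by (cases x; cases y) (auto simp: prod_le_zero)
  have j_mem: "j l x \<in> V \<union> B {l}" if "x \<in> {..n} <+> ?P" for l x
    using that square_cases by (cases x) (auto simp: mem_square)
  have \<pi>j: "\<pi> (j l x) = x" if "x \<in> {..n} <+> ?P" for l x
    using that cospan_nz by (cases x) auto
  have j\<pi>: "j l (\<pi> x) = x" if "x \<in> V \<union> B {l}" for l x
    using that by (cases x) auto
  have \<pi>_boundary: "\<pi> ` c \<in> cone_boundary n ?P" if c: "c \<subseteq> Z" "\<not> V \<subseteq> c \<or> c \<inter> cones = {}" for c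
  proof -
    have "\<pi> ` c \<subseteq> {..n} <+> ?P" using \<pi>_mem c(1) by blast
    moreover have "\<exists>i\<le>n. Inl i \<notin> \<pi> ` c"
      using c(2)
    proof
      assume "\<not> V \<subseteq> c"
      then obtain i where i: "i < n" "Inl i \<notin> c" by (auto simp: V_def)
      then have "Inl i \<noteq> \<pi> x" if "x \<in> c" for x using that by (cases x) (auto split: if_splits)
      then show ?thesis using i(1) by (auto intro: less_imp_le)
    next
      assume "c \<inter> cones = {}"
      then have "Inl n \<noteq> \<pi> x" if "x \<in> c" for x
        using that c(1) by (cases x) (auto simp: Z_def split: if_splits)
      then show ?thesis by auto
    qed
    ultimately show ?thesis by (auto simp: cone_boundary_def subset_iff)
  qed
  have j_boundary: "j l ` c \<subseteq> V \<union> B {l} \<and> (\<not> V \<subseteq> j l ` c \<or> j l ` c \<inter> cones = {})"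
    if c: "c \<in> cone_boundary n ?P" for c l
  proof -
    have sub: "c \<subseteq> {..n} <+> ?P" and "\<exists>i\<le>n. Inl i \<notin> c" using c by (auto simp: cone_boundary_def)
    then obtain i where i: "i \<le> n" "Inl i \<notin> c" by blast
    have "\<not> V \<subseteq> j l ` c \<or> j l ` c \<inter> cones = {}"
    proof (cases "i < n")
      case True
      have "j l x \<noteq> Inl i" if "x \<in> c" for x using that i by (cases x) (auto split: if_splits)
      then have "Inl i \<notin> j l ` c" by (metis imageE)
      then show ?thesis using True by (auto simp: V_def)
    next
      case False
      have "j l x \<notin> cones" if "x \<in> c" for x
      proof (cases x)
        case (Inl k)
        then have "k \<le> n" "k \<noteq> i" using that i sub by auto
        then show ?thesis using Inl False i by auto
      next
        case (Inr y)
        then have "y \<in> ?P" using that sub by auto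
        then show ?thesis using Inr cospan_nz by auto
      qed
      then show ?thesis by auto
    qed
    then show ?thesis using j_mem sub by blast
  qed

  \<comment> \<open>the initial data: \<open>R\<close>, and \<open>g\<close> on the levels \<open>0\<close> and \<open>2\<close>, degenerate in the direction of the levels\<close>
  let ?W = "B {..2}"
  define S0 where "S0 = {c. c \<subseteq> V \<union> B {0, 2} \<and> (\<not> V \<subseteq> c \<or> c \<inter> cones = {})}"
  have dS0: "down_closed S0" unfolding down_closed_def S0_def by blast
  have BZ02: "V \<union> B {0, 2} \<subseteq> Z" using BZ[of "{0, 2}"] VZ by auto
  have WZ: "?W \<subseteq> Z" by (simp add: Z_def)
  have Rhat: "pull ?K (Pow ?W) projr R \<in> smap (chain_cx ?K (Pow ?W)) C"
  proof (rule pull_smap[OF R down_closed_Pow])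
    fix c assume c: "c \<in> Pow ?W"
    then show "projr ` c \<in> Pow ({..2} \<times> square_shape)" using projr_mem by blast
    show "rel_prod (\<le>) prod_le (projr x) (projr y)" if "x \<in> c" "y \<in> c" "?K x y" for x y
      using that c by (intro projr_mono[of _ "{..2}"]) auto
  qed
  have ghat: "pull ?K S0 \<pi> g \<in> smap (chain_cx ?K S0) C"
  proof (rule pull_smap[OF g dS0])
    fix c assume c: "c \<in> S0"
    then have cZ: "c \<subseteq> Z" using BZ02 unfolding S0_def by blast
    show "?J (\<pi> x) (\<pi> y)" if "x \<in> c" "y \<in> c" "?K x y" for x y
      using that cZ by (intro \<pi>_mono) auto
    show "\<pi> ` c \<in> cone_boundary n ?P" using c cZ by (intro \<pi>_boundary) (auto simp: S0_def)
  qed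
  have overlap: "pull ?K (Pow ?W) projr R m s = pull ?K S0 \<pi> g m s"
    if sW: "s \<in> cells (chain_cx ?K (Pow ?W)) m" and s0: "s \<in> cells (chain_cx ?K S0) m" for m s
  proof -
    have mem: "s i \<in> B {0, 2}" if "i \<le> m" for i
    proof -
      have "s i \<in> ?W" "s i \<in> V \<union> B {0, 2}" using sW s0 that by (auto simp: mem_cx S0_def)
      then show ?thesis by (cases "s i") auto
    qed
    have cB: "s \<in> cells (chain_cx ?K (Pow (B {0, 2}))) m" using sW mem by (auto simp: mem_cx)
    have pr: "(\<lambda>i\<in>{..m}. projr (s i)) \<in> cells (chain_cx (rel_prod (\<le>) prod_le) (Pow ({0, 2} \<times> square_shape))) m"
    proof (rule map_cells[OF cB])
      fix c assume c: "c \<in> Pow (B {0, 2})"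
      then show "projr ` c \<in> Pow ({0, 2} \<times> square_shape)" using projr_mem by blast
      show "rel_prod (\<le>) prod_le (projr x) (projr y)" if "x \<in> c" "y \<in> c" "?K x y" for x y
        using that c by (intro projr_mono[of _ "{0, 2}"]) auto
    qed
    define u where "u = (\<lambda>i\<in>{..m}. if snd (projr (s i)) = (0, 0) then Inl (0 :: nat) else Inr (snd (projr (s i))) :: nat + nat \<times> nat)"
    have u: "u \<in> cells (chain_cx ?J (Pow ({..0} <+> ?P))) m"
      unfolding u_def
    proof (rule map_cells[OF cB])
      fix c x y assume "c \<in> Pow (B {0, 2})" "x \<in> c" "y \<in> c" "?K x y"
      then have "x \<in> B {0, 2}" "y \<in> B {0, 2}" "?K x y" by auto
      then show "?J (if snd (projr x) = (0, 0) then Inl (0 :: nat) else Inr (snd (projr x)))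
          (if snd (projr y) = (0, 0) then Inl (0 :: nat) else Inr (snd (projr y)))"
        unfolding B_def by (auto simp: prod_le_zero_iff)
    next
      fix c assume c: "c \<in> Pow (B {0, 2})"
      have "(if snd (projr x) = (0, 0) then Inl (0 :: nat) else Inr (snd (projr x))) \<in> {..0} <+> ?P" if "x \<in> c" for x
      proof -
        have "x \<in> B {0, 2}" using c that by blast
        then show ?thesis using square_cases unfolding B_def by auto
      qed
      then show "(\<lambda>x. if snd (projr x) = (0, 0) then Inl (0 :: nat) else Inr (snd (projr x))) ` c \<in> Pow ({..0} <+> ?P)"
        by blast
    qed
    have 1: "(\<lambda>i\<in>{..m}. map_sum (\<lambda>_. n) id (u i)) = (\<lambda>i\<in>{..m}. \<pi> (s i))"
    proof (rule restrict_ext)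
      fix i assume "i \<in> {..m}"
      then show "map_sum (\<lambda>_. n) id (u i) = \<pi> (s i)" using mem[of i] by (auto simp: u_def B_def)
    qed
    have 2: "(\<lambda>i\<in>{..m}. case_sum (\<lambda>_. (0, 0)) id (u i)) = (\<lambda>i\<in>{..m}. snd ((\<lambda>i\<in>{..m}. projr (s i)) i))"
      by (rule restrict_ext) (auto simp: u_def)
    show ?thesis
      using Rq[OF pr] gt[OF u] sW s0 u unfolding 1 by (simp add: pull_def square_cone_def pnerve_cx 2)
  qed
  obtain G0 where G0: "G0 \<in> smap (chain_cx ?K (Pow ?W \<union> S0)) C"
    and G0R: "\<And>m s. s \<in> cells (chain_cx ?K (Pow ?W)) m \<Longrightarrow> G0 m s = R m (\<lambda>i\<in>{..m}. projr (s i))"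
    and G0g: "\<And>m s. s \<in> cells (chain_cx ?K S0) m \<Longrightarrow> G0 m s = g m (\<lambda>i\<in>{..m}. \<pi> (s i))"
    using glue_smap[OF Rhat down_closed_Pow ghat dS0 overlap] by (auto simp: pull_def)

  \<comment> \<open>composing the given cones with \<open>q \<rightarrow> q'\<close>: chains that meet \<open>V\<close> and level \<open>1\<close>\<close>
  define U1 where "U1 = {c. c \<subseteq> Z \<and> is_chain ?K c \<and> (\<exists>i. Inl i \<in> c) \<and> (\<exists>x. Inr (Suc 0, x) \<in> c) \<and>
    (\<not> V \<subseteq> c \<or> c \<inter> cones = {})}"
  define S1 where "S1 = {c. c \<subseteq> Z \<and> (c \<subseteq> ?W \<or> \<not> V \<subseteq> c \<or> c \<inter> cones = {})}"
  have dS1: "down_closed S1" unfolding down_closed_def S1_def by blast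
  \<comment> \<open>chains without vertices on level \<open>1\<close> are covered by the initial data\<close>
  have cover1: "c \<in> Pow ?W \<union> S0 \<union> U1" if c: "c \<in> S1" "is_chain ?K c" for c
  proof (cases "c \<subseteq> ?W")
    case False
    then obtain x where "x \<in> c" "x \<notin> ?W" by blast
    then have i: "\<exists>i. Inl i \<in> c" using c(1) unfolding S1_def Z_def V_def by auto
    have d: "\<not> V \<subseteq> c \<or> c \<inter> cones = {}" "c \<subseteq> Z" using c(1) False unfolding S1_def by blast+
    show ?thesis
    proof (cases "\<exists>x. Inr (Suc 0, x) \<in> c")
      case True
      then show ?thesis using i d c(2) unfolding U1_def by blast
    next
      case no: False
      have "c \<subseteq> V \<union> B {0, 2}"
      proof
        fix y assume y: "y \<in> c"
        then have yZ: "y \<in> Z" using d by blast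
        show "y \<in> V \<union> B {0, 2}"
        proof (cases y)
          case (Inr z)
          obtain l w where z: "z = (l, w)" by (cases z)
          have "l \<noteq> 1" using no y Inr z by (metis One_nat_def)
          moreover have "l \<le> 2" using yZ Inr z by (auto simp: Z_def)
          ultimately have "l = 0 \<or> l = 2" by linarith
          then show ?thesis using yZ Inr z by (auto simp: Z_def)
        qed (use yZ in \<open>auto simp: Z_def\<close>)
      qed
      then show ?thesis using d unfolding S0_def by blast
    qed
  qed auto
  have "\<exists>G'\<in>smap (chain_cx ?K (Pow ?W \<union> S0 \<union> U1)) C. \<forall>m. \<forall>s\<in>cells (chain_cx ?K (Pow ?W \<union> S0)) m. G' m s = G0 m s"
  proof (rule level_extension[where b = 0, OF fills po _ G0])
    show "down_closed (Pow ?W \<union> S0)" using dS0 down_closed_Pow[of ?W] unfolding down_closed_def by blast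
    have "U1 \<subseteq> Pow Z" unfolding U1_def by blast
    then show "finite U1" by (rule finite_subset) (simp add: finZ)
    have "c \<notin> Pow ?W \<union> S0" if "c \<in> U1" for c
    proof -
      obtain i x where "Inl i \<in> c" "Inr (Suc 0, x) \<in> c" using \<open>c \<in> U1\<close> unfolding U1_def by blast
      moreover have "Inl i \<notin> ?W" "Inr (Suc 0, x) \<notin> V \<union> B {0, 2}" by auto
      ultimately show ?thesis unfolding S0_def by blast
    qed
    then show "(Pow ?W \<union> S0) \<inter> U1 = {}" by blast
    fix c assume c: "c \<in> U1"
    then have cZ: "c \<subseteq> Z" and ct: "is_chain ?K c" and ci: "\<exists>i. Inl i \<in> c" and cl: "\<exists>x. Inr (Suc 0, x) \<in> c"
      and cd: "\<not> V \<subseteq> c \<or> c \<inter> cones = {}" unfolding U1_def by auto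
    show "finite c \<and> is_chain ?K c" using ct finite_subset[OF cZ finZ] by simp
    show "\<exists>i. Inl i \<in> c" "\<exists>x. Inr (Suc 0, x) \<in> c" by fact+
    show "insert (Inr (0, x)) c \<in> U1 \<and> c - {Inr (0, x)} \<in> U1"
      if x: "Inr (Suc 0, x) \<in> c" and t: "is_chain ?K (insert (Inr (0, x)) c)" for x
    proof
      have "x \<in> square_shape" using x cZ by (auto simp: Z_def)
      then have "Inr (0, x) \<in> Z" by (simp add: Z_def)
      moreover have "\<not> V \<subseteq> insert (Inr (0, x)) c \<or> insert (Inr (0, x)) c \<inter> cones = {}"
        using cd
      proof
        assume "c \<inter> cones = {}"
        then have "x \<noteq> (0, 0)" using x by auto
        then show ?thesis using \<open>c \<inter> cones = {}\<close> by auto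
      next
        assume "\<not> V \<subseteq> c"
        then obtain i where "i < n" "Inl i \<notin> c" by (auto simp: V_def)
        then show ?thesis by (auto simp: V_def subset_iff)
      qed
      ultimately show "insert (Inr (0, x)) c \<in> U1" using cZ t ci cl unfolding U1_def by blast
      have "is_chain ?K (c - {Inr (0, x)})" using ct unfolding is_chain_def by blast
      moreover obtain i where "Inl i \<in> c - {Inr (0, x)}" using ci by auto
      moreover have "Inr (Suc 0, x) \<in> c - {Inr (0, x)}" using x by simp
      ultimately show "c - {Inr (0, x)} \<in> U1" using cZ cd unfolding U1_def by blast
    qed
    fix w assume "w \<in> c"
    have "is_chain ?K (c - {w})" using ct unfolding is_chain_def by blast
    moreover have "c - {w} \<in> S1" using cZ cd unfolding S1_def by blast
    ultimately show "c - {w} \<in> Pow ?W \<union> S0 \<union> U1" by (intro cover1)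
  qed
  moreover have "chain_cx ?K (Pow ?W \<union> S0 \<union> U1) = chain_cx ?K S1"
  proof (rule smap_cx_cong)
    fix c :: "(nat + nat \<times> nat \<times> nat) set" assume "\<And>x y. x \<in> c \<Longrightarrow> y \<in> c \<Longrightarrow> ?K x y \<or> ?K y x"
    then have "is_chain ?K c" by (simp add: is_chain_def)
    moreover have "c \<in> S1" if "c \<in> Pow ?W \<union> S0 \<union> U1"
      using that WZ BZ02 unfolding S1_def S0_def U1_def by blast
    ultimately show "c \<in> Pow ?W \<union> S0 \<union> U1 \<longleftrightarrow> c \<in> S1" using cover1 by blast
  qed
  ultimately obtain G1 where G1: "G1 \<in> smap (chain_cx ?K S1) C"
    and G10: "\<And>m s. s \<in> cells (chain_cx ?K (Pow ?W \<union> S0)) m \<Longrightarrow> G1 m s = G0 m s" by auto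
  have G1R: "G1 m s = R m (\<lambda>i\<in>{..m}. projr (s i))" if "s \<in> cells (chain_cx ?K (Pow ?W)) m" for m s
    using G10[OF cx_mono[OF that Un_upper1]] G0R[OF that] by simp
  have G1g: "G1 m s = g m (\<lambda>i\<in>{..m}. \<pi> (s i))" if "s \<in> cells (chain_cx ?K S0) m" for m s
    using G10[OF cx_mono[OF that Un_upper2]] G0g[OF that] by simp

  \<comment> \<open>on level \<open>1\<close> there is now a boundary of cones with last cone \<open>q'\<close>, which is terminal\<close>
  have cb_mono: "?K (j l x) (j l y)" if "c \<in> cone_boundary n ?P" "x \<in> c" "y \<in> c" "?J x y" for c x y l
    using that by (intro j_mono) (auto simp: cone_boundary_def)
  have j1_boundary: "j 1 ` c \<in> S1" if "c \<in> cone_boundary n ?P" for c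
    using j_boundary[OF that, of 1] BZ[of "{1}"] VZ unfolding S1_def by auto
  define g1 where "g1 = pull ?J (cone_boundary n ?P) (j 1) G1"
  have j1_cells: "(\<lambda>i\<in>{..m}. j 1 (s i)) \<in> cells (chain_cx ?K S1) m" if "s \<in> cells (chain_cx ?J (cone_boundary n ?P)) m" for m s
    by (rule map_cells[OF that], erule (3) cb_mono, erule j1_boundary)
  have g1: "g1 \<in> smap (chain_cx ?J (cone_boundary n ?P)) C"
    unfolding g1_def
    by (rule pull_smap[OF G1 down_closed_cone_boundary], erule (3) cb_mono, erule j1_boundary)
  have g1R: "g1 m s = q' m u"
    if s: "s \<in> cells (chain_cx ?J (cone_boundary n ?P)) m" and u: "u \<in> cells (pnerve square_shape prod_le) m"
      and su: "\<And>i. i \<le> m \<Longrightarrow> j 1 (s i) = Inr (1, u i)" for m s u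
  proof -
    have e: "(\<lambda>i\<in>{..m}. j 1 (s i)) = (\<lambda>i\<in>{..m}. Inr (1, u i))" 
      using su by (intro restrict_ext) simp
    let ?v = "\<lambda>i\<in>{..m}. Inr (1, u i) :: nat + nat \<times> nat \<times> nat"
    have v: "?v \<in> cells (chain_cx ?K (Pow ?W)) m"
      using j1_cells[OF s] u unfolding e by (auto simp: mem_cx pnerve_cx)
    have "g1 m s = G1 m (\<lambda>i\<in>{..m}. j 1 (s i))" using s by (simp add: g1_def pull_def)
    moreover have "G1 m ?v = R m (\<lambda>i\<in>{..m}. projr (?v i))" by (rule G1R[OF v])
    moreover have "(\<lambda>i\<in>{..m}. projr (?v i)) = (\<lambda>i\<in>{..m}. (1, u i))" by (rule restrict_ext) simp
    ultimately show ?thesis using Rq'[OF u] e by (simp only:)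
  qed
  have "\<exists>F\<in>smap (chain_cx ?J (Pow ({..n} <+> ?P))) C. \<forall>m. \<forall>s\<in>cells (chain_cx ?J (cone_boundary n ?P)) m. F m s = g1 m s"
  proof (rule terminal_extension[OF _ n g1])
    show "is_terminal (slice C ?P prod_le (square_cospan q')) (square_cone q')"
      using q' by (simp add: is_pullback_def)
  next
    fix m s assume s: "s \<in> cells (chain_cx prod_le (Pow ?P)) m"
    let ?u = "\<lambda>i\<in>{..m}. Inr (s i) :: nat + nat \<times> nat"
    have "?u \<in> cells (chain_cx ?J (cone_boundary n ?P)) m"
      by (rule map_cells[OF s]) (auto simp: cone_boundary_def)
    moreover have "s \<in> cells (pnerve square_shape prod_le) m"
      unfolding pnerve_cx by (rule cx_mono[OF s]) (auto simp: cospan_shape_def)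
    ultimately have "g1 m ?u = q' m s" by (rule g1R) simp
    then show "g1 m ?u = square_cospan q' m s" using s by (simp add: square_cospan_def pnerve_cx)
  next
    fix m s assume s: "s \<in> cells (chain_cx ?J (Pow ({..0} <+> ?P))) m"
    let ?u = "\<lambda>i\<in>{..m}. map_sum (\<lambda>_. n) id (s i)"
    let ?w = "\<lambda>i\<in>{..m}. case_sum (\<lambda>_. (0, 0)) id (s i)"
    have si: "s i \<in> {..0} <+> ?P" if "i \<le> m" for i using s that by (auto simp: mem_cx)
    have mono: "?J (s i) (s k)" if "i \<le> k" "k \<le> m" for i k using s that by (simp add: mem_cx)
    have uw: "?J (?u i) (?u k)" "prod_le (?w i) (?w k)" if "i \<le> k" "k \<le> m" for i k
      using mono[OF that] that by (cases "s i"; cases "s k"; auto simp: prod_le_zero)+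
    have pts: "?u i \<in> {..n} <+> ?P" "?u i \<noteq> Inl 0" "?w i \<in> square_shape" "j 1 (?u i) = Inr (1, ?w i)"
      if "i \<le> m" for i
      using si[OF that] that n square_cases by auto
    have "Inl 0 \<notin> ?u ` {..m}" using pts(2) by force
    then have "\<not> {..n} \<subseteq> Inl -` (?u ` {..m})" by blast
    moreover have "?u ` {..m} \<subseteq> {..n} <+> ?P" using pts(1) by blast
    ultimately have "?u ` {..m} \<in> cone_boundary n ?P" unfolding cone_boundary_def by blast
    then have u: "?u \<in> cells (chain_cx ?J (cone_boundary n ?P)) m"
      using uw(1) unfolding mem_cx by (intro conjI allI impI restrict_extensional) auto
    have "?w ` {..m} \<in> Pow square_shape" using pts(3) by blast
    then have w: "?w \<in> cells (pnerve square_shape prod_le) m"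
      using uw(2) unfolding mem_cx pnerve_cx by (intro conjI allI impI restrict_extensional) auto
    have "g1 m ?u = q' m ?w" by (rule g1R[OF u w pts(4)])
    then show "g1 m ?u = square_cone q' m s" using s by (simp add: square_cone_def pnerve_cx)
  qed
  then obtain F1 where F1: "F1 \<in> smap (chain_cx ?J (Pow ({..n} <+> ?P))) C"
    and F1g1: "\<And>m s. s \<in> cells (chain_cx ?J (cone_boundary n ?P)) m \<Longrightarrow> F1 m s = g1 m s" by blast
  have VB1: "V \<union> B {1} \<subseteq> Z" using BZ[of "{1}"] VZ by auto
  have Fhat: "pull ?K (Pow (V \<union> B {1})) \<pi> F1 \<in> smap (chain_cx ?K (Pow (V \<union> B {1}))) C"
  proof (rule pull_smap[OF F1 down_closed_Pow])
    fix c assume c: "c \<in> Pow (V \<union> B {1})"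
    show "?J (\<pi> x) (\<pi> y)" if "x \<in> c" "y \<in> c" "?K x y" for x y
      using that c VB1 by (intro \<pi>_mono) auto
    show "\<pi> ` c \<in> Pow ({..n} <+> ?P)" using c VB1 \<pi>_mem by blast
  qed
  have "\<exists>G2\<in>smap (chain_cx ?K (S1 \<union> Pow (V \<union> B {1}))) C. (\<forall>m. \<forall>s\<in>cells (chain_cx ?K S1) m. G2 m s = G1 m s) \<and>
      (\<forall>m. \<forall>s\<in>cells (chain_cx ?K (Pow (V \<union> B {1}))) m. G2 m s = pull ?K (Pow (V \<union> B {1})) \<pi> F1 m s)"
  proof (rule glue_smap[OF G1 dS1 Fhat down_closed_Pow])
    fix m s assume s1: "s \<in> cells (chain_cx ?K S1) m" and sB: "s \<in> cells (chain_cx ?K (Pow (V \<union> B {1}))) m"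
    let ?u = "\<lambda>i\<in>{..m}. \<pi> (s i)"
    have c1: "s ` {..m} \<in> S1" and cB: "s ` {..m} \<subseteq> V \<union> B {1}" using s1 sB by (auto simp: mem_cx)
    have im: "?u ` {..m} = \<pi> ` (s ` {..m})" by auto
    have "\<not> V \<subseteq> s ` {..m} \<or> s ` {..m} \<inter> cones = {}"
    proof -
      have "\<not> V \<subseteq> s ` {..m}" if sub: "s ` {..m} \<subseteq> ?W"
      proof
        assume "V \<subseteq> s ` {..m}"
        then have "Inl 0 \<in> ?W" using Vne sub by blast
        then show False by simp
      qed
      then show ?thesis using c1 unfolding S1_def by blast
    qed
    then have "\<pi> ` (s ` {..m}) \<in> cone_boundary n ?P" using cB VB1 by (intro \<pi>_boundary) auto
    moreover have "?J (\<pi> (s i)) (\<pi> (s k))" if "i \<le> k" "k \<le> m" for i k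
    proof (rule \<pi>_mono)
      have "s i \<in> s ` {..m}" "s k \<in> s ` {..m}" using that by auto
      then show "s i \<in> Z" "s k \<in> Z" using cB VB1 by blast+
      show "?K (s i) (s k)" using sB that by (simp add: mem_cx)
    qed
    ultimately have u: "?u \<in> cells (chain_cx ?J (cone_boundary n ?P)) m" unfolding mem_cx im by auto
    have "(\<lambda>i\<in>{..m}. j 1 (?u i)) = s"
      using s1 cB j\<pi> by (intro restrict_eqI) (auto simp: mem_cx image_subset_iff)
    then show "G1 m s = pull ?K (Pow (V \<union> B {1})) \<pi> F1 m s"
      using sB F1g1[OF u] u by (simp add: pull_def g1_def)
  qed
  then obtain G2 where G2: "G2 \<in> smap (chain_cx ?K (S1 \<union> Pow (V \<union> B {1}))) C"
    and G21: "\<And>m s. s \<in> cells (chain_cx ?K S1) m \<Longrightarrow> G2 m s = G1 m s" by blast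

  let ?S2 = "S1 \<union> Pow (V \<union> B {1})"
  \<comment> \<open>composing the new cone with \<open>q' \<rightarrow> q\<close>: the chains on the levels \<open>1\<close> and \<open>2\<close> excluded so far\<close>
  define U2 where "U2 = {c. c \<subseteq> V \<union> B {1, 2} \<and> is_chain ?K c \<and> V \<subseteq> c \<and> c \<inter> cones \<noteq> {} \<and> (\<exists>x. Inr (Suc 1, x) \<in> c)}"
  have VB12: "V \<union> B {1, 2} \<subseteq> Z" using BZ[of "{1, 2}"] VZ by auto
  have cover2: "c \<in> ?S2 \<union> U2" if c: "c \<subseteq> V \<union> B {1, 2}" "is_chain ?K c" for c
  proof (cases "V \<subseteq> c \<and> c \<inter> cones \<noteq> {}")
    case True
    show ?thesis
    proof (cases "\<exists>x. Inr (Suc 1, x) \<in> c")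
      case yes: True
      then show ?thesis using True c unfolding U2_def by blast
    next
      case no: False
      have "c \<subseteq> V \<union> B {1}"
      proof
        fix y assume y: "y \<in> c"
        then have "y \<in> V \<union> B {1, 2}" using c(1) by blast
        show "y \<in> V \<union> B {1}"
        proof (cases y)
          case (Inr z)
          obtain l w where z: "z = (l, w)" by (cases z)
          have "l \<noteq> 2" using no y Inr z by (metis Suc_1)
          then show ?thesis using \<open>y \<in> V \<union> B {1, 2}\<close> Inr z by auto
        qed (use \<open>y \<in> V \<union> B {1, 2}\<close> in auto)
      qed
      then show ?thesis by blast
    qed
  next
    case False
    then show ?thesis using c(1) VB12 unfolding S1_def by blast
  qed
  have "\<exists>G3\<in>smap (chain_cx ?K (?S2 \<union> U2)) C. \<forall>m. \<forall>s\<in>cells (chain_cx ?K ?S2) m. G3 m s = G2 m s"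
  proof (rule level_extension[where b = 1, OF fills po _ G2])
    show "down_closed ?S2" using dS1 down_closed_Pow[of "V \<union> B {1}"] unfolding down_closed_def by blast
    have "U2 \<subseteq> Pow Z" using VB12 unfolding U2_def by blast
    then show "finite U2" by (rule finite_subset) (simp add: finZ)
    have "c \<notin> ?S2" if "c \<in> U2" for c
    proof -
      obtain x where "V \<subseteq> c" "c \<inter> cones \<noteq> {}" "Inr (Suc 1, x) \<in> c" using \<open>c \<in> U2\<close> unfolding U2_def by blast
      moreover have "Inl 0 \<in> c" using \<open>V \<subseteq> c\<close> Vne by blast
      moreover have "Inl 0 \<notin> ?W" "Inr (Suc 1, x) \<notin> V \<union> B {1}" by auto
      ultimately show ?thesis unfolding S1_def by blast
    qed
    then show "?S2 \<inter> U2 = {}" by blast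
    fix c assume c: "c \<in> U2"
    then have cZ: "c \<subseteq> V \<union> B {1, 2}" and ct: "is_chain ?K c" and cV: "V \<subseteq> c" and cc: "c \<inter> cones \<noteq> {}"
      and cl: "\<exists>x. Inr (Suc 1, x) \<in> c" unfolding U2_def by auto
    show "finite c \<and> is_chain ?K c" using ct finite_subset[OF _ finZ] cZ VB12 by blast
    show "\<exists>i. Inl i \<in> c" using cV Vne by blast
    show "\<exists>x. Inr (Suc 1, x) \<in> c" by fact
    show "insert (Inr (1, x)) c \<in> U2 \<and> c - {Inr (1, x)} \<in> U2"
      if x: "Inr (Suc 1, x) \<in> c" and t: "is_chain ?K (insert (Inr (1, x)) c)" for x
    proof
      have "x \<in> square_shape" using x cZ by auto
      then have "Inr (1, x) \<in> V \<union> B {1, 2}" by simp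
      then show "insert (Inr (1, x)) c \<in> U2" using cZ t cV cc cl unfolding U2_def by blast
      have "is_chain ?K (c - {Inr (1, x)})" using ct unfolding is_chain_def by blast
      moreover have "V \<subseteq> c - {Inr (1, x)}" using cV by auto
      moreover have "(c - {Inr (1, x)}) \<inter> cones \<noteq> {}"
      proof -
        obtain l where l: "Inr (l, (0, 0)) \<in> c" using cc unfolding cones_def by auto
        show ?thesis
        proof (cases "Inr (l, (0, 0)) = (Inr (1, x) :: nat + nat \<times> nat \<times> nat)")
          case True
          then have "Inr (Suc 1, (0, 0)) \<in> (c - {Inr (1, x)}) \<inter> cones" using x by auto
          then show ?thesis by blast
        next
          case False
          then have "Inr (l, (0, 0)) \<in> (c - {Inr (1, x)}) \<inter> cones" using l by auto
          then show ?thesis by blast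
        qed
      qed
      moreover have "Inr (Suc 1, x) \<in> c - {Inr (1, x)}" using x by simp
      ultimately show "c - {Inr (1, x)} \<in> U2" using cZ unfolding U2_def by blast
    qed
    fix w assume "w \<in> c"
    have "is_chain ?K (c - {w})" using ct unfolding is_chain_def by blast
    then show "c - {w} \<in> ?S2 \<union> U2" using cZ by (intro cover2) auto
  qed
  then obtain G3 where "G3 \<in> smap (chain_cx ?K (?S2 \<union> U2)) C"
    and G32: "\<And>m s. s \<in> cells (chain_cx ?K ?S2) m \<Longrightarrow> G3 m s = G2 m s" by blast
  moreover have "chain_cx ?K (?S2 \<union> U2) = chain_cx ?K (?S2 \<union> U2 \<union> Pow (V \<union> B {2}))"
  proof (rule smap_cx_cong)
    fix c :: "(nat + nat \<times> nat \<times> nat) set" assume "\<And>x y. x \<in> c \<Longrightarrow> y \<in> c \<Longrightarrow> ?K x y \<or> ?K y x"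
    then have t: "is_chain ?K c" by (simp add: is_chain_def)
    have "B {2} \<subseteq> B {1, 2}" by (auto simp: B_def)
    then have "c \<in> ?S2 \<union> U2" if "c \<in> Pow (V \<union> B {2})" using cover2[OF _ t] that by blast
    then show "c \<in> ?S2 \<union> U2 \<longleftrightarrow> c \<in> ?S2 \<union> U2 \<union> Pow (V \<union> B {2})" by blast
  qed
  ultimately have G3: "G3 \<in> smap (chain_cx ?K (?S2 \<union> U2 \<union> Pow (V \<union> B {2}))) C" by simp
  have "pull ?J (Pow ({..n} <+> ?P)) (j 2) G3 \<in> smap (chain_cx ?J (Pow ({..n} <+> ?P))) C"
  proof (rule pull_smap[OF G3 down_closed_Pow])
    fix c assume c: "c \<in> Pow ({..n} <+> ?P)"
    show "?K (j 2 x) (j 2 y)" if "x \<in> c" "y \<in> c" "?J x y" for x y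
      using that c by (intro j_mono) auto
    show "j 2 ` c \<in> ?S2 \<union> U2 \<union> Pow (V \<union> B {2})" using c j_mem[of _ 2] by blast
  qed
  moreover have "pull ?J (Pow ({..n} <+> ?P)) (j 2) G3 m s = g m s"
    if s: "s \<in> cells (chain_cx ?J (cone_boundary n ?P)) m" for m s
  proof -
    let ?u = "\<lambda>i\<in>{..m}. j 2 (s i)"
    have sP: "s \<in> cells (chain_cx ?J (Pow ({..n} <+> ?P))) m"
      by (rule cx_mono[OF s]) (auto simp: cone_boundary_def)
    have j2_S0: "j 2 ` c \<in> S0" if "c \<in> cone_boundary n ?P" for c
    proof -
      have "B {2} \<subseteq> B {0, 2}" by (auto simp: B_def)
      then show ?thesis using j_boundary[OF that, of 2] unfolding S0_def by blast
    qed
    have u: "?u \<in> cells (chain_cx ?K S0) m"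
      by (rule map_cells[OF s], erule (3) cb_mono, erule j2_S0)
    have u1: "?u \<in> cells (chain_cx ?K S1) m"
      by (rule cx_mono[OF u]) (use BZ02 in \<open>auto simp: S0_def S1_def\<close>)
    have u2: "?u \<in> cells (chain_cx ?K ?S2) m" by (rule cx_mono[OF u1]) blast
    have "(\<lambda>i\<in>{..m}. \<pi> (?u i)) = s"
      using sP \<pi>j by (intro restrict_eqI) (auto simp: mem_cx image_subset_iff)
    then show ?thesis using G32[OF u2] G21[OF u1] G1g[OF u] sP by (simp add: pull_def)
  qed
  ultimately show "\<exists>G\<in>smap (chain_cx ?J (Pow ({..n} <+> ?P))) C. \<forall>m. \<forall>s\<in>cells (chain_cx ?J (cone_boundary n ?P)) m. G m s = g m s"
    by blast
qed

section \<open>Diagrams in the opposite of the simplex category\<close>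

lemma mem_Delta_op:
  "(a, \<phi>) \<in> cells Delta_op m \<longleftrightarrow>
     a \<in> extensional {..m} \<and> \<phi> \<in> extensional (tri m) \<and>
     (\<forall>i j. i \<le> j \<and> j \<le> m \<longrightarrow> \<phi> (i, j) \<in> Delta (a j) (a i)) \<and>
     (\<forall>i\<le>m. \<phi> (i, i) = Delta_id (a i)) \<and>
     (\<forall>i j k. i \<le> j \<and> j \<le> k \<and> k \<le> m \<longrightarrow> \<phi> (i, k) = (\<lambda>x\<in>{..a k}. \<phi> (i, j) (\<phi> (j, k) x)))"
  by (auto simp: Delta_op_def nerve_def opp_def simplex_cat_def PiE_def Pi_def tri_def compose_def)

lemma act_Delta_op: "act Delta_op m n \<theta> (a, \<phi>) = (\<lambda>i\<in>{..m}. a (\<theta> i), \<lambda>(i, j)\<in>tri m. \<phi> (\<theta> i, \<theta> j))"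
  by (simp add: Delta_op_def nerve_def compose_def)

text \<open>
The cell of the nerve given by a chain \<open>s\<close> and a functor from a poset to the opposite of the simplex
category, with values \<open>ob x\<close> on objects and \<open>M x y : [ob y] \<rightarrow> [ob x]\<close> on the relation \<open>x \<le> y\<close>.
\<close>

definition diagram :: "('e \<Rightarrow> nat) \<Rightarrow> ('e \<Rightarrow> 'e \<Rightarrow> nat \<Rightarrow> nat) \<Rightarrow> nat \<Rightarrow> (nat \<Rightarrow> 'e) \<Rightarrow> delta_op_cell" where
  "diagram ob M m s = (\<lambda>i\<in>{..m}. ob (s i), \<lambda>(i, j)\<in>tri m. M (s i) (s j))"

lemma diagram_act:
  assumes "\<theta> \<in> Delta l m"
  shows "act Delta_op l m \<theta> (diagram ob M m s) = diagram ob M l (\<lambda>i\<in>{..l}. s (\<theta> i))"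
  using Delta_le[OF assms] Delta_mono[OF assms]
  by (auto simp: diagram_def act_Delta_op tri_def intro!: restrict_ext)

lemma diagram_cell:
  assumes s: "s \<in> cells (chain_cx r (Pow A)) m"
    and M: "\<And>x y. x \<in> A \<Longrightarrow> y \<in> A \<Longrightarrow> r x y \<Longrightarrow> M x y \<in> Delta (ob y) (ob x)"
    and M_id: "\<And>x. x \<in> A \<Longrightarrow> M x x = Delta_id (ob x)"
    and M_comp: "\<And>x y z i. x \<in> A \<Longrightarrow> y \<in> A \<Longrightarrow> z \<in> A \<Longrightarrow> r x y \<Longrightarrow> r y z \<Longrightarrow> r x z \<Longrightarrow> i \<le> ob z \<Longrightarrow>
      M x z i = M x y (M y z i)"
  shows "diagram ob M m s \<in> cells Delta_op m"
proof -
  have sA: "s i \<in> A" if "i \<le> m" for i using s that by (auto simp: mem_cx)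
  have sr: "r (s i) (s j)" if "i \<le> j" "j \<le> m" for i j using s that by (simp add: mem_cx)
  have "M (s i) (s k) = (\<lambda>x\<in>{..ob (s k)}. M (s i) (s j) (M (s j) (s k) x))"
    if "i \<le> j" "j \<le> k" "k \<le> m" for i j k
  proof (rule restrict_eqI[symmetric])
    show "M (s i) (s k) \<in> extensional {..ob (s k)}"
      using that by (intro Delta_extensional[OF M] sA sr) auto
    show "M (s i) (s j) (M (s j) (s k) x) = M (s i) (s k) x" if "x \<in> {..ob (s k)}" for x
      using \<open>i \<le> j\<close> \<open>j \<le> k\<close> \<open>k \<le> m\<close> that by (intro M_comp[symmetric] sA sr) auto
  qed
  then show ?thesis using M M_id sA sr by (simp add: diagram_def mem_Delta_op tri_def)
qed

text \<open>
The map \<open>g : [k] \<rightarrow> [n]\<close> as a functor from \<open>[1]\<close> to the opposite of the simplex category, to be used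
with \<open>diagram\<close>.
\<close>

definition edge_ob :: "nat \<Rightarrow> nat \<Rightarrow> nat \<Rightarrow> nat" where
  "edge_ob k n b = (if b = 0 then n else k)"

definition edge_mor :: "nat \<Rightarrow> nat \<Rightarrow> (nat \<Rightarrow> nat) \<Rightarrow> nat \<Rightarrow> nat \<Rightarrow> nat \<Rightarrow> nat" where
  "edge_mor k n g b b' = (if b < b' then g else Delta_id (edge_ob k n b))"

lemma act_op_edge:
  assumes "t \<in> Delta m 1"
  shows "act Delta_op m 1 t (op_edge k n g) = diagram (edge_ob k n) (edge_mor k n g) m t"
  unfolding op_edge_def act_Delta_op diagram_def
proof (intro arg_cong2[where f = Pair] restrict_ext)
  fix i assume "i \<in> {..m}"
  then show "(\<lambda>i\<in>{..1}. if i = 0 then n else k) (t i) = edge_ob k n (t i)"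
    using Delta_le[OF assms] by (simp add: edge_ob_def)
next
  fix ij assume "ij \<in> tri m"
  then obtain i j where ij: "ij = (i, j)" "i \<le> j" "j \<le> m" by (auto simp: tri_def)
  have "t i \<le> t j" "t j \<le> 1" using Delta_mono[OF assms ij(2,3)] Delta_le[OF assms ij(3)] .
  then show "(case ij of (i, j) \<Rightarrow> (\<lambda>(i, j)\<in>tri 1. if i < j then g else Delta_id (if i = 0 then n else k)) (t i, t j)) =
      (case ij of (i, j) \<Rightarrow> edge_mor k n g (t i) (t j))"
    using ij by (simp add: tri_def edge_mor_def edge_ob_def)
qed

lemma square_chain_proj:
  assumes "s \<in> cells (chain_cx prod_le (Pow square_shape)) m"
  shows "(\<lambda>i\<in>{..m}. fst (s i)) \<in> Delta m 1" "(\<lambda>i\<in>{..m}. snd (s i)) \<in> Delta m 1"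
  using assms by (fastforce simp: mem_cx mem_Delta rel_prod_sel square_shape_def)+

lemma naturality_square_apply:
  assumes "s \<in> cells (pnerve square_shape prod_le) m"
  shows "naturality_square f k n g m s =
    f m (\<lambda>i\<in>{..m}. fst (s i), diagram (edge_ob k n) (edge_mor k n g) m (\<lambda>i\<in>{..m}. snd (s i)))"
  using assms act_op_edge[OF square_chain_proj(2)] by (simp add: naturality_square_def pnerve_cx)

section \<open>The functor \<open>Q\<close>\<close>

lemma Q_mor_apply: "i \<le> 2 * m + 1 \<Longrightarrow>
    Q_mor m n \<theta> i = (if i \<le> m then n - \<theta> (m - i) else n + 1 + \<theta> (i - (m + 1)))"
  by (simp add: Q_mor_def Q_obj_def)

lemma Q_mor_mem:
  assumes \<theta>: "\<theta> \<in> Delta m n" shows "Q_mor m n \<theta> \<in> Delta (Q_obj m) (Q_obj n)"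
  unfolding mem_Delta
proof (intro conjI allI impI)
  show "Q_mor m n \<theta> \<in> extensional {..Q_obj m}" by (simp add: Q_mor_def)
  fix i assume "i \<le> Q_obj m"
  then show "Q_mor m n \<theta> i \<le> Q_obj n"
    using Delta_le[OF \<theta>, of "i - (m + 1)"] by (auto simp: Q_mor_apply Q_obj_def)
next
  fix i j assume ij: "i \<le> j \<and> j \<le> Q_obj m"
  have "\<theta> (m - j) \<le> \<theta> (m - i)" using ij by (intro Delta_mono[OF \<theta>]) auto
  moreover have "\<theta> (i - (m + 1)) \<le> \<theta> (j - (m + 1))" using ij by (intro Delta_mono[OF \<theta>]) (auto simp: Q_obj_def)
  ultimately show "Q_mor m n \<theta> i \<le> Q_mor m n \<theta> j"
    using ij by (auto simp: Q_mor_apply Q_obj_def)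
qed

lemma Q_mor_id: "Q_mor n n (Delta_id n) = Delta_id (Q_obj n)"
  unfolding Q_mor_def Delta_id_def[of "Q_obj n"]
  by (rule restrict_ext) (auto simp: Q_obj_def Delta_id_def)

lemma Q_mor_comp:
  assumes \<phi>: "\<phi> \<in> Delta l m" and i: "i \<le> Q_obj l"
  shows "Q_mor l n (\<lambda>x\<in>{..l}. \<theta> (\<phi> x)) i = Q_mor m n \<theta> (Q_mor l m \<phi> i)"
proof (cases "i \<le> l")
  case True
  then have "m - (m - \<phi> (l - i)) = \<phi> (l - i)" using Delta_le[OF \<phi>, of "l - i"] by simp
  then show ?thesis using True by (simp add: Q_mor_apply)
next
  case False
  then have il: "i - (l + 1) \<le> l" using i by (simp add: Q_obj_def)
  from Delta_le[OF \<phi> this] have "\<phi> (i - (l + 1)) \<le> m" .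
  then show ?thesis using False i il by (simp add: Q_mor_apply Q_obj_def)
qed

lemma Q_edge_ob: "Q_obj (edge_ob k n b) = edge_ob (Q_obj k) (Q_obj n) b"
  by (simp add: edge_ob_def)

lemma Q_edge_mor:
  assumes "b \<le> b'" "b' \<le> 1"
  shows "Q_mor (edge_ob k n b') (edge_ob k n b) (edge_mor k n g b b') =
    edge_mor (Q_obj k) (Q_obj n) (Q_mor k n g) b b'"
proof (cases "b < b'")
  case True
  then show ?thesis using assms by (simp add: edge_mor_def edge_ob_def)
next
  case False
  then have "b' = b" using assms by simp
  then show ?thesis by (simp add: edge_mor_def Q_mor_id Q_edge_ob)
qed

lemma edge_mor_mem:
  assumes "g \<in> Delta k n" "b \<le> b'" "b' \<le> 1"
  shows "edge_mor k n g b b' \<in> Delta (edge_ob k n b') (edge_ob k n b)"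
  using assms Delta_id_mem by (cases "b < b'") (auto simp: edge_mor_def edge_ob_def)

lemma edge_mor_comp:
  assumes g: "g \<in> Delta k n" and b: "b \<le> b'" "b' \<le> b''" "b'' \<le> 1"
  shows "edge_mor k n g b b'' = (\<lambda>i\<in>{..edge_ob k n b''}. edge_mor k n g b b' (edge_mor k n g b' b'' i))"
proof -
  have "b = b' \<or> b' = b''" using b by linarith
  then show ?thesis
  proof
    assume [simp]: "b = b'"
    show ?thesis using Delta_id_comp[OF edge_mor_mem[OF g b(2,3)]] by (simp add: edge_mor_def[of _ _ _ b' b'])
  next
    assume [simp]: "b' = b''"
    show ?thesis using Delta_comp_id[OF edge_mor_mem[OF g b(1)]] b
      by (simp add: edge_mor_def[of _ _ _ b'' b''])
  qed
qed

text \<open>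
Applying \<open>Q\<close> to the edge given by \<open>g\<close> gives the edge given by \<open>Q(g)\<close>.
\<close>

lemma naturality_square_Sd:
  assumes g: "g \<in> Delta k n"
  shows "naturality_square (Sd 1 f) k n g = naturality_square f (Q_obj k) (Q_obj n) (Q_mor k n g)"
proof (rule ext, rule ext)
  fix m s
  show "naturality_square (Sd 1 f) k n g m s = naturality_square f (Q_obj k) (Q_obj n) (Q_mor k n g) m s"
  proof (cases "s \<in> cells (pnerve square_shape prod_le) m")
    case s: True
    let ?a = "\<lambda>i\<in>{..m}. fst (s i)" and ?t = "\<lambda>i\<in>{..m}. snd (s i)"
    let ?D = "diagram (edge_ob k n) (edge_mor k n g) m ?t"
    have at: "?a \<in> Delta m 1" "?t \<in> Delta m 1" using square_chain_proj s by (auto simp: pnerve_cx)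
    have "?D \<in> cells Delta_op m"
    proof (rule diagram_cell)
      show "?t \<in> cells (chain_cx (\<le>) (Pow {..1})) m" using at(2) by (simp add: cells_simplex flip: simplex_cx)
    next
      fix x y assume "x \<in> {..1::nat}" "y \<in> {..1::nat}" "x \<le> y"
      then show "edge_mor k n g x y \<in> Delta (edge_ob k n y) (edge_ob k n x)" by (intro edge_mor_mem[OF g]) auto
    next
      fix x y z i :: nat assume "x \<in> {..1}" "y \<in> {..1}" "z \<in> {..1}" "x \<le> y" "y \<le> z" "i \<le> edge_ob k n z"
      then show "edge_mor k n g x z i = edge_mor k n g x y (edge_mor k n g y z i)"
        using edge_mor_comp[OF g, of x y z] by simp
    qed (simp add: edge_mor_def)
    then have e1: "Sd 1 f m (?a, ?D) = f m (?a, Q_op m ?D)"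
      using at(1) by (simp add: Sd_def precomp_def cells_simplex)
    have e2: "Q_op m ?D = diagram (edge_ob (Q_obj k) (Q_obj n)) (edge_mor (Q_obj k) (Q_obj n) (Q_mor k n g)) m ?t"
      unfolding Q_op_def nerve_map_def diagram_def prod.case
    proof (intro arg_cong2[where f = Pair] restrict_ext)
      fix i assume "i \<in> {..m}"
      then show "Q_obj ((\<lambda>i\<in>{..m}. edge_ob k n (?t i)) i) = edge_ob (Q_obj k) (Q_obj n) (?t i)"
        by (simp add: Q_edge_ob)
    next
      fix ij assume ij: "ij \<in> tri m"
      obtain i j where [simp]: "ij = (i, j)" by (cases ij)
      have le: "i \<le> j" "j \<le> m" using ij by (auto simp: tri_def)
      have "?t i \<le> ?t j" "?t j \<le> 1" using Delta_mono[OF at(2) le] Delta_le[OF at(2) le(2)] .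
      then show "(case ij of (i, j) \<Rightarrow> Q_mor ((\<lambda>i\<in>{..m}. edge_ob k n (?t i)) j) ((\<lambda>i\<in>{..m}. edge_ob k n (?t i)) i)
            ((\<lambda>(i, j)\<in>tri m. edge_mor k n g (?t i) (?t j)) (i, j))) =
          (case ij of (i, j) \<Rightarrow> edge_mor (Q_obj k) (Q_obj n) (Q_mor k n g) (?t i) (?t j))"
        using ij le Q_edge_mor[of "?t i" "?t j" k n g] by simp
    qed
    show ?thesis unfolding naturality_square_apply[OF s] e1 e2 ..
  qed (simp add: naturality_square_def)
qed

section \<open>Active maps as retracts\<close>

text \<open>
The retraction of \<open>Q(g)\<close> onto \<open>g\<close>, as a functor from \<open>[2] \<times> [1]\<close> to the opposite of the simplex
category: level \<open>1\<close> is \<open>Q(g)\<close>, and the levels \<open>0\<close> and \<open>2\<close> are \<open>g\<close>.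
\<close>

definition retract_ob :: "nat \<Rightarrow> nat \<Rightarrow> nat \<times> nat \<Rightarrow> nat" where
  "retract_ob k n = (\<lambda>(l, b). if l = 1 then Q_obj (edge_ob k n b) else edge_ob k n b)"

text \<open>
Entering level \<open>1\<close> from level \<open>0\<close> is the retraction \<open>[2N+1] \<rightarrow> [N]\<close>, which collapses the first half
to \<open>0\<close>; this is truncated subtraction of \<open>N + 1\<close>. Leaving level \<open>1\<close> is the inclusion of
the second half, which adds \<open>N + 1\<close>.
\<close>

definition retract_mor :: "nat \<Rightarrow> nat \<Rightarrow> (nat \<Rightarrow> nat) \<Rightarrow> nat \<times> nat \<Rightarrow> nat \<times> nat \<Rightarrow> nat \<Rightarrow> nat" where
  "retract_mor k n g = (\<lambda>(l, b) (l', b'). \<lambda>i\<in>{..retract_ob k n (l', b')}.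
     let N = edge_ob k n b; N' = edge_ob k n b'; \<gamma> = edge_mor k n g b b' in
     if l' = 1 then if l = 1 then Q_mor N' N \<gamma> i else Q_mor N' N \<gamma> i - (N + 1)
     else if l = 1 then N + 1 + \<gamma> i else \<gamma> i)"

lemma retract_mor_mem:
  assumes g: "g \<in> Delta k n" and b: "b \<le> b'" "b' \<le> 1"
  shows "retract_mor k n g (l, b) (l', b') \<in> Delta (retract_ob k n (l', b')) (retract_ob k n (l, b))"
proof -
  let ?N = "edge_ob k n b" and ?N' = "edge_ob k n b'" and ?\<gamma> = "edge_mor k n g b b'"
  have \<gamma>: "?\<gamma> \<in> Delta ?N' ?N" by (rule edge_mor_mem[OF g b])
  have Q: "Q_mor ?N' ?N ?\<gamma> \<in> Delta (Q_obj ?N') (Q_obj ?N)" by (rule Q_mor_mem[OF \<gamma>])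
  let ?m = "retract_mor k n g (l, b) (l', b')"
  have Q2: "Q_mor ?N' ?N ?\<gamma> i - (?N + 1) \<le> ?N" if "i \<le> Q_obj ?N'" for i
    using Delta_le[OF Q that] by (simp add: Q_obj_def)
  have Q3: "Q_mor ?N' ?N ?\<gamma> i - (?N + 1) \<le> Q_mor ?N' ?N ?\<gamma> j - (?N + 1)" if "i \<le> j" "j \<le> Q_obj ?N'" for i j
    using Delta_mono[OF Q that] by (rule diff_le_mono)
  have "?m i \<le> retract_ob k n (l, b)" if "i \<le> retract_ob k n (l', b')" for i
    using that Delta_le[OF \<gamma>, of i] Delta_le[OF Q, of i] Q2[of i]
    by (auto simp: retract_mor_def retract_ob_def Let_def Q_obj_def)
  moreover have "?m i \<le> ?m j" if "i \<le> j" "j \<le> retract_ob k n (l', b')" for i j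
    using that Delta_mono[OF \<gamma>, of i j] Delta_mono[OF Q, of i j] Q3[of i j]
    by (cases "l' = 1"; cases "l = 1") (simp_all add: retract_mor_def retract_ob_def Let_def)
  moreover have "?m \<in> extensional {..retract_ob k n (l', b')}" by (simp add: retract_mor_def)
  ultimately show ?thesis unfolding mem_Delta by blast
qed

lemma Delta_id_apply: "i \<le> n \<Longrightarrow> Delta_id n i = i"
  by (simp add: Delta_id_def)

lemma retract_mor_id: "retract_mor k n g (l, b) (l, b) = Delta_id (retract_ob k n (l, b))"
  unfolding Delta_id_def retract_mor_def prod.case
proof (rule restrict_ext)
  fix i assume "i \<in> {..retract_ob k n (l, b)}"
  then show "(let N = edge_ob k n b; N' = edge_ob k n b; \<gamma> = edge_mor k n g b b in
     if l = 1 then if l = 1 then Q_mor N' N \<gamma> i else Q_mor N' N \<gamma> i - (N + 1)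
     else if l = 1 then N + 1 + \<gamma> i else \<gamma> i) = i"
    by (cases "l = 1") (simp_all add: Let_def edge_mor_def Q_mor_id retract_ob_def Delta_id_apply)
qed

text \<open>
Naturality of the retraction, in the case of the levels \<open>0\<close>, \<open>0\<close>, \<open>1\<close>, is where \<open>g 0 = 0\<close> enters:
the first half of \<open>[2N+1]\<close> is collapsed to \<open>0\<close>, which \<open>g\<close> has to preserve.
\<close>

lemma retract_mor_comp:
  assumes g: "g \<in> Delta k n" and g0: "g 0 = 0" and b: "b \<le> b'" "b' \<le> b''" "b'' \<le> 1"
    and l: "l \<le> l'" "l' \<le> l''" and i: "i \<le> retract_ob k n (l'', b'')"
  shows "retract_mor k n g (l, b) (l'', b'') i = retract_mor k n g (l, b) (l', b') (retract_mor k n g (l', b') (l'', b'') i)"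
proof -
  let ?N = "edge_ob k n b" and ?N' = "edge_ob k n b'" and ?N'' = "edge_ob k n b''"
  let ?\<gamma> = "edge_mor k n g b b'" and ?\<gamma>' = "edge_mor k n g b' b''" and ?\<gamma>'' = "edge_mor k n g b b''"
  have \<gamma>: "?\<gamma> \<in> Delta ?N' ?N" and \<gamma>': "?\<gamma>' \<in> Delta ?N'' ?N'"
    using edge_mor_mem[OF g] b by auto
  have \<gamma>0: "?\<gamma> 0 = 0" using g0 by (auto simp: edge_mor_def Delta_id_def)
  have comp: "?\<gamma>'' = (\<lambda>i\<in>{..?N''}. ?\<gamma> (?\<gamma>' i))" by (rule edge_mor_comp[OF g b])
  have Qcomp: "Q_mor ?N'' ?N ?\<gamma>'' i = Q_mor ?N' ?N ?\<gamma> (Q_mor ?N'' ?N' ?\<gamma>' i)" if "i \<le> Q_obj ?N''"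
    unfolding comp by (rule Q_mor_comp[OF \<gamma>' that])
  show ?thesis
  proof (cases "l'' = 1")
    case False
    then have i': "i \<le> ?N''" using i by (simp add: retract_ob_def)
    have le: "?\<gamma>' i \<le> ?N'" by (rule Delta_le[OF \<gamma>' i'])
    show ?thesis
    proof (cases "l' = 1")
      case True
      have "Q_mor ?N' ?N ?\<gamma> (?N' + 1 + ?\<gamma>' i) = ?N + 1 + ?\<gamma> (?\<gamma>' i)"
        using le by (simp add: Q_mor_apply)
      then show ?thesis using False True i' le comp
        by (simp add: retract_mor_def retract_ob_def Let_def Q_obj_def)
    next
      case no: False
      then show ?thesis using False i' le comp by (simp add: retract_mor_def retract_ob_def Let_def)
    qed
  next
    case l'': True
    then have i': "i \<le> Q_obj ?N''" using i by (simp add: retract_ob_def)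
    have Qle: "Q_mor ?N'' ?N' ?\<gamma>' i \<le> Q_obj ?N'" by (rule Delta_le[OF Q_mor_mem[OF \<gamma>'] i'])
    show ?thesis
    proof (cases "l' = 1")
      case True
      then show ?thesis using l'' i' Qle Qcomp[OF i'] by (simp add: retract_mor_def retract_ob_def Let_def)
    next
      case False
      then have l0: "l' = 0" "l = 0" using l l'' by auto
      let ?v = "Q_mor ?N'' ?N' ?\<gamma>' i - (?N' + 1)"
      have v: "?v \<le> ?N'" using Qle by (simp add: Q_obj_def)
      have "Q_mor ?N'' ?N ?\<gamma>'' i - (?N + 1) = ?\<gamma> ?v"
      proof (cases "i \<le> ?N''")
        case True
        then show ?thesis using \<gamma>0 by (simp add: Q_mor_apply)
      next
        case no: False
        then have "i - (?N'' + 1) \<le> ?N''" using i' by (simp add: Q_obj_def)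
        then show ?thesis using no i' comp by (simp add: Q_mor_apply Q_obj_def)
      qed
      then show ?thesis using l0 l'' i' v by (simp add: retract_mor_def retract_ob_def Let_def)
    qed
  qed
qed

text \<open>
Evaluating \<open>f\<close> on the retraction of \<open>Q(g)\<close> onto \<open>g\<close> exhibits the naturality square at \<open>g\<close> as a
retract of the one at \<open>Q(g)\<close>.
\<close>

lemma cartesian_retract:
  fixes f :: "'a sspaces_cell"
  assumes f: "f \<in> cells sspaces 1" and g: "g \<in> Delta k n" and g0: "g 0 = 0"
    and cart: "cartesian_on f (Q_obj k) (Q_obj n) (Q_mor k n g)"
  shows "cartesian_on f k n g"
proof -
  let ?r = "rel_prod (\<le>) prod_le :: nat \<times> nat \<times> nat \<Rightarrow> nat \<times> nat \<times> nat \<Rightarrow> bool"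
  let ?A = "{..2} \<times> square_shape"
  have f': "f \<in> smap (sprod (simplex 1) Delta_op) spaces" using f by (simp add: sspaces_def cells_shom)
  define lb :: "nat \<times> nat \<times> nat \<Rightarrow> nat \<times> nat" where "lb = (\<lambda>(l, a, b). (l, b))"
  define \<alpha> where "\<alpha> m s = (\<lambda>i\<in>{..m}. fst (snd (s i)))" for m :: nat and s :: "nat \<Rightarrow> nat \<times> nat \<times> nat"
  define D where "D m s = diagram (\<lambda>x. retract_ob k n (lb x)) (\<lambda>x y. retract_mor k n g (lb x) (lb y)) m s"
    for m and s :: "nat \<Rightarrow> nat \<times> nat \<times> nat"
  define R where "R = (\<lambda>m. \<lambda>s\<in>cells (chain_cx ?r (Pow ?A)) m. f m (\<alpha> m s, D m s))"
  have \<alpha>: "\<alpha> m s \<in> Delta m 1" if "s \<in> cells (chain_cx ?r (Pow ?A)) m" for m s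
    using that by (fastforce simp: \<alpha>_def mem_cx mem_Delta rel_prod_sel square_shape_def)
  have D: "D m s \<in> cells Delta_op m" if s: "s \<in> cells (chain_cx ?r (Pow ?A)) m" for m s
    unfolding D_def
  proof (rule diagram_cell[OF s])
    fix x y assume "x \<in> ?A" "y \<in> ?A" "?r x y"
    then show "retract_mor k n g (lb x) (lb y) \<in> Delta (retract_ob k n (lb y)) (retract_ob k n (lb x))"
      by (cases x; cases y) (auto simp: lb_def square_shape_def intro!: retract_mor_mem[OF g])
  next
    fix x show "retract_mor k n g (lb x) (lb x) = Delta_id (retract_ob k n (lb x))"
      by (cases "lb x") (simp add: retract_mor_id)
  next
    fix x y z i assume "x \<in> ?A" "y \<in> ?A" "z \<in> ?A" "?r x y" "?r y z" "i \<le> retract_ob k n (lb z)"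
    then show "retract_mor k n g (lb x) (lb z) i = retract_mor k n g (lb x) (lb y) (retract_mor k n g (lb y) (lb z) i)"
      by (cases x; cases y; cases z) (auto simp: lb_def square_shape_def intro!: retract_mor_comp[OF g g0])
  qed
  have R: "R \<in> smap (chain_cx ?r (Pow ?A)) spaces"
  proof (rule smapI)
    fix m s assume s: "s \<in> cells (chain_cx ?r (Pow ?A)) m"
    show "R m s \<in> cells spaces m"
      using smap_cell[OF f', of "(\<alpha> m s, D m s)"] \<alpha>[OF s] D[OF s] s
      by (simp add: R_def mem_sprod cells_simplex)
  next
    fix l m \<phi> s assume \<phi>: "\<phi> \<in> Delta l m" and s: "s \<in> cells (chain_cx ?r (Pow ?A)) m"
    let ?u = "\<lambda>i\<in>{..l}. s (\<phi> i)"
    have u: "?u \<in> cells (chain_cx ?r (Pow ?A)) l" by (rule cx_act_mem[OF down_closed_Pow s \<phi>])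
    have "\<alpha> l ?u = act (simplex 1) l m \<phi> (\<alpha> m s)"
      using Delta_le[OF \<phi>] by (auto simp: \<alpha>_def act_simplex intro!: restrict_ext)
    moreover have "D l ?u = act Delta_op l m \<phi> (D m s)" unfolding D_def by (rule diagram_act[OF \<phi>, symmetric])
    ultimately have "f l (\<alpha> l ?u, D l ?u) = act spaces l m \<phi> (f m (\<alpha> m s, D m s))"
      using smap_act[OF f' \<phi>, of "(\<alpha> m s, D m s)"] \<alpha>[OF s] D[OF s]
      by (simp add: mem_sprod cells_simplex act_sprod)
    then show "R l (act (chain_cx ?r (Pow ?A)) l m \<phi> s) = act spaces l m \<phi> (R m s)"
      using s u by (simp add: R_def act_cx)
  qed (simp add: R_def)
  have R_outer: "R m s = naturality_square f k n g m (\<lambda>i\<in>{..m}. snd (s i))"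
    if s: "s \<in> cells (chain_cx ?r (Pow ({0, 2} \<times> square_shape))) m" for m s
  proof -
    have sA: "s \<in> cells (chain_cx ?r (Pow ?A)) m" by (rule cx_mono[OF s]) auto
    let ?q = "\<lambda>i\<in>{..m}. snd (s i)"
    have q: "?q \<in> cells (pnerve square_shape prod_le) m"
      unfolding pnerve_cx by (rule map_cells[OF s]) auto
    have mem: "s i \<in> {0, 2} \<times> square_shape" if "i \<le> m" for i using s that by (auto simp: mem_cx)
    have mono: "?r (s i) (s j)" if "i \<le> j" "j \<le> m" for i j using s that by (simp add: mem_cx)
    have "D m s = diagram (edge_ob k n) (edge_mor k n g) m (\<lambda>i\<in>{..m}. snd (?q i))"
      unfolding D_def diagram_def
    proof (intro arg_cong2[where f = Pair] restrict_ext)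
      fix i assume "i \<in> {..m}"
      then show "retract_ob k n (lb (s i)) = edge_ob k n ((\<lambda>i\<in>{..m}. snd (?q i)) i)"
        using mem[of i] by (cases "s i") (auto simp: retract_ob_def lb_def)
    next
      fix ij assume "ij \<in> tri m"
      then obtain i j where ij: "ij = (i, j)" "i \<le> j" "j \<le> m" by (auto simp: tri_def)
      obtain l a b l' a' b' where e: "s i = (l, a, b)" "s j = (l', a', b')" by (metis prod_cases3)
      have b: "b \<le> b'" "b' \<le> 1" and l: "l \<noteq> 1" "l' \<noteq> 1"
        using mono[OF ij(2,3)] mem[of i] mem[OF ij(3)] ij e by (auto simp: square_shape_def)
      have "retract_mor k n g (l, b) (l', b') = edge_mor k n g b b'"
        unfolding retract_mor_def prod.case
        by (rule restrict_eqI)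
          (use Delta_extensional[OF edge_mor_mem[OF g b]] l in \<open>auto simp: retract_ob_def Let_def\<close>)
      then show "(case ij of (i, j) \<Rightarrow> retract_mor k n g (lb (s i)) (lb (s j))) =
        (case ij of (i, j) \<Rightarrow> edge_mor k n g ((\<lambda>i\<in>{..m}. snd (?q i)) i) ((\<lambda>i\<in>{..m}. snd (?q i)) j))"
        using ij e by (simp add: lb_def)
    qed
    moreover have "\<alpha> m s = (\<lambda>i\<in>{..m}. fst (?q i))" unfolding \<alpha>_def by (rule restrict_ext) simp
    ultimately show ?thesis using sA naturality_square_apply[OF q, of f k n g] by (simp add: R_def)
  qed
  have R_middle: "R m (\<lambda>i\<in>{..m}. (1, s i)) = naturality_square f (Q_obj k) (Q_obj n) (Q_mor k n g) m s"
    if s: "s \<in> cells (pnerve square_shape prod_le) m" for m s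
  proof -
    let ?u = "\<lambda>i\<in>{..m}. (1 :: nat, s i)"
    have u: "?u \<in> cells (chain_cx ?r (Pow ?A)) m"
      by (rule map_cells[OF s[unfolded pnerve_cx]]) auto
    have mem: "s i \<in> square_shape" if "i \<le> m" for i using s that by (auto simp: mem_cx pnerve_cx)
    have mono: "prod_le (s i) (s j)" if "i \<le> j" "j \<le> m" for i j using s that by (simp add: mem_cx pnerve_cx)
    have "D m ?u = diagram (edge_ob (Q_obj k) (Q_obj n)) (edge_mor (Q_obj k) (Q_obj n) (Q_mor k n g)) m (\<lambda>i\<in>{..m}. snd (s i))"
      unfolding D_def diagram_def
    proof (intro arg_cong2[where f = Pair] restrict_ext)
      fix i assume "i \<in> {..m}"
      then show "retract_ob k n (lb (?u i)) = edge_ob (Q_obj k) (Q_obj n) ((\<lambda>i\<in>{..m}. snd (s i)) i)"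
        by (cases "s i") (auto simp: retract_ob_def lb_def Q_edge_ob)
    next
      fix ij assume "ij \<in> tri m"
      then obtain i j where ij: "ij = (i, j)" "i \<le> j" "j \<le> m" by (auto simp: tri_def)
      obtain a b a' b' where e: "s i = (a, b)" "s j = (a', b')" by (metis surj_pair)
      have b: "b \<le> b'" "b' \<le> 1" using mono[OF ij(2,3)] mem[OF ij(3)] e by (auto simp: square_shape_def)
      have "retract_mor k n g (1, b) (1, b') = Q_mor (edge_ob k n b') (edge_ob k n b) (edge_mor k n g b b')"
        unfolding retract_mor_def prod.case
        by (rule restrict_eqI)
          (use Delta_extensional[OF Q_mor_mem[OF edge_mor_mem[OF g b]]] in \<open>auto simp: retract_ob_def Let_def\<close>)
      then show "(case ij of (i, j) \<Rightarrow> retract_mor k n g (lb (?u i)) (lb (?u j))) =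
        (case ij of (i, j) \<Rightarrow> edge_mor (Q_obj k) (Q_obj n) (Q_mor k n g) ((\<lambda>i\<in>{..m}. snd (s i)) i) ((\<lambda>i\<in>{..m}. snd (s i)) j))"
        using ij e Q_edge_mor[OF b, of k n g] by (simp add: lb_def)
    qed
    moreover have "\<alpha> m ?u = (\<lambda>i\<in>{..m}. fst (s i))" unfolding \<alpha>_def by (rule restrict_ext) simp
    ultimately show ?thesis using u naturality_square_apply[OF s, of f] by (simp add: R_def)
  qed
  have q: "naturality_square f k n g \<in> smap (pnerve square_shape prod_le) spaces"
  proof -
    have p: "pull prod_le (Pow square_shape) (\<lambda>x. (0, x)) R \<in> smap (chain_cx prod_le (Pow square_shape)) spaces"
      by (rule pull_smap[OF R down_closed_Pow]) auto
    moreover have "pull prod_le (Pow square_shape) (\<lambda>x. (0, x)) R = naturality_square f k n g"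
    proof (rule ext, rule ext)
      fix m s
      show "pull prod_le (Pow square_shape) (\<lambda>x. (0, x)) R m s = naturality_square f k n g m s"
      proof (cases "s \<in> cells (pnerve square_shape prod_le) m")
        case s: True
        let ?u = "\<lambda>i\<in>{..m}. (0 :: nat, s i)"
        have "?u \<in> cells (chain_cx ?r (Pow ({0, 2} \<times> square_shape))) m"
          by (rule map_cells[OF s[unfolded pnerve_cx]]) auto
        moreover have "(\<lambda>i\<in>{..m}. snd (?u i)) = s"
          using s by (intro restrict_eqI) (auto simp: mem_cx pnerve_cx)
        ultimately show ?thesis using R_outer[of ?u m] s by (simp add: pull_def pnerve_cx)
      qed (simp add: pull_def naturality_square_def pnerve_cx)
    qed
    ultimately show ?thesis by (simp add: pnerve_cx)
  qed
  show ?thesis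
    unfolding cartesian_on_def
    by (rule pullback_retract[OF spaces_inner_fills R q cart[unfolded cartesian_on_def] R_middle R_outer])
qed

theorem lemma5p3:
  fixes X Y f :: "'a sspaces_cell"
  assumes "Y \<in> cells sspaces 0" and "X \<in> cells sspaces 0"
    and "f \<in> sspace_maps Y X"
  shows "culf f \<longleftrightarrow> right_fibration (Sd 1 f)"
proof -
  have f: "f \<in> cells sspaces 1" using assms(3) by (simp add: sspace_maps_def)
  have Sd: "cartesian_on (Sd 1 f) k n l \<longleftrightarrow> cartesian_on f (Q_obj k) (Q_obj n) (Q_mor k n l)"
    if "l \<in> Delta k n" for k n l
    using naturality_square_Sd[OF that, of f] by (simp add: cartesian_on_def)
  show ?thesis
  proof
    assume c: "culf f"
    show "right_fibration (Sd 1 f)"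
      unfolding right_fibration_def
    proof (intro allI ballI impI)
      fix m n l assume l: "l \<in> Delta m n" and last: "l m = n"
      have "Q_mor m n l 0 = 0" "Q_mor m n l (Q_obj m) = Q_obj n"
        using last by (simp_all add: Q_mor_def Q_obj_def)
      then show "cartesian_on (Sd 1 f) m n l"
        using c Q_mor_mem[OF l] Sd[OF l] unfolding culf_def by blast
    qed
  next
    assume r: "right_fibration (Sd 1 f)"
    show "culf f"
      unfolding culf_def
    proof (intro allI ballI impI)
      fix k n g assume g: "g \<in> Delta k n" and ends: "g 0 = 0 \<and> g k = n"
      then have "cartesian_on (Sd 1 f) k n g" using r unfolding right_fibration_def by blast
      then show "cartesian_on f k n g" using cartesian_retract[OF f g] ends Sd[OF g] by metis
    qed
  qed
qed

end
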